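(* For all integers $d,k\ge3$, the operator systems $\mathrm{NC}(d)$ and $\mathrm{NCP}(k)$ admit factorial representations of type $\mathrm{II}_1$ and of type $\mathrm{II}_\infty$.
   Context: $\mathrm{NC}(d)=\mathrm{Span}\{1,u_1,\dots,u_d\}\subseteq\mathrm C^*( *_1^d\mathbb Z_2)$, where $u_1,\dots,u_d$ are the canonical generating symmetries of the full group C$^*$-algebra of the free product of $d$ copies of $\mathbb Z_2$. $\mathrm{NCP}(k)=\mathrm{Span}\{1,w,\dots,w^{k-1},v\}\subseteq\mathrm C^*(\mathbb Z_k*\mathbb Z_2)$, where $w,v$ are the canonical unitaries from the generators of $\mathbb Z_k$ and $\mathbb Z_2$. For an operator system $\mathcal R$ that is one of these, contained in the corresponding group C$^*$-algebra $\mathrm C^*(G)$, a unital completely positive map $\phi:\mathcal R\to\mathcal B(\mathcal H)$ is factorial if the von Neumann algebra $\phi(\mathcal R)''$ is a factor; if $\phi$ extends to a $*$-representation $\pi:\mathrm C^*(G)\to\mathcal B(\mathcal H)$, then $\pi$ is called a factorial representation, and its type is that of the factor $\phi(\mathcal R)''$. *)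

theory Defs
  imports "HOL-Analysis.Analysis" "HOL-Algebra.Elementary_Groups" "HOL-Algebra.Ring"
    "HOL-Library.Function_Algebras"
begin

section \<open>Complex Hilbert spaces\<close>

class complex_vector = ab_group_add +
  fixes scaleC :: "complex \<Rightarrow> 'a \<Rightarrow> 'a"  (infixr \<open>*\<^sub>C\<close> 75)
  assumes scaleC_add_right: "c *\<^sub>C (x + y) = c *\<^sub>C x + c *\<^sub>C y"
    and scaleC_add_left: "(c + d) *\<^sub>C x = c *\<^sub>C x + d *\<^sub>C x"
    and scaleC_scaleC: "c *\<^sub>C (d *\<^sub>C x) = (c * d) *\<^sub>C x"
    and scaleC_one: "1 *\<^sub>C x = x"

global_interpretation complex_vector: vector_space "scaleC :: complex \<Rightarrow> 'a \<Rightarrow> 'a::complex_vector"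
  defines cspan = complex_vector.span
  by unfold_locales (simp_all add: scaleC_add_right scaleC_add_left scaleC_scaleC scaleC_one)

text \<open>The complex inner product is linear in its first argument. Its real part is the inner product
  of the underlying real Hilbert space, which provides positive definiteness, the norm and the
  topology.\<close>

class complex_hilbert_space = complex_vector + real_inner + complete_space +
  fixes cinner :: "'a \<Rightarrow> 'a \<Rightarrow> complex"
  assumes scaleC_of_real: "complex_of_real r *\<^sub>C x = r *\<^sub>R x"
    and cinner_add_left: "cinner (x + y) z = cinner x z + cinner y z"
    and cinner_scaleC_left: "cinner (c *\<^sub>C x) y = c * cinner x y"
    and cinner_commute: "cinner x y = cnj (cinner y x)"
    and inner_eq_Re_cinner: "inner x y = Re (cinner x y)"

lemma cinner_scaleC_right: "cinner x (c *\<^sub>C y) = cnj c * cinner x (y::'a::complex_hilbert_space)"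
  by (metis cinner_commute cinner_scaleC_left complex_cnj_cnj complex_cnj_mult)

lemma norm_scaleC: "norm (c *\<^sub>C x) = cmod c * norm (x::'a::complex_hilbert_space)"
proof -
  have "cinner (c *\<^sub>C x) (c *\<^sub>C x) = (c * cnj c) * cinner x x"
    by (simp add: cinner_scaleC_left cinner_scaleC_right)
  then have "cinner (c *\<^sub>C x) (c *\<^sub>C x) = of_real ((cmod c)\<^sup>2) * cinner x x"
    by (simp only: complex_norm_square)
  then have "inner (c *\<^sub>C x) (c *\<^sub>C x) = (cmod c)\<^sup>2 * inner x x"
    by (simp add: inner_eq_Re_cinner del: of_real_power)
  then show ?thesis
    by (simp add: norm_eq_sqrt_inner real_sqrt_mult)
qed

lemma bounded_linear_scaleC: "bounded_linear (\<lambda>x::'a::complex_hilbert_space. c *\<^sub>C x)"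
proof (rule bounded_linear_intro [where K = "cmod c"])
  fix r :: real and x :: 'a
  show "c *\<^sub>C (r *\<^sub>R x) = r *\<^sub>R (c *\<^sub>C x)"
    by (simp add: scaleC_of_real [symmetric] scaleC_scaleC mult.commute)
qed (simp_all add: scaleC_add_right norm_scaleC mult.commute)

instantiation "fun" :: (type, complex_vector) complex_vector
begin
definition scaleC_fun :: "complex \<Rightarrow> ('a \<Rightarrow> 'b) \<Rightarrow> 'a \<Rightarrow> 'b"
  where "scaleC_fun c f = (\<lambda>x. c *\<^sub>C f x)"
instance
  by standard
    (simp_all add: scaleC_fun_def fun_eq_iff scaleC_add_right scaleC_add_left scaleC_scaleC scaleC_one)
end

instantiation blinfun :: (real_normed_vector, complex_hilbert_space) complex_vector
begin
lift_definition scaleC_blinfun :: "complex \<Rightarrow> ('a \<Rightarrow>\<^sub>L 'b) \<Rightarrow> 'a \<Rightarrow>\<^sub>L 'b"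
  is "\<lambda>c T x. c *\<^sub>C T x"
  by (rule bounded_linear_compose [OF bounded_linear_scaleC])
instance
  by standard
    (transfer; simp add: fun_eq_iff scaleC_add_right scaleC_add_left scaleC_scaleC scaleC_one)+
end


section \<open>The Hilbert space of square-summable families\<close>

typedef 'i ell2 = "{f :: 'i \<Rightarrow> complex. (\<lambda>i. (cmod (f i))\<^sup>2) summable_on UNIV}"
  morphisms ell2_apply Abs_ell2
  by (rule exI [of _ "\<lambda>_. 0"]) simp

setup_lifting type_definition_ell2

lemma cmod_add_sq: "(cmod (a + b))\<^sup>2 \<le> 2 * (cmod a)\<^sup>2 + 2 * (cmod b)\<^sup>2"
proof -
  have "(cmod (a + b))\<^sup>2 \<le> (cmod a + cmod b)\<^sup>2"
    by (simp add: norm_triangle_ineq power_mono)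
  also have "\<dots> \<le> 2 * (cmod a)\<^sup>2 + 2 * (cmod b)\<^sup>2"
    using sum_squares_bound [of "cmod a" "cmod b"] by (simp add: power2_sum)
  finally show ?thesis .
qed

lemma sq_summable_add:
  fixes f g :: "'i \<Rightarrow> complex"
  assumes "(\<lambda>i. (cmod (f i))\<^sup>2) summable_on UNIV" "(\<lambda>i. (cmod (g i))\<^sup>2) summable_on UNIV"
  shows "(\<lambda>i. (cmod (f i + g i))\<^sup>2) summable_on UNIV"
proof (rule summable_on_comparison_test)
  show "(\<lambda>i. 2 * (cmod (f i))\<^sup>2 + 2 * (cmod (g i))\<^sup>2) summable_on UNIV"
    by (intro summable_on_add summable_on_cmult_right assms)
qed (use cmod_add_sq in auto)

lemma sq_summable_scale:
  fixes f :: "'i \<Rightarrow> complex"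
  assumes "(\<lambda>i. (cmod (f i))\<^sup>2) summable_on UNIV"
  shows "(\<lambda>i. (cmod (c * f i))\<^sup>2) summable_on UNIV"
  unfolding norm_mult power_mult_distrib by (intro summable_on_cmult_right assms)

lemma sq_summable_prod:
  fixes f g :: "'i \<Rightarrow> complex"
  assumes "(\<lambda>i. (cmod (f i))\<^sup>2) summable_on UNIV" "(\<lambda>i. (cmod (g i))\<^sup>2) summable_on UNIV"
  shows "(\<lambda>i. f i * cnj (g i)) summable_on UNIV"
proof (rule abs_summable_summable [OF summable_on_comparison_test])
  show "(\<lambda>i. (cmod (f i))\<^sup>2 + (cmod (g i))\<^sup>2) summable_on UNIV"
    by (intro summable_on_add assms)
  fix i
  have "2 * (cmod (f i) * cmod (g i)) \<le> (cmod (f i))\<^sup>2 + (cmod (g i))\<^sup>2"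
    using sum_squares_bound [of "cmod (f i)" "cmod (g i)"] by simp
  moreover have "0 \<le> cmod (f i) * cmod (g i)"
    by simp
  ultimately show "norm (f i * cnj (g i)) \<le> (cmod (f i))\<^sup>2 + (cmod (g i))\<^sup>2"
    unfolding norm_mult complex_mod_cnj by linarith
qed auto

instantiation ell2 :: (type) complex_vector
begin
lift_definition zero_ell2 :: "'a ell2" is "\<lambda>_. 0" by simp
lift_definition plus_ell2 :: "'a ell2 \<Rightarrow> 'a ell2 \<Rightarrow> 'a ell2" is "\<lambda>f g i. f i + g i"
  by (rule sq_summable_add)
lift_definition uminus_ell2 :: "'a ell2 \<Rightarrow> 'a ell2" is "\<lambda>f i. - f i" by simp
lift_definition minus_ell2 :: "'a ell2 \<Rightarrow> 'a ell2 \<Rightarrow> 'a ell2" is "\<lambda>f g i. f i - g i"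
  subgoal for f g using sq_summable_add [of f "\<lambda>i. - g i"] by simp
  done
lift_definition scaleC_ell2 :: "complex \<Rightarrow> 'a ell2 \<Rightarrow> 'a ell2" is "\<lambda>c f i. c * f i"
  by (rule sq_summable_scale)
instance
  by standard (transfer; simp add: fun_eq_iff algebra_simps)+
end

instantiation ell2 :: (type) real_inner
begin
definition scaleR_ell2 :: "real \<Rightarrow> 'a ell2 \<Rightarrow> 'a ell2"
  where "scaleR_ell2 r x = complex_of_real r *\<^sub>C x"
definition inner_ell2 :: "'a ell2 \<Rightarrow> 'a ell2 \<Rightarrow> real"
  where "inner_ell2 x y = Re (\<Sum>\<^sub>\<infinity>i. ell2_apply x i * cnj (ell2_apply y i))"
definition norm_ell2 :: "'a ell2 \<Rightarrow> real"
  where "norm_ell2 x = sqrt (inner x x)"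
definition sgn_ell2 :: "'a ell2 \<Rightarrow> 'a ell2"
  where "sgn_ell2 x = inverse (norm x) *\<^sub>R x"
definition dist_ell2 :: "'a ell2 \<Rightarrow> 'a ell2 \<Rightarrow> real"
  where "dist_ell2 x y = norm (x - y)"
definition uniformity_ell2 :: "('a ell2 \<times> 'a ell2) filter"
  where "uniformity_ell2 = (INF e\<in>{0<..}. principal {(x, y). dist x y < e})"
definition open_ell2 :: "'a ell2 set \<Rightarrow> bool"
  where "open_ell2 U \<longleftrightarrow> (\<forall>x\<in>U. eventually (\<lambda>(x', y). x' = x \<longrightarrow> y \<in> U) uniformity)"

lemma ell2_prod_summable: "(\<lambda>i. ell2_apply x i * cnj (ell2_apply y i)) summable_on UNIV"
  by (rule sq_summable_prod; use ell2_apply in blast)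

lemma inner_ell2_self: "inner x x = (\<Sum>\<^sub>\<infinity>i. (cmod (ell2_apply x i))\<^sup>2)"
proof -
  have "inner x x = (\<Sum>\<^sub>\<infinity>i. Re (ell2_apply x i * cnj (ell2_apply x i)))"
    unfolding inner_ell2_def by (rule infsum_Re [symmetric]) (rule ell2_prod_summable)
  then show ?thesis
    by (simp only: complex_norm_square [symmetric] Re_complex_of_real)
qed

instance
proof
  fix x y z :: "'a ell2" and r s :: real
  show "r *\<^sub>R (x + y) = r *\<^sub>R x + r *\<^sub>R y" "(r + s) *\<^sub>R x = r *\<^sub>R x + s *\<^sub>R x"
    "r *\<^sub>R s *\<^sub>R x = (r * s) *\<^sub>R x" "1 *\<^sub>R x = x"
    by (simp_all add: scaleR_ell2_def scaleC_add_right scaleC_add_left scaleC_scaleC scaleC_one)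
  show "sgn x = inverse (norm x) *\<^sub>R x" by (rule sgn_ell2_def)
  show "dist x y = norm (x - y)" by (rule dist_ell2_def)
  show "uniformity = (INF e\<in>{0<..}. principal {(x::'a ell2, y). dist x y < e})"
    by (rule uniformity_ell2_def)
  show "open U \<longleftrightarrow> (\<forall>x\<in>U. eventually (\<lambda>(x', y). x' = x \<longrightarrow> y \<in> U) uniformity)" for U :: "'a ell2 set"
    by (rule open_ell2_def)
  show "norm x = sqrt (inner x x)" by (rule norm_ell2_def)
  have "(\<Sum>\<^sub>\<infinity>i. ell2_apply y i * cnj (ell2_apply x i))
      = (\<Sum>\<^sub>\<infinity>i. cnj (ell2_apply x i * cnj (ell2_apply y i)))"
    by (simp add: mult.commute)
  then show "inner x y = inner y x"
    by (simp only: inner_ell2_def infsum_cnj) simp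
  show "inner (x + y) z = inner x z + inner y z"
    by (simp add: inner_ell2_def plus_ell2.rep_eq distrib_right infsum_add ell2_prod_summable)
  show "inner (r *\<^sub>R x) y = r * inner x y"
    by (simp add: inner_ell2_def scaleR_ell2_def scaleC_ell2.rep_eq mult.assoc infsum_cmult_right')
  show "0 \<le> inner x x"
    by (simp add: inner_ell2_self infsum_nonneg)
  have "x = 0" if "inner x x = 0"
  proof -
    have "(cmod (ell2_apply x i))\<^sup>2 = 0" for i
      by (rule nonneg_infsum_le_0D [where A = UNIV and f = "\<lambda>i. (cmod (ell2_apply x i))\<^sup>2"])
        (use that ell2_apply [of x] in \<open>auto simp: inner_ell2_self\<close>)
    then show ?thesis
      by transfer (simp add: fun_eq_iff)
  qed
  moreover have "inner (0 :: 'a ell2) 0 = 0"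
    by (simp add: inner_ell2_self zero_ell2.rep_eq)
  ultimately show "inner x x = 0 \<longleftrightarrow> x = 0"
    by blast
qed
end

lemma ell2_finite_sum_le:
  assumes "finite F"
  shows "(\<Sum>i\<in>F. (cmod (ell2_apply x i))\<^sup>2) \<le> (norm x)\<^sup>2"
proof -
  have "(\<Sum>i\<in>F. (cmod (ell2_apply x i))\<^sup>2) \<le> (\<Sum>\<^sub>\<infinity>i. (cmod (ell2_apply x i))\<^sup>2)"
    by (rule finite_sum_le_infsum) (use ell2_apply assms in auto)
  then show ?thesis
    by (simp add: norm_eq_sqrt_inner inner_ell2_self infsum_nonneg)
qed

lemma ell2_cmod_le: "cmod (ell2_apply x i) \<le> norm x"
  using ell2_finite_sum_le [of "{i}" x] by (auto intro: power2_le_imp_le)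

lemma ell2_norm_leI:
  assumes "\<And>F. finite F \<Longrightarrow> (\<Sum>i\<in>F. (cmod (ell2_apply x i))\<^sup>2) \<le> e\<^sup>2" "0 \<le> e"
  shows "norm x \<le> e"
proof -
  have "(\<Sum>\<^sub>\<infinity>i. (cmod (ell2_apply x i))\<^sup>2) \<le> e\<^sup>2"
    by (rule infsum_le_finite_sums) (use ell2_apply assms in auto)
  then show ?thesis
    by (simp add: norm_eq_sqrt_inner inner_ell2_self assms(2) real_le_lsqrt infsum_nonneg)
qed

instance ell2 :: (type) complete_space
proof
  fix X :: "nat \<Rightarrow> 'a ell2"
  assume X: "Cauchy X"
  have "\<exists>l. (\<lambda>n. ell2_apply (X n) i) \<longlonglongrightarrow> l" for i
  proof -
    have "Cauchy (\<lambda>n. ell2_apply (X n) i)"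
      unfolding Cauchy_def
    proof (intro allI impI)
      fix e :: real assume "0 < e"
      then obtain M where M: "\<And>m n. m \<ge> M \<Longrightarrow> n \<ge> M \<Longrightarrow> dist (X m) (X n) < e"
        using X unfolding Cauchy_def by metis
      have "dist (ell2_apply (X m) i) (ell2_apply (X n) i) \<le> dist (X m) (X n)" for m n
        using ell2_cmod_le [of "X m - X n" i] by (simp add: dist_norm minus_ell2.rep_eq)
      with M show "\<exists>M. \<forall>m\<ge>M. \<forall>n\<ge>M. dist (ell2_apply (X m) i) (ell2_apply (X n) i) < e"
        by (meson le_less_trans)
    qed
    then show ?thesis
      by (simp add: Cauchy_convergent_iff convergent_def)
  qed
  then obtain L where L: "\<And>i. (\<lambda>n. ell2_apply (X n) i) \<longlonglongrightarrow> L i"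
    by metis
  have bound: "(\<Sum>i\<in>F. (cmod (ell2_apply (X m) i - L i))\<^sup>2) \<le> e\<^sup>2"
    if "\<And>n. n \<ge> M \<Longrightarrow> dist (X m) (X n) < e" for F m M and e :: real
  proof (cases "finite F")
    case True
    have "(\<lambda>n. \<Sum>i\<in>F. (cmod (ell2_apply (X m) i - ell2_apply (X n) i))\<^sup>2)
        \<longlonglongrightarrow> (\<Sum>i\<in>F. (cmod (ell2_apply (X m) i - L i))\<^sup>2)"
      by (intro tendsto_intros L)
    moreover have "(\<Sum>i\<in>F. (cmod (ell2_apply (X m) i - ell2_apply (X n) i))\<^sup>2) \<le> e\<^sup>2" if "n \<ge> M" for n
    proof -
      have "(\<Sum>i\<in>F. (cmod (ell2_apply (X m) i - ell2_apply (X n) i))\<^sup>2) \<le> (norm (X m - X n))\<^sup>2"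
        using ell2_finite_sum_le [OF True, of "X m - X n"] by (simp add: minus_ell2.rep_eq)
      also have "\<dots> \<le> e\<^sup>2"
        using \<open>\<And>n. n \<ge> M \<Longrightarrow> dist (X m) (X n) < e\<close> [OF that]
        by (intro power_mono) (auto simp: dist_norm)
      finally show ?thesis .
    qed
    ultimately show ?thesis
      by (intro LIMSEQ_le_const2 [where a = "e\<^sup>2"]) auto
  qed simp
  obtain M where M: "\<And>n. n \<ge> M \<Longrightarrow> dist (X M) (X n) < 1"
    using X unfolding Cauchy_def by (metis order_refl zero_less_one)
  have "(\<lambda>i. (cmod (ell2_apply (X M) i - L i))\<^sup>2) summable_on UNIV"
  proof (rule nonneg_bdd_above_summable_on)
    show "bdd_above (sum (\<lambda>i. (cmod (ell2_apply (X M) i - L i))\<^sup>2) ` {F. F \<subseteq> UNIV \<and> finite F})"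
      using bound [OF M] by (intro bdd_aboveI [where M = "1\<^sup>2"]) blast
  qed auto
  then have "(\<lambda>i. (cmod (- 1 * (ell2_apply (X M) i - L i)))\<^sup>2) summable_on UNIV"
    by (rule sq_summable_scale)
  then have "(\<lambda>i. (cmod (ell2_apply (X M) i + - 1 * (ell2_apply (X M) i - L i)))\<^sup>2) summable_on UNIV"
    by (intro sq_summable_add) (use ell2_apply in auto)
  then have Ls: "(\<lambda>i. (cmod (L i))\<^sup>2) summable_on UNIV"
    by simp
  define l where "l = Abs_ell2 L"
  have l: "ell2_apply l = L"
    using Ls by (simp add: l_def Abs_ell2_inverse)
  have "X \<longlonglongrightarrow> l"
  proof (rule LIMSEQ_I)
    fix e :: real assume "0 < e"
    then obtain M where M: "\<And>m n. m \<ge> M \<Longrightarrow> n \<ge> M \<Longrightarrow> dist (X m) (X n) < e / 2"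
      using X unfolding Cauchy_def by (metis half_gt_zero)
    have "norm (X m - l) \<le> e / 2" if "m \<ge> M" for m
      by (rule ell2_norm_leI)
        (use bound [OF M [OF that]] \<open>0 < e\<close> in \<open>auto simp: minus_ell2.rep_eq l\<close>)
    then show "\<exists>M. \<forall>m\<ge>M. norm (X m - l) < e"
      using \<open>0 < e\<close> by (intro exI [of _ M] allI impI) (smt (verit) field_sum_of_halves)
  qed
  then show "convergent X"
    by (auto simp: convergent_def)
qed

instantiation ell2 :: (type) complex_hilbert_space
begin
definition cinner_ell2 :: "'a ell2 \<Rightarrow> 'a ell2 \<Rightarrow> complex"
  where "cinner_ell2 x y = (\<Sum>\<^sub>\<infinity>i. ell2_apply x i * cnj (ell2_apply y i))"
instance
proof
  fix x y z :: "'a ell2" and r :: real and c :: complex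
  show "complex_of_real r *\<^sub>C x = r *\<^sub>R x"
    by (simp add: scaleR_ell2_def)
  show "cinner (x + y) z = cinner x z + cinner y z"
    by (simp add: cinner_ell2_def plus_ell2.rep_eq distrib_right infsum_add ell2_prod_summable)
  show "cinner (c *\<^sub>C x) y = c * cinner x y"
    by (simp add: cinner_ell2_def scaleC_ell2.rep_eq mult.assoc infsum_cmult_right')
  have "cnj (cinner y x) = (\<Sum>\<^sub>\<infinity>i. cnj (ell2_apply y i * cnj (ell2_apply x i)))"
    by (simp only: cinner_ell2_def infsum_cnj)
  then show "cinner x y = cnj (cinner y x)"
    by (simp add: cinner_ell2_def mult.commute)
  show "inner x y = Re (cinner x y)"
    by (simp add: inner_ell2_def cinner_ell2_def)
qed
end


section \<open>Operators and von Neumann algebras\<close>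

text \<open>The type \<open>'h \<Rightarrow>\<^sub>L 'h\<close> consists of all bounded real-linear operators, so the
  operators on the complex Hilbert space have to be carved out of it.\<close>

definition bounded_ops :: "('h::complex_hilbert_space \<Rightarrow>\<^sub>L 'h) ring" where
  "bounded_ops =
    \<lparr>carrier = {T. \<forall>c x. blinfun_apply T (c *\<^sub>C x) = c *\<^sub>C blinfun_apply T x},
     monoid.mult = (o\<^sub>L), one = id_blinfun, zero = 0, add = (+)\<rparr>"

definition cadjoint :: "('h::complex_hilbert_space \<Rightarrow>\<^sub>L 'h) \<Rightarrow> 'h \<Rightarrow>\<^sub>L 'h" where
  "cadjoint T =
    (THE S. \<forall>x y. cinner (blinfun_apply T x) y = cinner x (blinfun_apply S y))"

definition commutant :: "('h::complex_hilbert_space \<Rightarrow>\<^sub>L 'h) set \<Rightarrow> ('h \<Rightarrow>\<^sub>L 'h) set" where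
  "commutant S = {T \<in> carrier bounded_ops. \<forall>A\<in>S. T o\<^sub>L A = A o\<^sub>L T}"

definition von_neumann_algebra :: "('h::complex_hilbert_space \<Rightarrow>\<^sub>L 'h) set \<Rightarrow> bool" where
  "von_neumann_algebra M \<longleftrightarrow> M \<subseteq> carrier bounded_ops \<and> (\<forall>T\<in>M. cadjoint T \<in> M)
     \<and> commutant (commutant M) = M"

definition factor :: "('h::complex_hilbert_space \<Rightarrow>\<^sub>L 'h) set \<Rightarrow> bool" where
  "factor M \<longleftrightarrow> von_neumann_algebra M \<and> M \<inter> commutant M = range (\<lambda>c. c *\<^sub>C id_blinfun)"

definition projections :: "('h::complex_hilbert_space \<Rightarrow>\<^sub>L 'h) set \<Rightarrow> ('h \<Rightarrow>\<^sub>L 'h) set" where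
  "projections M = {p \<in> M. p o\<^sub>L p = p \<and> cadjoint p = p}"

definition subprojection :: "('h::complex_hilbert_space \<Rightarrow>\<^sub>L 'h) \<Rightarrow> ('h \<Rightarrow>\<^sub>L 'h) \<Rightarrow> bool" where
  "subprojection q p \<longleftrightarrow> p o\<^sub>L q = q"

definition murray_von_neumann_equiv ::
    "('h::complex_hilbert_space \<Rightarrow>\<^sub>L 'h) set \<Rightarrow> ('h \<Rightarrow>\<^sub>L 'h) \<Rightarrow> ('h \<Rightarrow>\<^sub>L 'h) \<Rightarrow> bool" where
  "murray_von_neumann_equiv M p q \<longleftrightarrow>
    (\<exists>v\<in>M. cadjoint v o\<^sub>L v = p \<and> v o\<^sub>L cadjoint v = q)"

definition finite_projection ::
    "('h::complex_hilbert_space \<Rightarrow>\<^sub>L 'h) set \<Rightarrow> ('h \<Rightarrow>\<^sub>L 'h) \<Rightarrow> bool" where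
  "finite_projection M p \<longleftrightarrow> p \<in> projections M \<and>
    (\<forall>q\<in>projections M. subprojection q p \<and> murray_von_neumann_equiv M p q \<longrightarrow> q = p)"

definition minimal_projection ::
    "('h::complex_hilbert_space \<Rightarrow>\<^sub>L 'h) set \<Rightarrow> ('h \<Rightarrow>\<^sub>L 'h) \<Rightarrow> bool" where
  "minimal_projection M p \<longleftrightarrow> p \<in> projections M \<and> p \<noteq> 0 \<and>
    (\<forall>q\<in>projections M. subprojection q p \<longrightarrow> q = 0 \<or> q = p)"

text \<open>A factor is of type I if it has a minimal projection, and of type II if it has none but has a
  nonzero finite projection.\<close>

definition type_II_factor :: "('h::complex_hilbert_space \<Rightarrow>\<^sub>L 'h) set \<Rightarrow> bool" where
  "type_II_factor M \<longleftrightarrow> factor M \<and> (\<nexists>p. minimal_projection M p)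
     \<and> (\<exists>p. finite_projection M p \<and> p \<noteq> 0)"

definition type_II_1_factor :: "('h::complex_hilbert_space \<Rightarrow>\<^sub>L 'h) set \<Rightarrow> bool" where
  "type_II_1_factor M \<longleftrightarrow> type_II_factor M \<and> finite_projection M id_blinfun"

definition type_II_inf_factor :: "('h::complex_hilbert_space \<Rightarrow>\<^sub>L 'h) set \<Rightarrow> bool" where
  "type_II_inf_factor M \<longleftrightarrow> type_II_factor M \<and> \<not> finite_projection M id_blinfun"


section \<open>Free products of groups\<close>

text \<open>Elements of the free product are the reduced words: lists of letters \<open>(i, g)\<close> with
  \<open>g\<close> a nontrivial element of the \<open>i\<close>-th group and with consecutive letters from different
  groups. Multiplication is concatenation followed by reduction.\<close>

fun free_cons :: "('i \<Rightarrow> 'a monoid) \<Rightarrow> 'i \<times> 'a \<Rightarrow> ('i \<times> 'a) list \<Rightarrow> ('i \<times> 'a) list" where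
  "free_cons G (i, g) [] = [(i, g)]"
| "free_cons G (i, g) ((j, h) # w) =
    (if i \<noteq> j then (i, g) # (j, h) # w
     else if g \<otimes>\<^bsub>G i\<^esub> h = \<one>\<^bsub>G i\<^esub> then w
     else (i, g \<otimes>\<^bsub>G i\<^esub> h) # w)"

definition free_product :: "'i set \<Rightarrow> ('i \<Rightarrow> 'a monoid) \<Rightarrow> ('i \<times> 'a) list monoid" where
  "free_product I G =
    \<lparr>carrier = {w. distinct_adj (map fst w) \<and>
                   (\<forall>(i, g)\<in>set w. i \<in> I \<and> g \<in> carrier (G i) \<and> g \<noteq> \<one>\<^bsub>G i\<^esub>)},
     monoid.mult = (\<lambda>u w. foldr (free_cons G) u w), one = []\<rparr>"


section \<open>Full group C*-algebras\<close>

definition unitary_group :: "('h::complex_hilbert_space \<Rightarrow>\<^sub>L 'h) monoid" where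
  "unitary_group =
    \<lparr>carrier = {T \<in> carrier bounded_ops. cadjoint T o\<^sub>L T = id_blinfun \<and> T o\<^sub>L cadjoint T = id_blinfun},
     monoid.mult = (o\<^sub>L), one = id_blinfun\<rparr>"

definition unitary_reps :: "'g monoid \<Rightarrow> ('g \<Rightarrow> 'h::complex_hilbert_space \<Rightarrow>\<^sub>L 'h) set" where
  "unitary_reps G = hom G unitary_group \<inter> extensional (carrier G)"

text \<open>The full group C*-algebra is realised as the norm closure of the linear span of the group in
  its universal representation, the direct sum of all unitary representations on
  \<open>\<ell>\<^sup>2(\<nat>)\<close>. A diagonal operator on that direct sum is a family of operators indexed by
  the representations, with the supremum norm; norm convergence is thus uniform convergence. Since
  \<open>G\<close> is countable, its cyclic representations act on separable spaces, and a countably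
  infinite multiple of such a representation is unitarily equivalent to one on
  \<open>\<ell>\<^sup>2(\<nat>)\<close>; so the resulting norm on the group algebra is the supremum over all
  unitary representations of \<open>G\<close> on all Hilbert spaces.\<close>

type_synonym 'g group_cstar_elem =
  "('g \<Rightarrow> nat ell2 \<Rightarrow>\<^sub>L nat ell2) \<Rightarrow> nat ell2 \<Rightarrow>\<^sub>L nat ell2"

definition canonical_unitary :: "('g::countable) monoid \<Rightarrow> 'g \<Rightarrow> 'g group_cstar_elem" where
  "canonical_unitary G g = (\<lambda>\<rho>. if \<rho> \<in> unitary_reps G then \<rho> g else 0)"

definition group_cstar :: "('g::countable) monoid \<Rightarrow> 'g group_cstar_elem ring" where
  "group_cstar G =
    \<lparr>carrier = {x. (\<forall>\<rho>. \<rho> \<notin> unitary_reps G \<longrightarrow> x \<rho> = 0) \<and>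
                   (\<exists>s. (\<forall>n. s n \<in> cspan (canonical_unitary G ` carrier G)) \<and>
                        uniform_limit (unitary_reps G) s x sequentially)},
     monoid.mult = (\<lambda>x y \<rho>. x \<rho> o\<^sub>L y \<rho>), one = canonical_unitary G \<one>\<^bsub>G\<^esub>,
     zero = 0, add = (+)\<rparr>"

definition group_cstar_star :: "'g group_cstar_elem \<Rightarrow> 'g group_cstar_elem" where
  "group_cstar_star x = (\<lambda>\<rho>. cadjoint (x \<rho>))"

definition star_representation ::
    "('g::countable) monoid \<Rightarrow> ('g group_cstar_elem \<Rightarrow> 'h::complex_hilbert_space \<Rightarrow>\<^sub>L 'h) \<Rightarrow> bool" where
  "star_representation G \<pi> \<longleftrightarrow> \<pi> \<in> ring_hom (group_cstar G) bounded_ops \<and>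
    (\<forall>x\<in>carrier (group_cstar G).
       (\<forall>c. \<pi> (c *\<^sub>C x) = c *\<^sub>C \<pi> x) \<and> \<pi> (group_cstar_star x) = cadjoint (\<pi> x))"


section \<open>Unital completely positive maps and factorial representations\<close>

text \<open>The matrix order on an operator system \<open>R\<close> is inherited from the C*-algebra of
  \<open>G\<close>: a matrix over \<open>R\<close> is positive iff it has the form \<open>Y\<^sup>* Y\<close> for a matrix \<open>Y\<close> over
  that C*-algebra.\<close>

definition positive_matrix ::
    "('g::countable) monoid \<Rightarrow> nat \<Rightarrow> (nat \<Rightarrow> nat \<Rightarrow> 'g group_cstar_elem) \<Rightarrow> bool" where
  "positive_matrix G n X \<longleftrightarrow>
    (\<exists>Y. (\<forall>i<n. \<forall>j<n. Y i j \<in> carrier (group_cstar G)) \<and>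
         (\<forall>i<n. \<forall>j<n. X i j = (\<Sum>l<n. group_cstar_star (Y l i) \<otimes>\<^bsub>group_cstar G\<^esub> Y l j)))"

definition completely_positive_on :: "('g::countable) monoid \<Rightarrow> 'g group_cstar_elem set \<Rightarrow>
    ('g group_cstar_elem \<Rightarrow> 'h::complex_hilbert_space \<Rightarrow>\<^sub>L 'h) \<Rightarrow> bool" where
  "completely_positive_on G R \<phi> \<longleftrightarrow>
    (\<forall>n X. (\<forall>i<n. \<forall>j<n. X i j \<in> R) \<and> positive_matrix G n X \<longrightarrow>
      (\<forall>h :: nat \<Rightarrow> 'h.
        (\<Sum>i<n. \<Sum>j<n. cinner (blinfun_apply (\<phi> (X i j)) (h j)) (h i)) \<in> \<real>\<^sub>\<ge>\<^sub>0))"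

definition ucp_on :: "('g::countable) monoid \<Rightarrow> 'g group_cstar_elem set \<Rightarrow>
    ('g group_cstar_elem \<Rightarrow> 'h::complex_hilbert_space \<Rightarrow>\<^sub>L 'h) \<Rightarrow> bool" where
  "ucp_on G R \<phi> \<longleftrightarrow> \<phi> ` R \<subseteq> carrier bounded_ops \<and>
    (\<forall>x\<in>R. \<forall>y\<in>R. \<phi> (x + y) = \<phi> x + \<phi> y) \<and> (\<forall>c. \<forall>x\<in>R. \<phi> (c *\<^sub>C x) = c *\<^sub>C \<phi> x) \<and>
    \<phi> \<one>\<^bsub>group_cstar G\<^esub> = id_blinfun \<and> completely_positive_on G R \<phi>"

definition factorial_ucp :: "('g::countable) monoid \<Rightarrow> 'g group_cstar_elem set \<Rightarrow>
    ('g group_cstar_elem \<Rightarrow> 'h::complex_hilbert_space \<Rightarrow>\<^sub>L 'h) \<Rightarrow> bool" where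
  "factorial_ucp G R \<phi> \<longleftrightarrow> ucp_on G R \<phi> \<and> factor (commutant (commutant (\<phi> ` R)))"

definition factorial_representation :: "('g::countable) monoid \<Rightarrow> 'g group_cstar_elem set \<Rightarrow>
    ('g group_cstar_elem \<Rightarrow> 'h::complex_hilbert_space \<Rightarrow>\<^sub>L 'h) \<Rightarrow> bool" where
  "factorial_representation G R \<pi> \<longleftrightarrow> star_representation G \<pi> \<and>
    (\<exists>\<phi>. factorial_ucp G R \<phi> \<and> (\<forall>x\<in>R. \<pi> x = \<phi> x))"

definition factorial_representation_II_1 :: "('g::countable) monoid \<Rightarrow> 'g group_cstar_elem set \<Rightarrow>
    ('g group_cstar_elem \<Rightarrow> 'h::complex_hilbert_space \<Rightarrow>\<^sub>L 'h) \<Rightarrow> bool" where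
  "factorial_representation_II_1 G R \<pi> \<longleftrightarrow>
    factorial_representation G R \<pi> \<and> type_II_1_factor (commutant (commutant (\<pi> ` R)))"

definition factorial_representation_II_inf :: "('g::countable) monoid \<Rightarrow> 'g group_cstar_elem set \<Rightarrow>
    ('g group_cstar_elem \<Rightarrow> 'h::complex_hilbert_space \<Rightarrow>\<^sub>L 'h) \<Rightarrow> bool" where
  "factorial_representation_II_inf G R \<pi> \<longleftrightarrow>
    factorial_representation G R \<pi> \<and> type_II_inf_factor (commutant (commutant (\<pi> ` R)))"


section \<open>The operator systems NC(d) and NCP(k)\<close>

definition NC_group :: "nat \<Rightarrow> (nat \<times> int) list monoid" where
  "NC_group d = free_product {..<d} (\<lambda>_. integer_mod_group 2)"

definition NC :: "nat \<Rightarrow> (nat \<times> int) list group_cstar_elem set" where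
  "NC d = cspan (insert \<one>\<^bsub>group_cstar (NC_group d)\<^esub>
                   ((\<lambda>i. canonical_unitary (NC_group d) [(i, 1)]) ` {..<d}))"

text \<open>Index \<open>0\<close> stands for the factor \<open>\<int>\<^sub>k\<close>, index \<open>1\<close> for the factor \<open>\<int>\<^sub>2\<close>.\<close>

definition NCP_group :: "nat \<Rightarrow> (nat \<times> int) list monoid" where
  "NCP_group k = free_product {0, 1} (\<lambda>i. integer_mod_group (if i = 0 then k else 2))"

definition NCP :: "nat \<Rightarrow> (nat \<times> int) list group_cstar_elem set" where
  "NCP k =
    (let A = group_cstar (NCP_group k);
         w = canonical_unitary (NCP_group k) [(0, 1)];
         v = canonical_unitary (NCP_group k) [(1, 1)]
     in cspan (insert v ((\<lambda>j::nat. w [^]\<^bsub>A\<^esub> j) ` {..<k})))"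

end

theory Submission
  imports Defs
begin

text \<open>A group \<open>A\<close> of permutations of a countable set \<open>X\<close> acts by unitaries on
  \<open>\<ell>\<^sup>2(X)\<close>. Suppose that \<open>A\<close> is transitive, that a group \<open>B\<close> acts freely on \<open>X\<close> and commutes with
  \<open>A\<close>, and that the stabiliser in \<open>A\<close> of a base point \<open>c\<close> has only infinite orbits outside
  \<open>B c\<close>. Then an operator that commutes with \<open>A\<close> is determined by its column at \<open>c\<close>, which is
  supported on \<open>B c\<close>; hence \<open>A''\<close> is the commutant of \<open>B\<close>, that is, the group von Neumann algebra
  of \<open>B\<close> tensored with the bounded operators on \<open>\<ell>\<^sup>2(X / B)\<close>. It is a factor when
  \<open>B\<close> is ICC, it is finite when \<open>X / B\<close> is a point, and properly infinite when \<open>X / B\<close> is infinite.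
  Minimal projections are excluded by projections of trace \<open>2\<^sup>-\<^sup>n\<close> built from commuting
  involutions: a nonzero operator between a minimal projection and such a projection has a polar
  decomposition, obtained by the Newton--Schulz iteration, which bounds the trace of the former.

  Both free products act on \<open>k\<close> copies of the half-line \<open>\<nat>\<close> whose edges are labelled cyclically
  by \<open>k\<close> involutions, with a different phase on each copy. The product of two involutions with
  adjacent labels is a disjoint union of 3-cycles, except that on the one copy where the pattern is
  cut off at its end it is a transposition; its cube is a single transposition. So the image contains
  all finitary permutations of each copy. The set \<open>X\<close> is the orbit of an injection \<open>j\<close>
  of \<open>\<nat>\<close> into the union of the copies: a bijection for type \<open>II\<^sub>1\<close>, and an enumeration of one
  copy together with one point of another for type \<open>II\<^sub>\<infinity>\<close>.\<close>

text \<open>For \<open>d = 2\<close> or \<open>k = 2\<close> the group is infinite dihedral, and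
  only factors of type I occur. The bound 3 enters because the labels \<open>l\<close> and
  \<open>l + 2\<close> must differ for the products of adjacent involutions to consist of 3-cycles.
  Finitary permutations are wanted for their supply of transpositions: moving one point around gives
  the infinite orbits and infinite conjugacy classes, and disjoint transpositions give the commuting
  involutions.

  The extra point in the second case wanders along its block under \<open>A\<close> but is fixed by
  all index permutations that define \<open>B\<close>. This makes \<open>X / B\<close> infinite,
  while the complete block beside it keeps \<open>B\<close> ICC.

  No trace is constructed. On the corner of the base orbit the vector state at \<open>c\<close> is
  the trace, and its tracial property is used only as an inequality between a column and the row at
  \<open>c\<close>. Nor is the polar partial isometry constructed: the norms of the iterates
  suffice.

  The operator systems matter only through their commutants. Complete positivity comes for free,
  since each representation used is a coordinate of the universal one.\<close>

unbundle no m_inv_syntax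

section \<open>Operators on \<open>\<ell>\<^sup>2\<close> spaces\<close>

lemma cinner_add_right: "cinner x (y + z) = cinner x y + cinner x (z::'a::complex_hilbert_space)"
  by (metis cinner_add_left cinner_commute complex_cnj_add)

lemma cinner_minus_left: "cinner (- x) y = - cinner x (y::'a::complex_hilbert_space)"
  using cinner_add_left [of x "- x" y] cinner_add_left [of 0 0 y] by (simp add: eq_neg_iff_add_eq_0 add.commute)

lemma cinner_diff_left: "cinner (x - z) y = cinner x y - cinner z (y::'a::complex_hilbert_space)"
  using cinner_add_left [of x "- z" y] by (simp add: cinner_minus_left)

lemma cinner_diff_right: "cinner x (y - z) = cinner x y - cinner x (z::'a::complex_hilbert_space)"
  by (metis cinner_commute cinner_diff_left complex_cnj_diff)

lemma cinner_zero_left [simp]: "cinner 0 (y::'a::complex_hilbert_space) = 0"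
  using cinner_diff_left [of 0 0 y] by simp

lemma cinner_zero_right [simp]: "cinner (x::'a::complex_hilbert_space) 0 = 0"
  using cinner_diff_right [of x 0 0] by simp

lemma cinner_sum_left: "cinner (sum f A) y = (\<Sum>i\<in>A. cinner (f i) (y::'a::complex_hilbert_space))"
  by (induction A rule: infinite_finite_induct) (simp_all add: cinner_add_left)

lemma cinner_sum_right: "cinner y (sum f A) = (\<Sum>i\<in>A. cinner (y::'a::complex_hilbert_space) (f i))"
  by (induction A rule: infinite_finite_induct) (simp_all add: cinner_add_right)

lemma cinner_self: "cinner x x = complex_of_real ((norm (x::'a::complex_hilbert_space))\<^sup>2)"
proof -
  have "Im (cinner x x) = 0"
    using arg_cong [OF cinner_commute [of x x], of Im] by simp
  moreover have "Re (cinner x x) = (norm x)\<^sup>2"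
    by (simp add: inner_eq_Re_cinner [symmetric] power2_norm_eq_inner)
  ultimately show ?thesis
    by (simp add: complex_eq_iff)
qed

lemma cinner_conv_inner:
  "cinner x y = Complex (inner x y) (inner x (\<i> *\<^sub>C (y::'a::complex_hilbert_space)))"
  by (simp add: complex_eq_iff inner_eq_Re_cinner cinner_scaleC_right)

lemma cmod_cinner_le: "cmod (cinner x y) \<le> norm x * norm (y::'a::complex_hilbert_space)"
proof (cases "cinner x y = 0")
  case False
  define u where "u = cnj (cinner x y) / cmod (cinner x y)"
  have u: "cmod u = 1"
    using False by (simp add: u_def norm_divide)
  have "cinner (u *\<^sub>C x) y = complex_of_real (cmod (cinner x y))"
    using False complex_norm_square [of "cinner x y"]
    by (simp add: cinner_scaleC_left u_def field_simps power2_eq_square)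
  then have "cmod (cinner x y) = inner (u *\<^sub>C x) y"
    by (simp add: inner_eq_Re_cinner)
  also have "\<dots> \<le> norm (u *\<^sub>C x) * norm y"
    by (rule norm_cauchy_schwarz)
  finally show ?thesis
    by (simp add: norm_scaleC u)
qed simp

lemma bounded_linear_cinner_left: "bounded_linear (\<lambda>x::'a::complex_hilbert_space. cinner x y)"
  by (rule bounded_linear_intro [where K = "norm y"])
    (simp_all add: cinner_add_left cinner_scaleC_left cmod_cinner_le scaleR_conv_of_real
      flip: scaleC_of_real)

lemmas tendsto_cinner_left = bounded_linear.tendsto [OF bounded_linear_cinner_left]

lemma ell2_eqI: "(\<And>i. ell2_apply x i = ell2_apply y i) \<Longrightarrow> x = y"
  by (metis ell2_apply_inject ext)

lemma ell2_apply_sum: "ell2_apply (sum f F) i = (\<Sum>j\<in>F. ell2_apply (f j) i)"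
  by (induction F rule: infinite_finite_induct) (simp_all add: zero_ell2.rep_eq plus_ell2.rep_eq)

lemma norm_sq_ell2: "(norm x)\<^sup>2 = (\<Sum>\<^sub>\<infinity>i. (cmod (ell2_apply x i))\<^sup>2)"
  by (simp add: power2_norm_eq_inner inner_ell2_self)

lift_definition ket :: "'i \<Rightarrow> 'i ell2" is "\<lambda>i j. if i = j then 1 else 0"
proof -
  fix i :: 'i
  have "(\<lambda>j. (cmod (if i = j then 1 else 0))\<^sup>2) summable_on UNIV \<longleftrightarrow>
      (\<lambda>j. (cmod (if i = j then 1 else 0))\<^sup>2) summable_on {i}"
    by (rule summable_on_cong_neutral) auto
  then show "(\<lambda>j. (cmod (if i = j then 1 else 0))\<^sup>2) summable_on UNIV"
    by simp
qed

lemma ket_apply: "ell2_apply (ket i) j = (if i = j then 1 else 0)"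
  by (simp add: ket.rep_eq)

lemma cinner_ket: "cinner x (ket i) = ell2_apply x i"
proof -
  have "cinner x (ket i) = (\<Sum>\<^sub>\<infinity>j\<in>{i}. ell2_apply x j * cnj (ell2_apply (ket i) j))"
    unfolding cinner_ell2_def by (rule infsum_cong_neutral) (auto simp: ket_apply)
  then show ?thesis
    by (simp add: ket_apply)
qed

lemma cinner_ket_left: "cinner (ket i) x = cnj (ell2_apply x i)"
  by (metis cinner_commute cinner_ket)

lemma norm_ket [simp]: "norm (ket i) = 1"
proof -
  have "(norm (ket i))\<^sup>2 = 1"
    using cinner_self [of "ket i"] by (simp add: cinner_ket ket_apply flip: of_real_power)
  then show ?thesis
    by (simp add: power2_eq_1_iff) (use norm_ge_zero [of "ket i"] in linarith)
qed

lemma ket_nonzero: "ket i \<noteq> 0"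
  using norm_ket [of i] by force

lemma ket_expansion:
  "((\<lambda>F. \<Sum>i\<in>F. ell2_apply x i *\<^sub>C ket i) \<longlongrightarrow> x) (finite_subsets_at_top UNIV)"
proof -
  define P where "P F = (\<Sum>i\<in>F. ell2_apply x i *\<^sub>C ket i)" for F
  have "(norm (x - P F))\<^sup>2 = (norm x)\<^sup>2 - (\<Sum>i\<in>F. (cmod (ell2_apply x i))\<^sup>2)" if F: "finite F" for F
  proof -
    have ap: "ell2_apply (P F) i = (if i \<in> F then ell2_apply x i else 0)" for i
      using F by (simp add: P_def ell2_apply_sum scaleC_ell2.rep_eq ket_apply if_distrib cong: if_cong)
    have "(norm (x - P F))\<^sup>2 = (\<Sum>\<^sub>\<infinity>i\<in>- F. (cmod (ell2_apply x i))\<^sup>2)"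
      unfolding norm_sq_ell2 by (rule infsum_cong_neutral) (auto simp: minus_ell2.rep_eq ap)
    also have "\<dots> = (\<Sum>\<^sub>\<infinity>i. (cmod (ell2_apply x i))\<^sup>2) - (\<Sum>\<^sub>\<infinity>i\<in>F. (cmod (ell2_apply x i))\<^sup>2)"
      using F ell2_apply [of x] by (subst infsum_Diff [symmetric]) (auto simp: Compl_eq_Diff_UNIV)
    finally show ?thesis
      using F by (simp add: norm_sq_ell2)
  qed
  then have "\<forall>\<^sub>F F in finite_subsets_at_top UNIV.
      (norm x)\<^sup>2 - (\<Sum>i\<in>F. (cmod (ell2_apply x i))\<^sup>2) = (norm (x - P F))\<^sup>2"
    by (auto simp: eventually_finite_subsets_at_top)
  moreover have "((\<lambda>i. (cmod (ell2_apply x i))\<^sup>2) has_sum (norm x)\<^sup>2) UNIV"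
    using ell2_apply [of x] by (simp add: norm_sq_ell2)
  then have "((\<lambda>F. (norm x)\<^sup>2 - (\<Sum>i\<in>F. (cmod (ell2_apply x i))\<^sup>2)) \<longlongrightarrow> (norm x)\<^sup>2 - (norm x)\<^sup>2)
      (finite_subsets_at_top UNIV)"
    unfolding has_sum_def by (intro tendsto_intros)
  ultimately have "((\<lambda>F. (norm (x - P F))\<^sup>2) \<longlongrightarrow> 0) (finite_subsets_at_top UNIV)"
    by (simp add: tendsto_cong)
  then have "((\<lambda>F. sqrt ((norm (x - P F))\<^sup>2)) \<longlongrightarrow> sqrt 0) (finite_subsets_at_top UNIV)"
    by (rule tendsto_real_sqrt)
  then have "((\<lambda>F. norm (P F - x)) \<longlongrightarrow> 0) (finite_subsets_at_top UNIV)"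
    by (simp add: norm_minus_commute)
  then show ?thesis
    unfolding P_def by (simp add: tendsto_norm_zero_iff LIM_zero_iff)
qed

section \<open>Complex-linear bounded operators and their adjoints\<close>

abbreviation ops :: "('h::complex_hilbert_space \<Rightarrow>\<^sub>L 'h) set" where
  "ops \<equiv> carrier bounded_ops"

lemma ops_iff: "T \<in> ops \<longleftrightarrow> (\<forall>c x. T (c *\<^sub>C x) = c *\<^sub>C T x)"
  by (simp add: bounded_ops_def)

lemma ops_scaleC: "T \<in> ops \<Longrightarrow> T (c *\<^sub>C x) = c *\<^sub>C T x"
  by (simp add: ops_iff)

lemma ops_compose: "S \<in> ops \<Longrightarrow> T \<in> ops \<Longrightarrow> S o\<^sub>L T \<in> ops"
  by (simp add: ops_iff)

lemma ops_id: "id_blinfun \<in> ops"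
  by (simp add: ops_iff)

lemma ops_add: "S \<in> ops \<Longrightarrow> T \<in> ops \<Longrightarrow> S + T \<in> ops"
  by (simp add: ops_iff blinfun.add_left scaleC_add_right)

lemma scaleC_diff_right: "c *\<^sub>C (x - y) = c *\<^sub>C x - c *\<^sub>C (y::'a::complex_hilbert_space)"
  by (rule linear_diff) (rule bounded_linear.linear [OF bounded_linear_scaleC])

lemma scaleC_scaleR: "c *\<^sub>C r *\<^sub>R x = r *\<^sub>R c *\<^sub>C (x::'a::complex_hilbert_space)"
  by (rule linear_scale) (rule bounded_linear.linear [OF bounded_linear_scaleC])

lemma ops_diff: "S \<in> ops \<Longrightarrow> T \<in> ops \<Longrightarrow> S - T \<in> ops"
  by (simp add: ops_iff blinfun.diff_left scaleC_diff_right)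

lemma ops_scaleR: "T \<in> ops \<Longrightarrow> r *\<^sub>R T \<in> ops"
  by (simp add: ops_iff blinfun.scaleR_left scaleC_scaleR)

lemma ops_scaleC_blinfun: "T \<in> ops \<Longrightarrow> c *\<^sub>C T \<in> ops"
  by (simp add: ops_iff scaleC_blinfun.rep_eq scaleC_scaleC mult.commute)

lemma ops_eq_on_ket:
  fixes S T :: "'i ell2 \<Rightarrow>\<^sub>L 'i ell2"
  assumes "S \<in> ops" "T \<in> ops" "\<And>i. S (ket i) = T (ket i)"
  shows "S = T"
proof (rule blinfun_eqI)
  fix x
  have *: "((\<lambda>F. R (\<Sum>i\<in>F. ell2_apply x i *\<^sub>C ket i)) \<longlongrightarrow> R x) (finite_subsets_at_top UNIV)"
    for R :: "'i ell2 \<Rightarrow>\<^sub>L 'i ell2"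
    by (rule blinfun.tendsto [OF tendsto_const ket_expansion])
  have "S (\<Sum>i\<in>F. ell2_apply x i *\<^sub>C ket i) = T (\<Sum>i\<in>F. ell2_apply x i *\<^sub>C ket i)" for F
    by (simp add: blinfun.sum_right ops_scaleC assms)
  then show "S x = T x"
    using tendsto_unique [OF finite_subsets_at_top_neq_bot * [of S]] * [of T] by simp
qed

text \<open>\<open>cadjoint\<close> is a definite description, so nothing can be said about it
  before an adjoint is exhibited. Its coordinates at \<open>y\<close> have to be
  \<open>cinner y (T (ket i))\<close>; the work is their square-summability.\<close>

lemma adjoint_exists:
  fixes T :: "'i ell2 \<Rightarrow>\<^sub>L 'i ell2"
  assumes T: "T \<in> ops"
  shows "\<exists>S\<in>ops. \<forall>x y. cinner (T x) y = cinner x (S y)"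
proof -
  define s where "s y i = cinner y (T (ket i))" for y i
  have fin: "(\<Sum>i\<in>F. (cmod (s y i))\<^sup>2) \<le> (norm T * norm y)\<^sup>2" if F: "finite F" for F y
  proof -
    \<comment> \<open>Testing \<open>T\<close> on the truncated candidate itself makes the partial
      sum equal to \<open>norm z ^ 2\<close> and bounds it by
      \<open>norm T * norm y * norm z\<close>.\<close>
    define z where "z = (\<Sum>i\<in>F. s y i *\<^sub>C ket i)"
    let ?q = "\<Sum>i\<in>F. (cmod (s y i))\<^sup>2"
    have zi: "ell2_apply z i = (if i \<in> F then s y i else 0)" for i
      using F by (simp add: z_def ell2_apply_sum scaleC_ell2.rep_eq ket_apply if_distrib cong: if_cong)
    have "(norm z)\<^sup>2 = (\<Sum>\<^sub>\<infinity>i\<in>F. (cmod (s y i))\<^sup>2)"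
      unfolding norm_sq_ell2 by (rule infsum_cong_neutral) (auto simp: zi)
    then have nz: "(norm z)\<^sup>2 = ?q"
      using F by simp
    have "cinner y (T z) = (\<Sum>i\<in>F. cnj (s y i) * s y i)"
      by (simp add: z_def blinfun.sum_right ops_scaleC [OF T] cinner_sum_right cinner_scaleC_right s_def)
    also have "\<dots> = complex_of_real ?q"
      by (simp add: complex_norm_square mult.commute del: of_real_power)
    finally have "?q = cmod (cinner y (T z))"
      by (simp add: sum_nonneg del: of_real_sum)
    also have "\<dots> \<le> norm y * norm (T z)"
      by (rule cmod_cinner_le)
    also have "\<dots> \<le> norm y * (norm T * norm z)"
      by (intro mult_left_mono norm_blinfun) simp
    finally have "norm z * norm z \<le> (norm T * norm y) * norm z"
      by (simp add: nz power2_eq_square [symmetric] mult_ac)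
    then have "norm z \<le> norm T * norm y"
      by (cases "norm z = 0") auto
    then show ?thesis
      by (simp add: nz [symmetric] power_mono)
  qed
  have summ: "(\<lambda>i. (cmod (s y i))\<^sup>2) summable_on UNIV" for y
    by (rule nonneg_bdd_above_summable_on) (use fin in \<open>auto intro!: bdd_aboveI\<close>)
  define S where "S y = Abs_ell2 (s y)" for y
  have S: "ell2_apply (S y) i = s y i" for y i
    using summ by (simp add: S_def Abs_ell2_inverse)
  have bl: "bounded_linear S"
  proof (rule bounded_linear_intro [where K = "norm T"])
    show "S (x + y) = S x + S y" for x y
      by (rule ell2_eqI) (simp add: S s_def plus_ell2.rep_eq cinner_add_left)
    show "S (r *\<^sub>R x) = r *\<^sub>R S x" for r x
      by (rule ell2_eqI) (simp add: S s_def scaleC_ell2.rep_eq cinner_scaleC_left flip: scaleC_of_real)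
    show "norm (S x) \<le> norm x * norm T" for x
      by (rule ell2_norm_leI) (use fin in \<open>simp_all add: S mult.commute\<close>)
  qed
  define B where "B = Blinfun S"
  have B: "blinfun_apply B = S"
    using bl by (simp add: B_def bounded_linear_Blinfun_apply)
  have "B \<in> ops"
    by (auto simp: ops_iff B S s_def scaleC_ell2.rep_eq cinner_scaleC_left intro!: ell2_eqI)
  moreover have "cinner (T x) y = cinner x (B y)" for x y
  proof -
    have *: "cinner (T (\<Sum>i\<in>F. ell2_apply x i *\<^sub>C ket i)) y = cinner (\<Sum>i\<in>F. ell2_apply x i *\<^sub>C ket i) (B y)" for F
      by (simp add: blinfun.sum_right ops_scaleC [OF T] cinner_sum_left cinner_scaleC_left
          cinner_ket_left B S s_def flip: cinner_commute)
    let ?P = "\<lambda>F. \<Sum>i\<in>F. ell2_apply x i *\<^sub>C ket i"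
    have "((\<lambda>F. cinner (T (?P F)) y) \<longlongrightarrow> cinner (T x) y) (finite_subsets_at_top UNIV)"
      by (intro tendsto_cinner_left blinfun.tendsto tendsto_const ket_expansion)
    moreover have "((\<lambda>F. cinner (?P F) (B y)) \<longlongrightarrow> cinner x (B y)) (finite_subsets_at_top UNIV)"
      by (intro tendsto_cinner_left ket_expansion)
    ultimately show ?thesis
      unfolding * by (rule tendsto_unique [OF finite_subsets_at_top_neq_bot])
  qed
  ultimately show ?thesis
    by blast
qed

lemma cinner_ext: "(\<And>x. cinner x y = cinner x z) \<Longrightarrow> y = (z::'a::complex_hilbert_space)"
  using cinner_diff_right [of "y - z" y z] cinner_self [of "y - z"] by simp

lemma cadjoint_eqI:
  fixes S T :: "'h::complex_hilbert_space \<Rightarrow>\<^sub>L 'h"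
  assumes "\<And>x y. cinner (T x) y = cinner x (S y)"
  shows "cadjoint T = S"
  unfolding cadjoint_def
proof (rule the_equality)
  fix S' :: "'h \<Rightarrow>\<^sub>L 'h"
  assume "\<forall>x y. cinner (T x) y = cinner x (S' y)"
  with assms show "S' = S"
    by (intro blinfun_eqI cinner_ext) metis
qed (use assms in blast)

lemma
  fixes T :: "'i ell2 \<Rightarrow>\<^sub>L 'i ell2"
  assumes "T \<in> ops"
  shows cadjoint_ops: "cadjoint T \<in> ops"
    and cinner_cadjoint: "cinner (T x) y = cinner x (cadjoint T y)"
  using adjoint_exists [OF assms] cadjoint_eqI by metis+

lemma cinner_cadjoint': "T \<in> ops \<Longrightarrow> cinner (cadjoint T x) y = cinner x (T (y :: 'i ell2))"
  by (metis cinner_cadjoint cinner_commute)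

lemma cadjoint_cadjoint: "T \<in> ops \<Longrightarrow> cadjoint (cadjoint T) = (T :: 'i ell2 \<Rightarrow>\<^sub>L 'i ell2)"
  by (rule cadjoint_eqI) (rule cinner_cadjoint')

lemma cadjoint_compose:
  "S \<in> ops \<Longrightarrow> T \<in> ops \<Longrightarrow> cadjoint (S o\<^sub>L T) = cadjoint T o\<^sub>L cadjoint (S :: 'i ell2 \<Rightarrow>\<^sub>L 'i ell2)"
  by (rule cadjoint_eqI) (simp add: cinner_cadjoint)

lemma inner_cadjoint: "T \<in> ops \<Longrightarrow> inner (T x) y = inner x (cadjoint T (y :: 'i ell2))"
  by (simp add: inner_eq_Re_cinner cinner_cadjoint)

text \<open>The imaginary part of \<open>cinner\<close> is a real inner product against
  \<open>\<i> *\<^sub>C y\<close>, so complex-linearity of \<open>S\<close> upgrades the real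
  identity to the complex one.\<close>

lemma cadjoint_eqI_inner:
  fixes S T :: "'h::complex_hilbert_space \<Rightarrow>\<^sub>L 'h"
  assumes "S \<in> ops" "\<And>x y. inner (T x) y = inner x (S y)"
  shows "cadjoint T = S"
  by (rule cadjoint_eqI) (simp add: cinner_conv_inner assms flip: ops_scaleC [OF assms(1)])

lemma cadjoint_add:
  "S \<in> ops \<Longrightarrow> T \<in> ops \<Longrightarrow> cadjoint (S + T) = cadjoint S + cadjoint (T :: 'i ell2 \<Rightarrow>\<^sub>L 'i ell2)"
  by (rule cadjoint_eqI) (simp add: blinfun.add_left cinner_add_left cinner_add_right cinner_cadjoint)

lemma cadjoint_scaleC:
  "T \<in> ops \<Longrightarrow> cadjoint (c *\<^sub>C T) = cnj c *\<^sub>C cadjoint (T :: 'i ell2 \<Rightarrow>\<^sub>L 'i ell2)"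
  by (rule cadjoint_eqI) (simp add: scaleC_blinfun.rep_eq cinner_scaleC_left cinner_scaleC_right cinner_cadjoint)

lemma scaleR_scaleC_blinfun: "r *\<^sub>R T = complex_of_real r *\<^sub>C (T :: 'h::complex_hilbert_space \<Rightarrow>\<^sub>L 'h)"
  by (rule blinfun_eqI) (simp add: scaleC_blinfun.rep_eq blinfun.scaleR_left scaleC_of_real)

lemma cadjoint_scaleR:
  "T \<in> ops \<Longrightarrow> cadjoint (r *\<^sub>R T) = r *\<^sub>R cadjoint (T :: 'i ell2 \<Rightarrow>\<^sub>L 'i ell2)"
  by (simp add: scaleR_scaleC_blinfun cadjoint_scaleC)

section \<open>Commutants and their closure properties\<close>

lemma commutant_ops: "T \<in> commutant S \<Longrightarrow> T \<in> ops"
  by (simp add: commutant_def)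

lemma commutantD: "T \<in> commutant S \<Longrightarrow> A \<in> S \<Longrightarrow> T o\<^sub>L A = A o\<^sub>L T"
  by (simp add: commutant_def)

lemma commutantD_apply:
  fixes A T :: "'h::complex_hilbert_space \<Rightarrow>\<^sub>L 'h"
  shows "T \<in> commutant S \<Longrightarrow> A \<in> S \<Longrightarrow> T (A x) = A (T x)"
  by (metis blinfun_apply_blinfun_compose commutantD)

lemma commutantI:
  fixes T :: "'h::complex_hilbert_space \<Rightarrow>\<^sub>L 'h" and S :: "('h \<Rightarrow>\<^sub>L 'h) set"
  shows "T \<in> ops \<Longrightarrow> (\<And>A x. A \<in> S \<Longrightarrow> T (A x) = A (T x)) \<Longrightarrow> T \<in> commutant S"
  by (auto simp: commutant_def intro!: blinfun_eqI)

lemma commutant_antimono: "S \<subseteq> S' \<Longrightarrow> commutant S' \<subseteq> commutant S"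
  by (auto simp: commutant_def)

lemma commutant_double: "S \<subseteq> ops \<Longrightarrow> S \<subseteq> commutant (commutant S)"
  by (auto simp: commutant_def)

lemma commutant_triple: "S \<subseteq> ops \<Longrightarrow> commutant (commutant (commutant S)) = commutant S"
  by (meson commutant_antimono commutant_double commutant_ops subset_antisym subsetI)

lemma commutant_compose: "T \<in> commutant S \<Longrightarrow> T' \<in> commutant S \<Longrightarrow> T o\<^sub>L T' \<in> commutant S"
  by (rule commutantI) (simp_all add: ops_compose commutant_ops commutantD_apply)

lemma commutant_id: "id_blinfun \<in> commutant S"
  by (rule commutantI) (simp_all add: ops_id)

lemma commutant_add: "T \<in> commutant S \<Longrightarrow> T' \<in> commutant S \<Longrightarrow> T + T' \<in> commutant S"
  by (rule commutantI) (simp_all add: ops_add commutant_ops commutantD_apply blinfun.add_left blinfun.add_right)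

lemma commutant_diff: "T \<in> commutant S \<Longrightarrow> T' \<in> commutant S \<Longrightarrow> T - T' \<in> commutant S"
  by (rule commutantI) (simp_all add: ops_diff commutant_ops commutantD_apply blinfun.diff_left blinfun.diff_right)

lemma commutant_scaleR: "T \<in> commutant S \<Longrightarrow> r *\<^sub>R T \<in> commutant S"
  by (rule commutantI) (simp_all add: ops_scaleR commutant_ops commutantD_apply blinfun.scaleR_left blinfun.scaleR_right)

lemma commutant_cadjoint:
  fixes T :: "'i ell2 \<Rightarrow>\<^sub>L 'i ell2"
  assumes S: "S \<subseteq> ops" "\<And>A. A \<in> S \<Longrightarrow> cadjoint A \<in> S" and T: "T \<in> commutant S"
  shows "cadjoint T \<in> commutant S"
proof (rule commutantI)
  show "cadjoint T \<in> ops"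
    using T by (simp add: cadjoint_ops commutant_ops)
  fix A x
  assume A: "A \<in> S"
  then have "A \<in> ops" "cadjoint A \<in> S"
    using S by auto
  have "cadjoint T o\<^sub>L A = cadjoint (cadjoint A o\<^sub>L T)"
    using A T \<open>A \<in> ops\<close> by (simp add: cadjoint_compose cadjoint_ops commutant_ops cadjoint_cadjoint)
  also have "\<dots> = cadjoint (T o\<^sub>L cadjoint A)"
    by (simp add: commutantD [OF T \<open>cadjoint A \<in> S\<close>])
  also have "\<dots> = A o\<^sub>L cadjoint T"
    using A T \<open>A \<in> ops\<close> by (simp add: cadjoint_compose cadjoint_ops commutant_ops cadjoint_cadjoint)
  finally show "cadjoint T (A x) = A (cadjoint T x)"
    by (metis blinfun_apply_blinfun_compose)
qed

text \<open>Used for the strong limit of the defects in the polar iteration and, with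
  \<open>S = {}\<close>, for elements of the group algebra obtained as norm limits.\<close>

lemma commutant_limit:
  fixes T :: "'h::complex_hilbert_space \<Rightarrow>\<^sub>L 'h"
  assumes "\<And>n. u n \<in> commutant S" "\<And>x. (\<lambda>n. blinfun_apply (u n) x) \<longlonglongrightarrow> T x"
  shows "T \<in> commutant S"
proof (rule commutantI)
  show "T \<in> ops"
    unfolding ops_iff
  proof (intro allI)
    fix c x
    have "(\<lambda>n. u n (c *\<^sub>C x)) \<longlonglongrightarrow> c *\<^sub>C T x"
      using bounded_linear.tendsto [OF bounded_linear_scaleC assms(2)]
      by (simp add: ops_scaleC commutant_ops [OF assms(1)])
    then show "T (c *\<^sub>C x) = c *\<^sub>C T x"
      using LIMSEQ_unique assms(2) by blast
  qed
  fix A x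
  assume A: "A \<in> S"
  have "(\<lambda>n. u n (A x)) \<longlonglongrightarrow> A (T x)"
    using blinfun.tendsto [OF tendsto_const assms(2), of A] by (simp add: commutantD_apply [OF assms(1) A])
  then show "T (A x) = A (T x)"
    using LIMSEQ_unique assms(2) by blast
qed

section \<open>Operators of partial injections and matrix entries\<close>

text \<open>One construction covers permutation unitaries, coordinate projections and the isometry
  of a non-surjective injection: each sends a basis vector to a basis vector or to zero.\<close>

definition pinj_op :: "'i set \<Rightarrow> ('i \<Rightarrow> 'i) \<Rightarrow> 'i ell2 \<Rightarrow>\<^sub>L 'i ell2" where
  "pinj_op A \<sigma> = Blinfun (\<lambda>x. Abs_ell2 (\<lambda>i. if i \<in> \<sigma> ` A then ell2_apply x (inv_into A \<sigma> i) else 0))"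

lemma pinj_op_apply:
  assumes \<sigma>: "inj_on \<sigma> A"
  shows "ell2_apply (pinj_op A \<sigma> x) i = (if i \<in> \<sigma> ` A then ell2_apply x (inv_into A \<sigma> i) else 0)"
proof -
  let ?f = "\<lambda>x i. if i \<in> \<sigma> ` A then ell2_apply x (inv_into A \<sigma> i) else 0"
  have fin: "(\<Sum>i\<in>F. (cmod (?f x i))\<^sup>2) \<le> (norm x)\<^sup>2" if "finite F" for F x
  proof -
    have "(\<Sum>i\<in>F. (cmod (?f x i))\<^sup>2) = (\<Sum>i\<in>F \<inter> \<sigma> ` A. (cmod (ell2_apply x (inv_into A \<sigma> i)))\<^sup>2)"
      using that by (intro sum.mono_neutral_cong_right) auto
    also have "\<dots> = (\<Sum>j\<in>inv_into A \<sigma> ` (F \<inter> \<sigma> ` A). (cmod (ell2_apply x j))\<^sup>2)"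
      by (subst sum.reindex) (auto simp: inj_on_inv_into)
    also have "\<dots> \<le> (norm x)\<^sup>2"
      using that by (intro ell2_finite_sum_le) auto
    finally show ?thesis .
  qed
  have "(\<lambda>i. (cmod (?f x i))\<^sup>2) summable_on UNIV" for x
    by (rule nonneg_bdd_above_summable_on) (use fin in \<open>auto intro!: bdd_aboveI\<close>)
  then have ap: "ell2_apply (Abs_ell2 (?f x)) = ?f x" for x
    by (simp add: Abs_ell2_inverse)
  have "bounded_linear (\<lambda>x. Abs_ell2 (?f x))"
  proof (rule bounded_linear_intro [where K = 1])
    show "Abs_ell2 (?f (x + y)) = Abs_ell2 (?f x) + Abs_ell2 (?f y)" for x y
      by (rule ell2_eqI) (simp add: ap plus_ell2.rep_eq)
    show "Abs_ell2 (?f (r *\<^sub>R x)) = r *\<^sub>R Abs_ell2 (?f x)" for r x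
      by (rule ell2_eqI) (simp add: ap scaleC_ell2.rep_eq scaleR_ell2_def)
    show "norm (Abs_ell2 (?f x)) \<le> norm x * 1" for x
      by (rule ell2_norm_leI) (use fin [of _ x] in \<open>simp_all add: ap\<close>)
  qed
  then show ?thesis
    by (simp add: pinj_op_def bounded_linear_Blinfun_apply ap)
qed

lemma pinj_op_ops: "inj_on \<sigma> A \<Longrightarrow> pinj_op A \<sigma> \<in> ops"
  by (auto simp: ops_iff pinj_op_apply scaleC_ell2.rep_eq intro!: ell2_eqI)

lemma pinj_op_ket:
  assumes \<sigma>: "inj_on \<sigma> A"
  shows "pinj_op A \<sigma> (ket i) = (if i \<in> A then ket (\<sigma> i) else 0)"
  using assms by (intro ell2_eqI) (auto simp: pinj_op_apply ket_apply zero_ell2.rep_eq inv_into_into)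

lemma cadjoint_eqI_ket:
  fixes S T :: "'i ell2 \<Rightarrow>\<^sub>L 'i ell2"
  assumes ops: "S \<in> ops" "T \<in> ops" and "\<And>i j. ell2_apply (T (ket i)) j = cnj (ell2_apply (S (ket j)) i)"
  shows "cadjoint T = S"
proof (rule ops_eq_on_ket)
  fix j
  show "cadjoint T (ket j) = S (ket j)"
  proof (rule ell2_eqI)
    fix i
    have "ell2_apply (cadjoint T (ket j)) i = cinner (ket j) (T (ket i))"
      by (simp add: cinner_cadjoint' ops flip: cinner_ket)
    then show "ell2_apply (cadjoint T (ket j)) i = ell2_apply (S (ket j)) i"
      by (simp add: cinner_ket_left assms)
  qed
qed (use ops in \<open>simp_all add: cadjoint_ops\<close>)

lemma cadjoint_pinj_op:
  assumes \<sigma>: "inj_on \<sigma> A"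
  shows "cadjoint (pinj_op A \<sigma>) = pinj_op (\<sigma> ` A) (inv_into A \<sigma>)"
proof (rule cadjoint_eqI_ket)
  have *: "inj_on (inv_into A \<sigma>) (\<sigma> ` A)"
    by (simp add: inj_on_inv_into)
  then show "pinj_op (\<sigma> ` A) (inv_into A \<sigma>) \<in> ops"
    by (rule pinj_op_ops)
  show "ell2_apply (pinj_op A \<sigma> (ket i)) j
      = cnj (ell2_apply (pinj_op (\<sigma> ` A) (inv_into A \<sigma>) (ket j)) i)" for i j
  proof -
    have "j \<in> \<sigma> ` A \<and> inv_into A \<sigma> j = i \<longleftrightarrow> i \<in> A \<and> \<sigma> i = j"
      using \<sigma> by (auto simp: f_inv_into_f inv_into_into)
    then show ?thesis
      by (auto simp: pinj_op_ket [OF *] pinj_op_ket [OF \<sigma>] ket_apply zero_ell2.rep_eq)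
  qed
qed (use assms pinj_op_ops in blast)

abbreviation perm_op :: "('i \<Rightarrow> 'i) \<Rightarrow> 'i ell2 \<Rightarrow>\<^sub>L 'i ell2" where
  "perm_op \<equiv> pinj_op UNIV"

abbreviation restr_op :: "'i set \<Rightarrow> 'i ell2 \<Rightarrow>\<^sub>L 'i ell2" where
  "restr_op A \<equiv> pinj_op A id"

lemma perm_op_ops: "bij g \<Longrightarrow> perm_op g \<in> ops"
  by (simp add: pinj_op_ops bij_is_inj)

lemma perm_op_ket: "bij g \<Longrightarrow> perm_op g (ket i) = ket (g i)"
  by (simp add: pinj_op_ket bij_is_inj)

lemma perm_op_apply: "bij g \<Longrightarrow> ell2_apply (perm_op g x) (g i) = ell2_apply x i"
  by (simp add: pinj_op_apply bij_is_inj)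

lemma cadjoint_perm_op: "bij g \<Longrightarrow> cadjoint (perm_op g) = perm_op (inv g)"
  by (simp add: cadjoint_pinj_op bij_is_inj bij_is_surj)

lemma perm_op_compose: "bij g \<Longrightarrow> bij h \<Longrightarrow> perm_op g o\<^sub>L perm_op h = perm_op (g \<circ> h)"
  by (rule ops_eq_on_ket) (simp_all add: ops_compose perm_op_ops bij_comp perm_op_ket)

lemma perm_op_id: "perm_op id = id_blinfun"
  by (rule ops_eq_on_ket) (simp_all add: perm_op_ops ops_id perm_op_ket)

lemma perm_op_perm_op: "bij g \<Longrightarrow> bij h \<Longrightarrow> perm_op g (perm_op h x) = perm_op (g \<circ> h) x"
  by (simp flip: perm_op_compose)

lemma norm_perm_op: "bij g \<Longrightarrow> norm (perm_op g x) = norm x"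
proof -
  assume g: "bij g"
  have "inner (perm_op g x) (perm_op g x) = inner x (perm_op (inv g) (perm_op g x))"
    using g by (simp add: inner_cadjoint perm_op_ops cadjoint_perm_op)
  also have "\<dots> = inner x x"
    using g by (simp add: perm_op_perm_op bij_imp_bij_inv perm_op_id bij_is_inj)
  finally show ?thesis
    by (simp add: norm_eq_sqrt_inner)
qed

lemma restr_op_ops: "restr_op A \<in> ops"
  by (simp add: pinj_op_ops)

lemma restr_op_apply: "ell2_apply (restr_op A x) i = (if i \<in> A then ell2_apply x i else 0)"
  by (simp add: pinj_op_apply inv_into_f_eq)

lemma restr_op_ket: "restr_op A (ket i) = (if i \<in> A then ket i else 0)"
  by (simp add: pinj_op_ket)

lemma cadjoint_restr_op: "cadjoint (restr_op A) = restr_op A"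
  by (rule cadjoint_eqI_ket) (auto simp: restr_op_ops restr_op_ket ket_apply zero_ell2.rep_eq)

lemma restr_op_UNIV: "restr_op UNIV = id_blinfun"
  by (rule perm_op_id)

lemma ops_apply_expand:
  fixes T :: "'i ell2 \<Rightarrow>\<^sub>L 'i ell2"
  assumes "T \<in> ops"
  shows "ell2_apply (T v) y = (\<Sum>\<^sub>\<infinity>z. ell2_apply v z * ell2_apply (T (ket z)) y)"
proof -
  have "ell2_apply (T v) y = cinner v (cadjoint T (ket y))"
    using assms by (simp add: cinner_cadjoint flip: cinner_ket)
  moreover have "cnj (ell2_apply (cadjoint T (ket y)) z) = ell2_apply (T (ket z)) y" for z
    using assms by (metis cinner_cadjoint cinner_ket cinner_ket_left)
  ultimately show ?thesis
    by (simp add: cinner_ell2_def)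
qed

text \<open>Together with the converse \<open>commute_perm_opI\<close> this turns commutation into
  invariance of matrix entries under the diagonal action, the form in which commutants are handled
  below.\<close>

lemma commute_perm_op_entry:
  fixes T :: "'i ell2 \<Rightarrow>\<^sub>L 'i ell2"
  assumes "bij g" "\<And>v. T (perm_op g v) = perm_op g (T v)"
  shows "ell2_apply (T (ket (g x))) (g y) = ell2_apply (T (ket x)) y"
  using assms by (metis perm_op_apply perm_op_ket)

lemma commute_perm_opI:
  fixes T :: "'i ell2 \<Rightarrow>\<^sub>L 'i ell2"
  assumes "T \<in> ops" and g: "bij g"
    and "\<And>x y. ell2_apply (T (ket (g x))) (g y) = ell2_apply (T (ket x)) y"
  shows "T (perm_op g v) = perm_op g (T v)"
proof -
  have "T o\<^sub>L perm_op g = perm_op g o\<^sub>L T"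
  proof (rule ops_eq_on_ket)
    fix x
    have "T (ket (g x)) = perm_op g (T (ket x))"
    proof (rule ell2_eqI)
      fix z
      obtain y where "z = g y"
        using g by (metis bij_pointE)
      then show "ell2_apply (T (ket (g x))) z = ell2_apply (perm_op g (T (ket x))) z"
        using assms by (simp add: perm_op_apply)
    qed
    then show "(T o\<^sub>L perm_op g) (ket x) = (perm_op g o\<^sub>L T) (ket x)"
      using g by (simp add: perm_op_ket)
  qed (use assms in \<open>simp_all add: ops_compose perm_op_ops\<close>)
  then show ?thesis
    by (metis blinfun_apply_blinfun_compose)
qed

text \<open>The point at which infinite orbits act on operators: a coefficient that is invariant
  along one of them must vanish.\<close>

lemma ell2_constant_on_infinite:
  assumes "infinite K" "\<And>k. k \<in> K \<Longrightarrow> ell2_apply v k = z"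
  shows "z = 0"
proof (rule ccontr)
  assume "z \<noteq> 0"
  then obtain n :: nat where n: "(norm v)\<^sup>2 < real n * (cmod z)\<^sup>2"
    using reals_Archimedean3 [of "(cmod z)\<^sup>2"] by auto
  obtain F where F: "finite F" "card F = n" "F \<subseteq> K"
    using infinite_arbitrarily_large [OF assms(1)] by blast
  have "real n * (cmod z)\<^sup>2 = (\<Sum>i\<in>F. (cmod (ell2_apply v i))\<^sup>2)"
    using F assms(2) by (simp add: subset_iff)
  also have "\<dots> \<le> (norm v)\<^sup>2"
    using F(1) by (rule ell2_finite_sum_le)
  finally show False
    using n by simp
qed

section \<open>Commuting actions: the double commutant, its centre and the substitute for a
  trace\<close>

text \<open>\<open>orbit_AB\<close> is the ICC condition on \<open>B\<close>: if
  \<open>g (h' c) = c\<close>, commutation gives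
  \<open>g (h' (h c)) = (h' \<circ> h \<circ> inv h') c\<close>, and by \<open>trans\<close> a
  suitable \<open>g\<close> exists for every \<open>h'\<close>. In this form it applies directly to
  an operator whose entries are invariant under both actions.\<close>

locale commuting_actions =
  fixes A B :: "('i \<Rightarrow> 'i) set" and c :: 'i
  assumes A_bij: "g \<in> A \<Longrightarrow> bij g" and A_inv: "g \<in> A \<Longrightarrow> inv g \<in> A"
    and B_bij: "h \<in> B \<Longrightarrow> bij h" and B_inv: "h \<in> B \<Longrightarrow> inv h \<in> B"
    and B_id: "id \<in> B" and B_comp: "h \<in> B \<Longrightarrow> h' \<in> B \<Longrightarrow> h \<circ> h' \<in> B"
    and comm: "g \<in> A \<Longrightarrow> h \<in> B \<Longrightarrow> g (h x) = h (g x)"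
    and free: "h \<in> B \<Longrightarrow> h' \<in> B \<Longrightarrow> h x = h' x \<Longrightarrow> h = h'"
    and trans: "\<exists>g\<in>A. g c = x"
    and orbit_A: "x \<notin> (\<lambda>h. h c) ` B \<Longrightarrow> infinite {g x |g. g \<in> A \<and> g c = c}"
    and orbit_AB: "h \<in> B \<Longrightarrow> h c \<noteq> c \<Longrightarrow> infinite {g (h' (h c)) |g h'. g \<in> A \<and> h' \<in> B \<and> g (h' c) = c}"
begin



definition vna :: "('i ell2 \<Rightarrow>\<^sub>L 'i ell2) set" where
  "vna = commutant (commutant (perm_op ` A))"

abbreviation base_orbit :: "'i set" where
  "base_orbit \<equiv> (\<lambda>h. h c) ` B"

lemma perm_op_A_subset: "perm_op ` A \<subseteq> ops"
  using A_bij perm_op_ops by blast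

lemma perm_op_A_cadjoint: "T \<in> perm_op ` A \<Longrightarrow> cadjoint T \<in> perm_op ` A"
  using A_bij A_inv cadjoint_perm_op by auto

lemma perm_op_A_vna: "g \<in> A \<Longrightarrow> perm_op g \<in> vna"
  using commutant_double [OF perm_op_A_subset] by (auto simp: vna_def)

lemma vna_ops: "T \<in> vna \<Longrightarrow> T \<in> ops"
  unfolding vna_def by (rule commutant_ops)

lemma perm_op_B_commutant: "h \<in> B \<Longrightarrow> perm_op h \<in> commutant (perm_op ` A)"
proof (rule commutantI)
  fix T x
  assume h: "h \<in> B" and "T \<in> perm_op ` A"
  then obtain g where g: "g \<in> A" "T = perm_op g"
    by blast
  then have "h \<circ> g = g \<circ> h"
    using comm [OF g(1) h] by (simp add: fun_eq_iff)
  then show "perm_op h (T x) = T (perm_op h x)"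
    using g h by (simp add: perm_op_perm_op A_bij B_bij)
qed (simp add: B_bij perm_op_ops)

lemma vna_entry:
  "T \<in> vna \<Longrightarrow> h \<in> B \<Longrightarrow> ell2_apply (T (ket (h x))) (h y) = ell2_apply (T (ket x)) y"
  by (rule commute_perm_op_entry [OF B_bij commutantD_apply [OF _ perm_op_B_commutant]])
    (auto simp: vna_def)

lemma commutant_A_entry:
  "S \<in> commutant (perm_op ` A) \<Longrightarrow> g \<in> A \<Longrightarrow> ell2_apply (S (ket (g x))) (g y) = ell2_apply (S (ket x)) y"
  using commute_perm_op_entry [OF A_bij commutantD_apply [OF _ imageI [where f = perm_op and A = A]]] .

text \<open>Formally \<open>S\<close> is the sum over \<open>B\<close> of \<open>s h\<close> times
  \<open>perm_op h\<close>, but this sum need not converge in norm. The two products are therefore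
  compared entry by entry: both entries equal the sum over \<open>B\<close> of \<open>s h\<close>
  times the entry of \<open>T\<close> from \<open>x\<close> to \<open>inv h y\<close>.\<close>

lemma vnaI:
  assumes T: "T \<in> ops"
    and inv: "\<And>h x y. h \<in> B \<Longrightarrow> ell2_apply (T (ket (h x))) (h y) = ell2_apply (T (ket x)) y"
  shows "T \<in> vna"
  unfolding vna_def
proof (rule commutantI [OF T])
  fix S v
  assume S: "S \<in> commutant (perm_op ` A)"
  note S_ops = commutant_ops [OF S]
  have S0: "ell2_apply (S (ket c)) x = 0" if x: "x \<notin> (\<lambda>h. h c) ` B" for x
    by (rule ell2_constant_on_infinite [OF orbit_A [OF x], where v = "S (ket c)"])
      (use commutant_A_entry [OF S, where x = c] in force)+
  define s where "s h = ell2_apply (S (ket c)) (h c)" for h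
  have S1: "ell2_apply (S (ket x)) (h x) = s h" if h: "h \<in> B" for h x
  proof -
    obtain g where g: "g \<in> A" "g c = x"
      using trans by blast
    then show ?thesis
      using commutant_A_entry [OF S g(1), of c "h c"] comm [OF g(1) h, of c] by (simp add: s_def)
  qed
  have S2: "\<exists>h\<in>B. z = h x" if nz: "ell2_apply (S (ket x)) z \<noteq> 0" for z x
  proof -
    obtain g where g: "g \<in> A" "g c = x"
      using trans by blast
    obtain w where w: "z = g w"
      using A_bij [OF g(1)] by (metis bij_pointE)
    then have "ell2_apply (S (ket c)) w \<noteq> 0"
      using nz commutant_A_entry [OF S g(1), of c w] g by simp
    then obtain h where "h \<in> B" "w = h c"
      using S0 by blast
    then show ?thesis
      using comm [OF g(1)] g w by auto
  qed
  have "T o\<^sub>L S = S o\<^sub>L T"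
  proof (rule ops_eq_on_ket)
    fix x
    show "(T o\<^sub>L S) (ket x) = (S o\<^sub>L T) (ket x)"
    proof (rule ell2_eqI)
      fix y
      have inj: "inj_on (\<lambda>h. h x) B"
        using free by (auto intro!: inj_onI)
      have inj': "inj_on (\<lambda>h. inv h y) B"
      proof (rule inj_onI)
        fix h h'
        assume h: "h \<in> B" "h' \<in> B" "inv h y = inv h' y"
        then have "inv h = inv h'"
          using free B_inv by blast
        then show "h = h'"
          using h B_bij by (metis inv_inv_eq)
      qed
      have TB: "ell2_apply (T (ket (h x))) y = ell2_apply (T (ket x)) (inv h y)" if "h \<in> B" for h
        using inv [OF that, of x "inv h y"] B_bij [OF that] by (simp add: bij_is_surj surj_f_inv_f)
      have SB: "ell2_apply (S (ket (inv h y))) y = s h" if "h \<in> B" for h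
        using S1 [OF that, of "inv h y"] B_bij [OF that] by (simp add: bij_is_surj surj_f_inv_f)
      have "ell2_apply (T (S (ket x))) y = (\<Sum>\<^sub>\<infinity>z. ell2_apply (S (ket x)) z * ell2_apply (T (ket z)) y)"
        by (rule ops_apply_expand [OF T])
      also have "\<dots> = (\<Sum>\<^sub>\<infinity>z\<in>(\<lambda>h. h x) ` B. ell2_apply (S (ket x)) z * ell2_apply (T (ket z)) y)"
        by (rule infsum_cong_neutral) (use S2 in force)+
      also have "\<dots> = (\<Sum>\<^sub>\<infinity>h\<in>B. s h * ell2_apply (T (ket x)) (inv h y))"
        using S1 TB by (auto simp: infsum_reindex [OF inj] intro!: infsum_cong)
      \<comment> \<open>For the other product the intermediate point lies in the
        \<open>B\<close>-orbit of \<open>y\<close> instead of that of \<open>x\<close>, and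
        \<open>inv h y\<close> parametrises it.\<close>
      also have "\<dots> = (\<Sum>\<^sub>\<infinity>z\<in>(\<lambda>h. inv h y) ` B. ell2_apply (T (ket x)) z * ell2_apply (S (ket z)) y)"
        using SB by (auto simp: infsum_reindex [OF inj'] mult.commute intro!: infsum_cong)
      also have "\<dots> = (\<Sum>\<^sub>\<infinity>z. ell2_apply (T (ket x)) z * ell2_apply (S (ket z)) y)"
      proof (rule infsum_cong_neutral)
        fix z
        assume "z \<in> UNIV - (\<lambda>h. inv h y) ` B"
        then have "ell2_apply (S (ket z)) y = 0"
          using S2 [of z y] B_bij by (force simp: bij_is_inj)
        then show "ell2_apply (T (ket x)) z * ell2_apply (S (ket z)) y = 0"
          by simp
      qed auto
      also have "\<dots> = ell2_apply (S (T (ket x))) y"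
        by (rule ops_apply_expand [OF S_ops, symmetric])
      finally show "ell2_apply ((T o\<^sub>L S) (ket x)) y = ell2_apply ((S o\<^sub>L T) (ket x)) y"
        by simp
    qed
  qed (use T S_ops in \<open>simp_all add: ops_compose\<close>)
  then show "T (S v) = S (T v)"
    by (metis blinfun_apply_blinfun_compose)
qed

lemma commutant_vna: "commutant vna = commutant (perm_op ` A)"
  unfolding vna_def by (rule commutant_triple [OF perm_op_A_subset])

lemma vna_cadjoint: "T \<in> vna \<Longrightarrow> cadjoint T \<in> vna"
  unfolding vna_def
  by (rule commutant_cadjoint)
    (auto simp: commutant_ops intro: commutant_cadjoint [OF perm_op_A_subset perm_op_A_cadjoint])

lemma von_neumann_algebra_vna: "von_neumann_algebra vna"
  unfolding von_neumann_algebra_def commutant_vna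
  using vna_cadjoint vna_ops by (auto simp: vna_def)

lemma ops_scaleC_id: "z *\<^sub>C id_blinfun \<in> (ops :: ('i ell2 \<Rightarrow>\<^sub>L 'i ell2) set)"
  by (simp add: ops_scaleC_blinfun ops_id)

text \<open>A central operator has entries invariant under both actions, so each off-diagonal entry
  of its column at \<open>c\<close> repeats along an infinite set: a conjugacy class of
  \<open>B\<close> if the point is in the base orbit, an orbit of the stabiliser of \<open>c\<close>
  otherwise. Transitivity copies the surviving diagonal entry to every point.\<close>

lemma factor_vna: "factor vna"
  unfolding factor_def
proof (intro conjI von_neumann_algebra_vna subset_antisym subsetI)
  fix T
  assume "T \<in> vna \<inter> commutant vna"
  then have T: "T \<in> vna" "T \<in> commutant (perm_op ` A)"
    by (auto simp: commutant_vna)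
  have T0: "ell2_apply (T (ket c)) x = 0" if "x \<noteq> c" for x
  proof (cases "\<exists>h\<in>B. x = h c")
    case True
    then obtain h where h: "h \<in> B" "x = h c"
      by blast
    show ?thesis
    proof (rule ell2_constant_on_infinite [where v = "T (ket c)"])
      show "infinite {g (h' (h c)) |g h'. g \<in> A \<and> h' \<in> B \<and> g (h' c) = c}"
        using h that by (intro orbit_AB) auto
      fix k
      assume "k \<in> {g (h' (h c)) |g h'. g \<in> A \<and> h' \<in> B \<and> g (h' c) = c}"
      then obtain g h' where "k = g (h' (h c))" "g \<in> A" "h' \<in> B" "g (h' c) = c"
        by blast
      then show "ell2_apply (T (ket c)) k = ell2_apply (T (ket c)) x"
        using commutant_A_entry [OF T(2), of g "h' c" "h' (h c)"] vna_entry [OF T(1), of h' c "h c"] h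
        by simp
    qed
  next
    case False
    then have x: "x \<notin> (\<lambda>h. h c) ` B"
      by blast
    show ?thesis
      by (rule ell2_constant_on_infinite [OF orbit_A [OF x], where v = "T (ket c)"])
        (use commutant_A_entry [OF T(2), where x = c] in force)+
  qed
  define z where "z = ell2_apply (T (ket c)) c"
  have "T = z *\<^sub>C id_blinfun"
  proof (rule ops_eq_on_ket)
    fix x
    obtain g where g: "g \<in> A" "g c = x"
      using trans by blast
    have "T (ket c) = z *\<^sub>C ket c"
      using T0 by (intro ell2_eqI) (auto simp: z_def scaleC_ell2.rep_eq ket_apply)
    then have "perm_op g (T (ket c)) = z *\<^sub>C ket x"
      using g A_bij by (simp add: ops_scaleC perm_op_ops perm_op_ket)
    then show "T (ket x) = (z *\<^sub>C id_blinfun) (ket x)"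
      using commutantD_apply [OF T(2), of "perm_op g" "ket c"] g A_bij
      by (simp add: perm_op_ket scaleC_blinfun.rep_eq)
  qed (use T vna_ops ops_scaleC_id in auto)
  then show "T \<in> range (\<lambda>c. c *\<^sub>C id_blinfun)"
    by blast
next
  fix T :: "'i ell2 \<Rightarrow>\<^sub>L 'i ell2"
  assume "T \<in> range (\<lambda>c. c *\<^sub>C id_blinfun)"
  then obtain z where T: "T = z *\<^sub>C id_blinfun"
    by blast
  have "T \<in> commutant S" if "S \<subseteq> ops" for S
    by (rule commutantI) (use that ops_scaleC_id in \<open>auto simp: T scaleC_blinfun.rep_eq ops_scaleC subset_iff\<close>)
  then show "T \<in> vna \<inter> commutant vna"
    using vna_ops commutant_ops by (auto simp: vna_def)
qed

lemma base_orbit_B: "h \<in> B \<Longrightarrow> h x \<in> base_orbit \<longleftrightarrow> x \<in> base_orbit"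
proof
  assume h: "h \<in> B" "h x \<in> base_orbit"
  then obtain h' where "h' \<in> B" "h x = h' c"
    by blast
  then have "x = (inv h \<circ> h') c"
    using B_bij [OF h(1)] by (metis bij_inv_eq_iff comp_apply)
  then show "x \<in> base_orbit"
    using B_comp B_inv h \<open>h' \<in> B\<close> by blast
next
  assume "h \<in> B" "x \<in> base_orbit"
  then show "h x \<in> base_orbit"
    using B_comp by (metis (no_types, lifting) comp_apply image_iff)
qed

lemma restr_op_vna: "restr_op base_orbit \<in> vna"
  by (rule vnaI) (use B_bij base_orbit_B in \<open>auto simp: restr_op_ops restr_op_ket ket_apply zero_ell2.rep_eq bij_is_inj inj_eq\<close>)

lemma restr_op_projection: "restr_op base_orbit \<in> projections vna"
  by (auto simp: projections_def restr_op_vna cadjoint_restr_op restr_op_apply intro!: blinfun_eqI ell2_eqI)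

text \<open>The substitute for a trace. Invariance under \<open>B\<close> moves the column at
  \<open>i\<close> over the base orbit into the row at \<open>c\<close>, injectively because the
  action is free; the whole row at \<open>c\<close> is, up to conjugation, the column of the adjoint
  at \<open>c\<close>.\<close>

lemma norm_column_le_row:
  assumes u: "u \<in> vna" and range: "restr_op base_orbit o\<^sub>L u = u"
  shows "norm (u (ket i)) \<le> norm (cadjoint u (ket c))"
proof (rule ell2_norm_leI)
  fix F :: "'i set"
  assume F: "finite F"
  define H where "H = {h \<in> B. h c \<in> F}"
  have inj: "inj_on (\<lambda>h. h c) H"
    by (rule inj_onI) (use free in \<open>auto simp: H_def\<close>)
  have inj': "inj_on (\<lambda>h. inv h i) H"
  proof (rule inj_onI)
    fix h h'
    assume h: "h \<in> H" "h' \<in> H" "inv h i = inv h' i"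
    then have "inv h = inv h'"
      using free B_inv unfolding H_def by blast
    then show "h = h'"
      using h B_bij unfolding H_def by (metis (no_types, lifting) inv_inv_eq mem_Collect_eq)
  qed
  have "finite H"
    by (rule inj_on_finite [OF inj _ F]) (auto simp: H_def)
  have z: "ell2_apply (u (ket i)) x = 0" if "x \<notin> base_orbit" for x
    using arg_cong [OF range, of "\<lambda>u. ell2_apply (u (ket i)) x"] that by (simp add: restr_op_apply)
  have "(\<Sum>x\<in>F. (cmod (ell2_apply (u (ket i)) x))\<^sup>2) = (\<Sum>x\<in>(\<lambda>h. h c) ` H. (cmod (ell2_apply (u (ket i)) x))\<^sup>2)"
  proof (rule sum.mono_neutral_right [OF F])
    show "\<forall>x\<in>F - (\<lambda>h. h c) ` H. (cmod (ell2_apply (u (ket i)) x))\<^sup>2 = 0"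
    proof
      fix x
      assume "x \<in> F - (\<lambda>h. h c) ` H"
      then have "x \<notin> base_orbit"
        by (auto simp: H_def)
      then show "(cmod (ell2_apply (u (ket i)) x))\<^sup>2 = 0"
        by (simp add: z)
    qed
  qed (auto simp: H_def)
  also have "\<dots> = (\<Sum>h\<in>H. (cmod (ell2_apply (u (ket i)) (h c)))\<^sup>2)"
    by (simp add: sum.reindex [OF inj])
  also have "\<dots> = (\<Sum>h\<in>H. (cmod (ell2_apply (cadjoint u (ket c)) (inv h i)))\<^sup>2)"
  proof (rule sum.cong [OF refl])
    fix h
    assume "h \<in> H"
    then have h: "h \<in> B"
      by (simp add: H_def)
    have "ell2_apply (u (ket i)) (h c) = ell2_apply (u (ket (inv h i))) c"
      using vna_entry [OF u h, of "inv h i" c] B_bij [OF h] by (simp add: bij_is_surj surj_f_inv_f)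
    also have "\<dots> = cinner (ket (inv h i)) (cadjoint u (ket c))"
      using u by (simp add: cinner_cadjoint vna_ops flip: cinner_ket)
    finally show "(cmod (ell2_apply (u (ket i)) (h c)))\<^sup>2 = (cmod (ell2_apply (cadjoint u (ket c)) (inv h i)))\<^sup>2"
      by (simp add: cinner_ket_left)
  qed
  also have "\<dots> = (\<Sum>x\<in>(\<lambda>h. inv h i) ` H. (cmod (ell2_apply (cadjoint u (ket c)) x))\<^sup>2)"
    by (simp add: sum.reindex [OF inj'])
  also have "\<dots> \<le> (norm (cadjoint u (ket c)))\<^sup>2"
    using \<open>finite H\<close> by (intro ell2_finite_sum_le) auto
  finally show "(\<Sum>x\<in>F. (cmod (ell2_apply (u (ket i)) x))\<^sup>2) \<le> (norm (cadjoint u (ket c)))\<^sup>2" .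
qed simp

end

section \<open>Polar decomposition by Newton--Schulz iteration\<close>

text \<open>This is \<open>T^2 <= T\<close> for \<open>0 <= T <= 1\<close>. Testing positivity at
  \<open>x - T x\<close> avoids a square root of \<open>T\<close>.\<close>

lemma norm_sq_le_inner_positive_contraction:
  fixes T :: "'h::real_inner \<Rightarrow>\<^sub>L 'h"
  assumes sym: "\<And>x y. inner (T x) y = inner x (T y)"
    and le: "\<And>x. inner (T x) x \<le> (norm x)\<^sup>2" and nonneg: "\<And>x. 0 \<le> inner (T x) x"
  shows "(norm (T x))\<^sup>2 \<le> inner (T x) x"
proof -
  have "0 \<le> inner (T (x - T x)) (x - T x)"
    by (rule nonneg)
  also have "\<dots> = inner (T x) x - 2 * (norm (T x))\<^sup>2 + inner (T (T x)) (T x)"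
    using sym [of "T x" x] by (simp add: blinfun.diff_right inner_diff power2_norm_eq_inner)
  finally show ?thesis
    using le [of "T x"] by simp
qed

lemma
  fixes p :: "'i ell2 \<Rightarrow>\<^sub>L 'i ell2"
  assumes p: "p \<in> ops" "p o\<^sub>L p = p" "cadjoint p = p"
  shows projection_idem: "p (p x) = p x"
    and projection_sym: "inner (p x) y = inner x (p y)"
    and norm_projection_sq: "(norm (p x))\<^sup>2 = inner (p x) x"
    and norm_projection_le: "norm (p x) \<le> norm x"
proof -
  show idem: "p (p x) = p x" for x
    by (metis blinfun_apply_blinfun_compose p(2))
  show sym: "inner (p x) y = inner x (p y)" for x y
    using inner_cadjoint [OF p(1)] p(3) by simp
  show *: "(norm (p x))\<^sup>2 = inner (p x) x"
    using sym [of "p x" x] by (simp add: power2_norm_eq_inner idem)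
  have "norm (p x) * norm (p x) \<le> norm (p x) * norm x"
    using norm_cauchy_schwarz [of "p x" x] by (simp flip: * add: power2_eq_square)
  then show "norm (p x) \<le> norm x"
    by (cases "norm (p x) = 0") auto
qed

text \<open>One step of the Newton--Schulz iteration for the partial isometry in the polar decomposition
  of \<open>v\<close>: the defect \<open>E = p - v\<^sup>* v\<close> becomes \<open>(3 E\<^sup>2 + E\<^sup>3) / 4\<close>.\<close>

definition newton_schulz :: "('i ell2 \<Rightarrow>\<^sub>L 'i ell2) \<Rightarrow> ('i ell2 \<Rightarrow>\<^sub>L 'i ell2) \<Rightarrow> 'i ell2 \<Rightarrow>\<^sub>L 'i ell2" where
  "newton_schulz p v = v o\<^sub>L (p + (1 / 2) *\<^sub>R (p - (cadjoint v o\<^sub>L v)))"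

text \<open>The defect formula is needed only as a quadratic form, so it is read off from the norm
  of the new iterate on a vector, without computing the adjoint of that iterate. What makes this
  possible is that \<open>E\<close> and \<open>p\<close> act on vectors with
  \<open>E p = p E = E\<close>.\<close>

lemma
  fixes p v :: "'i ell2 \<Rightarrow>\<^sub>L 'i ell2"
  defines "E \<equiv> p - (cadjoint v o\<^sub>L v)"
  assumes p: "p \<in> ops" "p o\<^sub>L p = p" "cadjoint p = p"
    and v: "v \<in> ops" "v o\<^sub>L p = v" "\<And>x. norm (v x) \<le> norm x"
  shows defect_sym: "inner (E x) y = inner x (E y)"
    and inner_defect: "inner (E x) x = (norm (p x))\<^sup>2 - (norm (v x))\<^sup>2"
    and inner_defect_nonneg: "0 \<le> inner (E x) x"
    and inner_defect_le: "inner (E x) x \<le> (norm x)\<^sup>2"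
    and projection_defect: "p (E x) = E x"
    and norm_newton_schulz:
      "(norm (newton_schulz p v x))\<^sup>2 = (norm (p x))\<^sup>2 - 3 / 4 * (norm (E x))\<^sup>2 - inner (E (E x)) (E x) / 4"
proof -
  note proj = projection_idem [OF p] projection_sym [OF p] norm_projection_sq [OF p]
  have E: "E x = p x - cadjoint v (v x)" for x
    by (simp add: E_def blinfun.diff_left)
  have vv: "inner (cadjoint v (v x)) y = inner (v x) (v y)" for x y
    using v(1) by (metis inner_cadjoint inner_commute)
  have vp: "v (p x) = v x" for x
    by (metis blinfun_apply_blinfun_compose v(2))
  show sym: "inner (E x) y = inner x (E y)" for x y
    by (simp add: E inner_diff proj(2) vv) (metis inner_commute vv)
  show q: "inner (E x) x = (norm (p x))\<^sup>2 - (norm (v x))\<^sup>2" for x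
    by (simp add: E inner_diff_left vv flip: proj(3)) (simp add: power2_norm_eq_inner)
  have "norm (v x) \<le> norm (p x)" for x
    using v(3) [of "p x"] by (simp add: vp)
  then have "(norm (v x))\<^sup>2 \<le> (norm (p x))\<^sup>2" for x
    by (intro power_mono) auto
  then show "0 \<le> inner (E x) x"
    by (simp add: q)
  have "(norm (p x))\<^sup>2 \<le> (norm x)\<^sup>2"
    using norm_projection_le [OF p] by (intro power_mono) auto
  then show "inner (E x) x \<le> (norm x)\<^sup>2"
    using zero_le_power2 [of "norm (v x)"] unfolding q by linarith
  have Ep: "E (p x) = E x" for x
    by (simp add: E vp proj(1))
  show pE: "p (E x) = E x" for x
  proof (rule vector_eq_rdot [THEN iffD1, rule_format])
    fix y
    show "inner (p (E x)) y = inner (E x) y"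
      using proj(2) sym Ep by metis
  qed
  \<comment> \<open>Twice the vector to which \<open>v\<close> is applied in
    \<open>newton_schulz p v x\<close>; it lies in the range of \<open>p\<close>, so
    \<open>inner_defect\<close> at \<open>w\<close> gives the norm of \<open>v w\<close>.\<close>
  define w where "w = 2 *\<^sub>R p x + E x"
  have "newton_schulz p v x = (1 / 2) *\<^sub>R v w"
    by (simp add: newton_schulz_def w_def blinfun.add_left blinfun.scaleR_left blinfun.add_right
        blinfun.scaleR_right scaleR_add_right flip: E_def)
  then have "(norm (newton_schulz p v x))\<^sup>2 = (norm (v w))\<^sup>2 / 4"
    by (simp add: power_mult_distrib power2_eq_square)
  moreover have "(norm (v w))\<^sup>2 = (norm w)\<^sup>2 - inner (E w) w"
    using q [of w] by (simp add: w_def blinfun.add_right blinfun.scaleR_right proj(1) pE)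
  moreover have Epx: "inner (E y) (p x) = inner (E y) x" for y
    using proj(2) [of "E y" x] by (simp add: pE)
  have "(norm w)\<^sup>2 = 4 * (norm (p x))\<^sup>2 + 4 * inner (E x) x + (norm (E x))\<^sup>2"
    using Epx [of x] by (simp add: w_def power2_norm_eq_inner inner_add inner_commute)
  moreover have "inner (E w) w = 4 * inner (E x) x + 4 * (norm (E x))\<^sup>2 + inner (E (E x)) (E x)"
    using Epx [of x] Epx [of "E x"] sym [of "E x" x]
    by (simp add: w_def Ep blinfun.add_right blinfun.scaleR_right inner_add power2_norm_eq_inner inner_commute)
  ultimately show "(norm (newton_schulz p v x))\<^sup>2
      = (norm (p x))\<^sup>2 - 3 / 4 * (norm (E x))\<^sup>2 - inner (E (E x)) (E x) / 4"
    by (simp add: field_simps)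
qed

text \<open>The defects \<open>E n\<close> are positive contractions with
  \<open>E (n + 1) <= (E n)^2 <= E n\<close>, so they decrease strongly to some \<open>F\<close>,
  which turns out to be a projection below \<open>p\<close>. Minimality leaves \<open>F = 0\<close>
  or \<open>F = p\<close>, and \<open>F = p\<close> would force the starting operator to vanish.
  Hence \<open>F = 0\<close>, which says that the iterates become isometric on the range of
  \<open>p\<close>.\<close>

lemma minimal_projection_polar:
  fixes S :: "('i ell2 \<Rightarrow>\<^sub>L 'i ell2) set" and p e u\<^sub>0 :: "'i ell2 \<Rightarrow>\<^sub>L 'i ell2"
  assumes S: "S \<subseteq> ops" "\<And>A. A \<in> S \<Longrightarrow> cadjoint A \<in> S"
    and min: "minimal_projection (commutant S) p"
    and u\<^sub>0: "u\<^sub>0 \<in> commutant S" "u\<^sub>0 o\<^sub>L p = u\<^sub>0" "u\<^sub>0 \<noteq> 0" "\<And>x. norm (u\<^sub>0 x) \<le> norm x" "e o\<^sub>L u\<^sub>0 = u\<^sub>0"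
  obtains u where "\<And>n. u n \<in> commutant S" "\<And>n x. norm (blinfun_apply (u n) x) \<le> norm x"
    "\<And>n. e o\<^sub>L u n = u n" "\<And>x. (\<lambda>n. norm (u n x)) \<longlonglongrightarrow> norm (p x)"
proof -
  let ?M = "commutant S"
  have pM: "p \<in> ?M" and p: "p \<in> ops" "p o\<^sub>L p = p" "cadjoint p = p"
    using min commutant_ops by (auto simp: minimal_projection_def projections_def)
  define u where "u n = (newton_schulz p ^^ n) u\<^sub>0" for n
  have u_Suc: "u (Suc n) = newton_schulz p (u n)" for n
    by (simp add: u_def)
  have step: "newton_schulz p v \<in> ?M \<and> newton_schulz p v o\<^sub>L p = newton_schulz p v
      \<and> (\<forall>x. norm (newton_schulz p v x) \<le> norm x) \<and> e o\<^sub>L newton_schulz p v = newton_schulz p v"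
    if v: "v \<in> ?M" "v o\<^sub>L p = v" "\<And>x. norm (v x) \<le> norm x" "e o\<^sub>L v = v" for v
  proof (intro conjI allI)
    let ?E = "p - (cadjoint v o\<^sub>L v)"
    show "newton_schulz p v \<in> ?M"
      unfolding newton_schulz_def
      by (intro commutant_compose commutant_add commutant_scaleR commutant_diff pM v commutant_cadjoint S) auto
    have "v (p x) = v x" for x
      by (metis blinfun_apply_blinfun_compose v(2))
    then show "newton_schulz p v o\<^sub>L p = newton_schulz p v"
      using projection_idem [OF p]
      by (intro blinfun_eqI) (simp add: newton_schulz_def blinfun.add_left blinfun.diff_left blinfun.scaleR_left)
    fix x
    have "(norm (newton_schulz p v x))\<^sup>2 \<le> (norm (p x))\<^sup>2"
      using norm_newton_schulz [OF p commutant_ops v(2) v(3), of S x]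
        inner_defect_nonneg [OF p commutant_ops v(2) v(3), of S "?E x"] v(1)
        zero_le_power2 [of "norm (?E x)"] by linarith
    then show "norm (newton_schulz p v x) \<le> norm x"
      using norm_projection_le [OF p, of x] power2_le_imp_le order_trans norm_ge_zero by metis
    show "e o\<^sub>L newton_schulz p v = newton_schulz p v"
    proof (rule blinfun_eqI)
      have "e (v y) = v y" for y
        by (metis blinfun_apply_blinfun_compose v(4))
      then show "(e o\<^sub>L newton_schulz p v) x = newton_schulz p v x" for x
        by (simp add: newton_schulz_def)
    qed
  qed
  have inv: "u n \<in> ?M \<and> u n o\<^sub>L p = u n \<and> (\<forall>x. norm (u n x) \<le> norm x) \<and> e o\<^sub>L u n = u n" for n
  proof (induction n)
    case 0
    then show ?case
      using u\<^sub>0 by (simp add: u_def)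
  next
    case (Suc n)
    then show ?case
      unfolding u_Suc by (intro step) auto
  qed
  define E where "E n = p - (cadjoint (u n) o\<^sub>L u n)" for n
  have u_ops: "u n \<in> ops" "u n o\<^sub>L p = u n" "\<And>x. norm (u n x) \<le> norm x" for n
    using inv commutant_ops by blast+
  note E_sym = defect_sym [OF p u_ops, folded E_def]
    and E_inner = inner_defect [OF p u_ops, folded E_def]
    and E_nonneg = inner_defect_nonneg [OF p u_ops, folded E_def]
    and E_le = inner_defect_le [OF p u_ops, folded E_def]
    and E_proj = projection_defect [OF p u_ops, folded E_def]
  define q where "q n x = inner (E n x) x" for n x
  have q_Suc: "q (Suc n) x = 3 / 4 * (norm (E n x))\<^sup>2 + inner (E n (E n x)) (E n x) / 4" for n x
    using norm_newton_schulz [OF p u_ops, of n x, folded E_def] E_inner [of "Suc n" x] by (simp add: q_def u_Suc)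
  have E_q: "(norm (E n x))\<^sup>2 \<le> q n x" for n x
    unfolding q_def by (rule norm_sq_le_inner_positive_contraction) (use E_sym E_le E_nonneg in auto)
  have q_E: "q (Suc n) x \<le> (norm (E n x))\<^sup>2" for n x
    using E_le [of n "E n x"] by (simp add: q_Suc)
  have q_antimono: "q m x \<le> q n x" if "n \<le> m" for m n x
    using that by (induction rule: dec_induct) (simp, meson q_E E_q order_trans)
  have "\<exists>l. (\<lambda>n. q n x) \<longlonglongrightarrow> l" for x
  proof -
    have "decseq (\<lambda>n. q n x)" "\<And>n. 0 \<le> q n x"
      using q_antimono E_nonneg by (auto simp: decseq_def q_def)
    then show ?thesis
      using decseq_convergent by blast
  qed
  then obtain L where L: "\<And>x. (\<lambda>n. q n x) \<longlonglongrightarrow> L x"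
    by metis
  \<comment> \<open>The difference of two defects is again a positive contraction, so convergence of
    the forms \<open>q n x\<close> controls the vectors \<open>E n x\<close>.\<close>
  have diff: "(norm (E n x - E m x))\<^sup>2 \<le> q n x - q m x" if "n \<le> m" for n m x
  proof -
    have "(norm ((E n - E m) x))\<^sup>2 \<le> inner ((E n - E m) x) x"
    proof (rule norm_sq_le_inner_positive_contraction)
      show "inner ((E n - E m) x) y = inner x ((E n - E m) y)" for x y
        by (simp add: blinfun.diff_left inner_diff E_sym)
      show "0 \<le> inner ((E n - E m) x) x" for x
        using q_antimono [OF that, of x] by (simp add: blinfun.diff_left inner_diff q_def)
      show "inner ((E n - E m) x) x \<le> (norm x)\<^sup>2" for x
        using E_le [of n x] E_nonneg [of m x] by (simp add: blinfun.diff_left inner_diff)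
    qed
    then show ?thesis
      by (simp add: blinfun.diff_left inner_diff q_def)
  qed
  have "\<exists>l. (\<lambda>n. E n x) \<longlonglongrightarrow> l" for x
  proof -
    have "Cauchy (\<lambda>n. E n x)"
    proof (rule metric_CauchyI)
      fix \<epsilon> :: real
      assume \<epsilon>: "0 < \<epsilon>"
      have "Cauchy (\<lambda>n. q n x)"
        using L LIMSEQ_imp_Cauchy by blast
      then obtain N where N: "\<And>m n. m \<ge> N \<Longrightarrow> n \<ge> N \<Longrightarrow> dist (q m x) (q n x) < \<epsilon>\<^sup>2"
        unfolding Cauchy_def using \<epsilon> by (metis zero_less_power)
      have *: "dist (E n x) (E m x) < \<epsilon>" if "N \<le> n" "n \<le> m" for m n
      proof -
        have "(norm (E n x - E m x))\<^sup>2 < \<epsilon>\<^sup>2"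
          using diff [OF that(2), of x] N [of n m] that by (simp add: dist_real_def)
        then show ?thesis
          using \<epsilon> by (simp add: dist_norm power2_less_imp_less)
      qed
      have "dist (E m x) (E n x) < \<epsilon>" if "N \<le> n" "N \<le> m" for m n
        using that * [of n m] * [of m n] by (cases "n \<le> m") (auto simp: dist_commute)
      then show "\<exists>M. \<forall>m\<ge>M. \<forall>n\<ge>M. dist (E m x) (E n x) < \<epsilon>"
        by blast
    qed
    then show ?thesis
      by (simp add: Cauchy_convergent_iff convergent_def)
  qed
  then obtain G where G: "\<And>x. (\<lambda>n. E n x) \<longlonglongrightarrow> G x"
    by metis
  have E_norm: "norm (E n x) \<le> norm x" for n x
    using E_q [of n x] E_le [of n x] by (simp add: q_def power2_le_imp_le)
  have "bounded_linear G"
  proof (rule bounded_linear_intro [where K = 1])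
    show "G (x + y) = G x + G y" for x y
      by (rule LIMSEQ_unique [OF G]) (simp add: blinfun.add_right tendsto_add G)
    show "G (r *\<^sub>R x) = r *\<^sub>R G x" for r x
      by (rule LIMSEQ_unique [OF G]) (simp add: blinfun.scaleR_right tendsto_scaleR G)
    show "norm (G x) \<le> norm x * 1" for x
      using LIMSEQ_le_const2 [OF tendsto_norm [OF G [of x]]] E_norm by auto
  qed
  then obtain F where F: "\<And>x. blinfun_apply F x = G x"
    by (metis bounded_linear_Blinfun_apply)
  note limF = G [folded F]
  have F_sym: "inner (F x) y = inner x (F y)" for x y
    using LIMSEQ_unique [OF tendsto_inner [OF limF tendsto_const]]
      tendsto_inner [OF tendsto_const limF, of x y] by (simp add: E_sym)
  have qF: "(\<lambda>n. q n x) \<longlonglongrightarrow> inner (F x) x" for x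
    unfolding q_def by (intro tendsto_inner limF tendsto_const)
  \<comment> \<open>The squared norm of \<open>E n x\<close> is squeezed between
    \<open>q (Suc n) x\<close> and \<open>q n x\<close>, which have the same limit.\<close>
  have F_norm: "(norm (F x))\<^sup>2 = inner (F x) x" for x
  proof (rule LIMSEQ_unique)
    show "(\<lambda>n. (norm (E n x))\<^sup>2) \<longlonglongrightarrow> (norm (F x))\<^sup>2"
      by (intro tendsto_intros limF)
    show "(\<lambda>n. (norm (E n x))\<^sup>2) \<longlonglongrightarrow> inner (F x) x"
      by (rule tendsto_sandwich [OF _ _ LIMSEQ_Suc [OF qF] qF]) (use q_E E_q in auto)
  qed
  \<comment> \<open>\<open>F_norm\<close> at \<open>x - F x\<close> gives a second expression for
    the same squared norm, equal to the negative of the first.\<close>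
  have FF: "F (F x) = F x" for x
  proof -
    have "norm (F x - F (F x)) ^ 2 = (norm (F x))\<^sup>2 - 2 * inner (F (F x)) (F x) + (norm (F (F x)))\<^sup>2"
      by (simp add: power2_norm_eq_inner inner_diff inner_commute)
    also have "\<dots> = (norm (F x))\<^sup>2 - inner (F (F x)) (F x)"
      by (simp add: F_norm [of "F x"])
    finally have *: "norm (F x - F (F x)) ^ 2 = (norm (F x))\<^sup>2 - inner (F (F x)) (F x)" .
    have "inner (F (x - F x)) (x - F x) = inner (F x) x - 2 * (norm (F x))\<^sup>2 + inner (F (F x)) (F x)"
      using F_sym [of "F x" x] by (simp add: blinfun.diff_right inner_diff power2_norm_eq_inner)
    also have "\<dots> = inner (F (F x)) (F x) - (norm (F x))\<^sup>2"
      by (simp add: F_norm [symmetric])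
    also have "inner (F (x - F x)) (x - F x) = norm (F x - F (F x)) ^ 2"
      using F_norm [of "x - F x"] by (simp add: blinfun.diff_right)
    finally have "norm (F x - F (F x)) ^ 2 = 0"
      using * by simp
    then show ?thesis
      by simp
  qed
  have EM: "E n \<in> ?M" for n
    unfolding E_def using inv pM
    by (intro commutant_diff commutant_compose commutant_cadjoint S) auto
  have FM: "F \<in> ?M"
    by (rule commutant_limit [OF EM limF])
  have "cadjoint F = F"
    using commutant_ops [OF FM] F_sym by (rule cadjoint_eqI_inner)
  moreover have "F o\<^sub>L F = F"
    by (rule blinfun_eqI) (simp add: FF)
  ultimately have "F \<in> projections ?M"
    using FM by (simp add: projections_def)
  moreover have "subprojection F p"
    unfolding subprojection_def
  proof (rule blinfun_eqI)
    fix x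
    have "(\<lambda>n. p (E n x)) \<longlonglongrightarrow> p (F x)"
      by (intro blinfun.tendsto tendsto_const limF)
    then show "(p o\<^sub>L F) x = F x"
      using LIMSEQ_unique limF by (simp add: E_proj) blast
  qed
  ultimately have "F = 0 \<or> F = p"
    using min by (simp add: minimal_projection_def)
  moreover have "F \<noteq> p"
  proof
    assume "F = p"
    have "u\<^sub>0 x = 0" for x
    proof -
      have "inner (F x) x \<le> q 0 x"
        by (rule LIMSEQ_le_const2 [OF qF]) (use q_antimono in auto)
      then have "(norm (p x))\<^sup>2 \<le> (norm (p x))\<^sup>2 - (norm (u\<^sub>0 x))\<^sup>2"
        using E_inner [of 0 x] by (simp add: q_def \<open>F = p\<close> norm_projection_sq [OF p] u_def)
      then show ?thesis
        by simp
    qed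
    then show False
      using u\<^sub>0(3) by (metis blinfun_eqI zero_blinfun.rep_eq)
  qed
  ultimately have "F = 0"
    by blast
  have "(\<lambda>n. norm (u n x)) \<longlonglongrightarrow> norm (p x)" for x
  proof -
    have "(\<lambda>n. (norm (p x))\<^sup>2 - q n x) \<longlonglongrightarrow> (norm (p x))\<^sup>2 - inner (F x) x"
      by (intro tendsto_intros qF)
    then have "(\<lambda>n. sqrt ((norm (u n x))\<^sup>2)) \<longlonglongrightarrow> sqrt ((norm (p x))\<^sup>2)"
      by (intro tendsto_real_sqrt) (simp add: q_def E_inner \<open>F = 0\<close>)
    then show ?thesis
      by simp
  qed
  then show thesis
    using that [of u] inv by blast
qed

section \<open>Finite and infinite projections\<close>

context commuting_actions
begin

lemma vna_perm_op_commute: "T \<in> vna \<Longrightarrow> h \<in> B \<Longrightarrow> T (perm_op h v) = perm_op h (T v)"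
  unfolding vna_def by (rule commutantD_apply [OF _ perm_op_B_commutant])

lemma base_mem_orbit: "c \<in> base_orbit"
  by (rule image_eqI [OF _ B_id]) simp

text \<open>If \<open>v\<close> implements the equivalence of the base projection with
  \<open>q\<close> below it, the column-row inequality at \<open>c\<close> reads
  \<open>1 <= norm (q (ket c))\<close>. So \<open>q\<close> fixes \<open>ket c\<close>, and by
  invariance under \<open>B\<close> it fixes the basis vectors of the whole base orbit.\<close>

lemma finite_projection_restr_op: "finite_projection vna (restr_op base_orbit)"
  unfolding finite_projection_def
proof (intro conjI ballI impI restr_op_projection)
  let ?D = "restr_op base_orbit"
  fix q
  assume q: "q \<in> projections vna" and "subprojection q ?D \<and> murray_von_neumann_equiv vna ?D q"
  then obtain v where Dq: "?D o\<^sub>L q = q" and v: "v \<in> vna" "cadjoint v o\<^sub>L v = ?D" "v o\<^sub>L cadjoint v = q"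
    by (auto simp: subprojection_def murray_von_neumann_equiv_def)
  have qp: "q \<in> ops" "q o\<^sub>L q = q" "cadjoint q = q" and qv: "q \<in> vna"
    using q vna_ops by (auto simp: projections_def)
  have v_ops: "v \<in> ops" "cadjoint v \<in> ops"
    using v(1) vna_ops cadjoint_ops by auto
  have nv: "(norm (v x))\<^sup>2 = inner (?D x) x" for x
    using inner_cadjoint [OF v_ops(1), of x "v x"] v(2)
    by (metis blinfun_apply_blinfun_compose inner_commute power2_norm_eq_inner)
  have vD: "v (?D x) = v x" for x
  proof -
    have "(norm (v (x - ?D x)))\<^sup>2 = 0"
    proof -
      have "?D (?D x) = ?D x"
        by (rule ell2_eqI) (simp add: restr_op_apply)
      then show ?thesis
        unfolding nv by (simp add: blinfun.diff_right)
    qed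
    then show ?thesis
      by (simp add: blinfun.diff_right)
  qed
  have "?D o\<^sub>L v = v"
  proof (rule blinfun_eqI)
    fix x
    \<comment> \<open>A partial isometry satisfies \<open>v = v v^* v\<close>, here with
      \<open>v v^* = q\<close>; thus the range of \<open>v\<close> lies below \<open>q\<close>,
      hence in the base orbit, as the inequality requires.\<close>
    have "v x = q (v x)"
      by (metis blinfun_apply_blinfun_compose v(2) v(3) vD)
    then show "(?D o\<^sub>L v) x = v x"
      by (metis Dq blinfun_apply_blinfun_compose)
  qed
  then have "norm (v (ket c)) \<le> norm (cadjoint v (ket c))"
    by (rule norm_column_le_row [OF v(1)])
  moreover note c = base_mem_orbit
  moreover have "(norm (v (ket c)))\<^sup>2 = 1"
    using c by (simp add: nv restr_op_ket) (simp add: norm_eq_1 [symmetric])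
  then have "norm (v (ket c)) = 1"
    by (simp add: power2_eq_1_iff) (use norm_ge_zero [of "v (ket c)"] in linarith)
  moreover have "(norm (cadjoint v (ket c)))\<^sup>2 = (norm (q (ket c)))\<^sup>2"
    unfolding norm_projection_sq [OF qp] using v(3) inner_cadjoint [OF v_ops(1), of "cadjoint v (ket c)" "ket c"]
    by (metis blinfun_apply_blinfun_compose power2_norm_eq_inner)
  ultimately have "1 \<le> norm (q (ket c))"
    by simp
  moreover have "(norm (ket c - q (ket c)))\<^sup>2 = 1 - (norm (q (ket c)))\<^sup>2"
    using norm_projection_sq [OF qp, of "ket c"]
    by (simp add: power2_norm_eq_inner inner_diff inner_commute) (simp add: norm_eq_1 [symmetric])
  ultimately have "(norm (ket c - q (ket c)))\<^sup>2 \<le> 0"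
    by simp
  then have qc: "q (ket c) = ket c"
    by simp
  have "q (ket x) = ket x" if "x \<in> base_orbit" for x
  proof -
    obtain h where h: "h \<in> B" "x = h c"
      using \<open>x \<in> base_orbit\<close> by blast
    then show ?thesis
      using vna_perm_op_commute [OF qv h(1), of "ket c"] qc B_bij by (simp add: perm_op_ket)
  qed
  then have "q o\<^sub>L ?D = ?D"
    by (intro ops_eq_on_ket) (simp_all add: ops_compose restr_op_ops qp restr_op_ket)
  moreover have "q o\<^sub>L ?D = q"
    using arg_cong [OF Dq, of cadjoint] qp by (simp add: cadjoint_compose restr_op_ops cadjoint_restr_op)
  ultimately show "q = ?D"
    by simp
qed

text \<open>Equivariance puts the isometry of the injection into the algebra. Its range projection
  is equivalent to the identity but kills the basis vector of any point that is not hit.\<close>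

lemma not_finite_projection_id:
  assumes inj: "inj \<sigma>" and "\<not> surj \<sigma>" and comm: "\<And>h x. h \<in> B \<Longrightarrow> \<sigma> (h x) = h (\<sigma> x)"
  shows "\<not> finite_projection vna id_blinfun"
proof
  assume fin: "finite_projection vna id_blinfun"
  define V where "V = perm_op \<sigma>"
  have V_ops: "V \<in> ops"
    using inj by (simp add: V_def pinj_op_ops)
  have V: "V \<in> vna"
  proof (rule vnaI [OF V_ops])
    fix h x y
    assume "h \<in> B"
    then have "h (\<sigma> x) = h y \<longleftrightarrow> \<sigma> x = y"
      using B_bij by (simp add: bij_is_inj inj_eq)
    then show "ell2_apply (V (ket (h x))) (h y) = ell2_apply (V (ket x)) y"
      using inj \<open>h \<in> B\<close> by (simp add: V_def pinj_op_ket comm ket_apply)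
  qed
  have V_ket: "V (ket x) = ket (\<sigma> x)" for x
    using inj by (simp add: V_def pinj_op_ket)
  have V'_ket: "cadjoint V (ket x) = (if x \<in> range \<sigma> then ket (inv \<sigma> x) else 0)" for x
    using inj by (simp add: V_def cadjoint_pinj_op pinj_op_ket inj_on_inv_into)
  have VV: "cadjoint V o\<^sub>L V = id_blinfun"
    using inj by (intro ops_eq_on_ket) (simp_all add: V_ops cadjoint_ops ops_compose ops_id V_ket V'_ket)
  define q where "q = V o\<^sub>L cadjoint V"
  have "q \<in> vna"
    unfolding q_def vna_def
    by (rule commutant_compose) (use V vna_cadjoint in \<open>auto simp: vna_def\<close>)
  moreover have "q o\<^sub>L q = q"
  proof (rule blinfun_eqI)
    have "cadjoint V (V y) = y" for y
      by (metis VV blinfun_apply_blinfun_compose blinfun_apply_id_blinfun id_apply)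
    then show "(q o\<^sub>L q) x = q x" for x
      by (simp add: q_def)
  qed
  moreover have "cadjoint q = q"
    by (simp add: q_def cadjoint_compose V_ops cadjoint_ops cadjoint_cadjoint)
  ultimately have "q \<in> projections vna"
    by (simp add: projections_def)
  moreover have "subprojection q id_blinfun"
    unfolding subprojection_def by (rule blinfun_eqI) simp
  moreover have "murray_von_neumann_equiv vna id_blinfun q"
    unfolding murray_von_neumann_equiv_def using V VV q_def by blast
  ultimately have "q = id_blinfun"
    using fin by (simp add: finite_projection_def)
  moreover obtain x where "x \<notin> range \<sigma>"
    using assms(2) by blast
  then have "q (ket x) = 0"
    by (simp add: q_def V'_ket)
  ultimately show False
    using ket_nonzero [of x] by simp
qed

end

text \<open>The \<open>f n\<close> are commuting involutions, and the partial products of the projections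
  \<open>(1 \<plusminus> f n) / 2\<close> on the base orbit have trace \<open>2\<^sup>-\<^sup>n\<close>. The sets \<open>N n\<close> contain the orbit of
  the base point under the first \<open>n\<close> involutions.\<close>

locale diffuse_commuting_actions = commuting_actions A B c for A B :: "('i \<Rightarrow> 'i) set" and c +
  fixes f :: "nat \<Rightarrow> 'i \<Rightarrow> 'i" and N :: "nat \<Rightarrow> 'i set"
  assumes f_A: "f n \<in> A" and f_invol: "f n (f n x) = x" and f_comm: "f m (f n x) = f n (f m x)"
    and f_base: "f n c \<in> base_orbit"
    and N_0: "c \<in> N 0" and N_Suc: "x \<in> N n \<Longrightarrow> x \<in> N (Suc n)" "x \<in> N n \<Longrightarrow> f n x \<in> N (Suc n)"
    and f_N: "f n c \<notin> N n"
begin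

text \<open>At each step \<open>e\<close> splits into two halves by the eigenvalues of the next
  involution. The halves add up to \<open>e\<close>, so one of them does not kill
  \<open>\<zeta>\<close>, and that one is kept. The support condition on \<open>e (ket c)\<close> is
  carried along to make the trace halve exactly.\<close>

lemma small_projection:
  assumes "ell2_apply \<zeta> c \<noteq> 0"
  shows "\<exists>e\<in>projections vna. blinfun_apply e \<zeta> \<noteq> 0 \<and> restr_op base_orbit o\<^sub>L e = e \<and> (norm (e (ket c)))\<^sup>2 \<le> (1 / 2) ^ n
    \<and> (\<forall>m v. e (perm_op (f m) v) = perm_op (f m) (e v)) \<and> (\<forall>x. x \<notin> N n \<longrightarrow> ell2_apply (e (ket c)) x = 0)"
proof (induction n)
  case 0
  let ?D = "restr_op base_orbit"
  note c = base_mem_orbit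
  have "f m x \<in> base_orbit \<longleftrightarrow> x \<in> base_orbit" for m x
  proof -
    have "f m x \<in> base_orbit" if "x \<in> base_orbit" for x
      using that comm [OF f_A] f_base base_orbit_B by auto
    then show ?thesis
      using f_invol by metis
  qed
  then have "?D (perm_op (f m) v) = perm_op (f m) (?D v)" for m v
    using A_bij [OF f_A, of m]
    by (intro commute_perm_opI restr_op_ops)
      (auto simp: restr_op_ket ket_apply zero_ell2.rep_eq bij_is_inj inj_eq)
  moreover have "ell2_apply (?D \<zeta>) c \<noteq> 0"
    using c assms by (simp add: restr_op_apply)
  then have "?D \<zeta> \<noteq> 0"
    by (auto simp: zero_ell2.rep_eq)
  moreover have "?D o\<^sub>L ?D = ?D"
    using restr_op_projection by (simp add: projections_def)
  moreover have "?D (ket c) = ket c"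
    using c by (simp add: restr_op_ket)
  moreover have "ell2_apply (ket c) x = 0" if "x \<notin> N 0" for x
    using N_0 that by (auto simp: ket_apply)
  ultimately show ?case
    using restr_op_projection by (intro bexI [of _ ?D] conjI) (assumption | simp)+
next
  case (Suc n)
  then obtain e where e: "e \<in> projections vna" "blinfun_apply e \<zeta> \<noteq> 0" "restr_op base_orbit o\<^sub>L e = e"
      "(norm (e (ket c)))\<^sup>2 \<le> (1 / 2) ^ n" "\<And>m v. e (perm_op (f m) v) = perm_op (f m) (e v)"
      "\<And>x. x \<notin> N n \<Longrightarrow> ell2_apply (e (ket c)) x = 0"
    by blast
  have ev: "e \<in> vna" and ep: "e \<in> ops" "e o\<^sub>L e = e" "cadjoint e = e"
    using e(1) vna_ops by (auto simp: projections_def)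
  define F where "F = perm_op (f n)"
  have fb: "bij (f m)" for m
    using A_bij f_A by blast
  have finv: "inv (f m) = f m" for m
    using fb f_invol by (metis bij_inv_eq_iff ext)
  have F: "F \<in> vna" "F \<in> ops" "cadjoint F = F"
    using perm_op_A_vna [OF f_A] fb by (simp_all add: F_def perm_op_ops cadjoint_perm_op finv)
  have FF: "F (F x) = x" for x
    using fb f_invol by (simp add: F_def perm_op_perm_op comp_def flip: perm_op_id id_def) (simp add: id_def perm_op_id flip: id_def)
  have eF: "e (F x) = F (e x)" for x
    by (simp add: F_def e(5))
  have Ff: "F (perm_op (f m) v) = perm_op (f m) (F v)" for m v
  proof -
    have "f n \<circ> f m = f m \<circ> f n"
      using f_comm by (simp add: fun_eq_iff)
    then show ?thesis
      using fb by (simp add: F_def perm_op_perm_op)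
  qed
  define P where "P s = (1 / 2) *\<^sub>R (e + s *\<^sub>R (e o\<^sub>L F))" for s
  have Px: "P s x = (1 / 2) *\<^sub>R (e x + s *\<^sub>R e (F x))" for s x
    by (simp add: P_def blinfun.add_left blinfun.scaleR_left)
  have "P 1 \<zeta> + P (- 1) \<zeta> = e \<zeta>"
    by (simp add: Px scaleR_diff_right scaleR_add_right flip: scaleR_add_left)
  then have "P 1 \<zeta> \<noteq> 0 \<or> P (- 1) \<zeta> \<noteq> 0"
    using e(2) by auto
  then obtain s :: real where s: "s = 1 \<or> s = - 1" "P s \<zeta> \<noteq> 0"
    by blast
  then have ss: "s * s = 1"
    by auto
  have Pv: "P s \<in> vna"
    unfolding P_def vna_def using ev F
    by (intro commutant_scaleR commutant_add commutant_compose) (auto simp: vna_def)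
  have ee: "e (e x) = e x" for x
    by (rule projection_idem [OF ep])
  have PP: "P s o\<^sub>L P s = P s"
  proof (rule blinfun_eqI)
    fix x
    show "(P s o\<^sub>L P s) x = P s x"
      using ss by (simp add: Px blinfun.add_right blinfun.scaleR_right eF ee FF scaleR_add_right algebra_simps
          flip: scaleR_add_left)
  qed
  have adj: "cadjoint (P s) = P s"
  proof -
    have "F o\<^sub>L e = e o\<^sub>L F"
      by (rule blinfun_eqI) (simp add: eF)
    then show ?thesis
      using ep F by (simp add: P_def cadjoint_scaleR cadjoint_add ops_add ops_scaleR ops_compose cadjoint_compose)
  qed
  have proj: "P s \<in> projections vna"
    using Pv PP adj by (simp add: projections_def)
  have De: "restr_op base_orbit (e x) = e x" for x
    by (metis blinfun_apply_blinfun_compose e(3))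
  have "restr_op base_orbit o\<^sub>L P s = P s"
    by (rule blinfun_eqI) (simp add: Px blinfun.add_right blinfun.scaleR_right De)
  moreover have "(norm (P s (ket c)))\<^sup>2 \<le> (1 / 2) ^ Suc n"
  proof -
    have "(norm (P s (ket c)))\<^sup>2 = inner (P s (ket c)) (ket c)"
      using proj vna_ops by (intro norm_projection_sq) (auto simp: projections_def)
    also have "\<dots> = (inner (e (ket c)) (ket c) + s * inner (F (e (ket c))) (ket c)) / 2"
      by (simp add: Px inner_add_left eF)
    \<comment> \<open>The cross term is the coefficient of \<open>e (ket c)\<close> at
      \<open>f n c\<close>, which lies outside the support set \<open>N n\<close>.\<close>
    also have "inner (F (e (ket c))) (ket c) = Re (ell2_apply (e (ket c)) (f n c))"
      using inner_cadjoint [OF F(2), of "e (ket c)" "ket c"] F(3) fb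
      by (simp add: F_def perm_op_ket inner_eq_Re_cinner cinner_ket)
    also have "\<dots> = 0"
      using e(6) f_N by simp
    also have "inner (e (ket c)) (ket c) = (norm (e (ket c)))\<^sup>2"
      by (rule norm_projection_sq [OF ep, symmetric])
    finally show ?thesis
      using e(4) by simp
  qed
  moreover have "P s (perm_op (f m) v) = perm_op (f m) (P s v)" for m v
    by (simp add: Px Ff e(5) blinfun.add_right blinfun.scaleR_right)
  moreover have "ell2_apply (P s (ket c)) x = 0" if "x \<notin> N (Suc n)" for x
  proof -
    have "x \<notin> N n" "f n x \<notin> N n"
      using that N_Suc f_invol by metis+
    moreover have "ell2_apply (F (e (ket c))) x = ell2_apply (e (ket c)) (f n x)"
      using perm_op_apply [OF fb, of n "e (ket c)" "f n x"] f_invol by (simp add: F_def)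
    ultimately show ?thesis
      using e(6) by (simp add: Px eF plus_ell2.rep_eq scaleR_ell2_def scaleC_ell2.rep_eq)
  qed
  ultimately show ?case
    using proj s(2) by blast
qed

text \<open>Polar iterates \<open>u\<close> between a minimal \<open>p\<close> and a small
  \<open>e\<close> satisfy \<open>e u = u\<close>, so the row of \<open>u\<close> at
  \<open>c\<close> only sees \<open>e (ket c)\<close>. The column-row inequality then bounds the
  norm of \<open>u (ket i)\<close> by that of \<open>e (ket c)\<close>; in the limit
  \<open>p (ket i)\<close> is arbitrarily small, hence zero.\<close>

lemma no_minimal_projection: "\<not> minimal_projection vna p"
proof
  assume min: "minimal_projection vna p"
  then have pv: "p \<in> vna" and p: "p \<in> ops" "p o\<^sub>L p = p" "cadjoint p = p" "p \<noteq> 0"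
    using vna_ops by (auto simp: minimal_projection_def projections_def)
  have "\<exists>i. p (ket i) \<noteq> 0"
  proof (rule ccontr)
    assume "\<not> ?thesis"
    then have "p = 0"
      by (intro ops_eq_on_ket) (use p in \<open>simp_all add: ops_iff zero_blinfun.rep_eq\<close>)
    with p show False
      by blast
  qed
  then obtain i where i: "p (ket i) \<noteq> 0"
    by blast
  then obtain x where x: "ell2_apply (p (ket i)) x \<noteq> 0"
    by (metis ell2_eqI zero_ell2.rep_eq)
  \<comment> \<open>Transports a nonzero coordinate of \<open>p (ket i)\<close> to the base point,
    the only place where \<open>small_projection\<close> promises not to kill the vector.\<close>
  obtain g where g: "g \<in> A" "g x = c"
    using trans [of x] A_inv A_bij by (metis bij_inv_eq_iff)
  have gv: "perm_op g \<in> vna"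
    by (rule perm_op_A_vna [OF g(1)])
  have \<zeta>: "ell2_apply (perm_op g (p (ket i))) c \<noteq> 0"
    using perm_op_apply [OF A_bij [OF g(1)], of "p (ket i)" x] g x by simp
  have "(norm (p (ket i)))\<^sup>2 \<le> (1 / 2) ^ n" for n
  proof -
    obtain e where e: "e \<in> projections vna" "blinfun_apply e (perm_op g (p (ket i))) \<noteq> 0"
        "restr_op base_orbit o\<^sub>L e = e" "(norm (e (ket c)))\<^sup>2 \<le> (1 / 2) ^ n"
      using small_projection [OF \<zeta>] by metis
    have ev: "e \<in> vna" and ep: "e \<in> ops" "e o\<^sub>L e = e" "cadjoint e = e"
      using e(1) vna_ops by (auto simp: projections_def)
    define a where "a = e o\<^sub>L (perm_op g o\<^sub>L p)"
    have 1: "commutant (perm_op ` A) \<subseteq> ops"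
      "\<And>T. T \<in> commutant (perm_op ` A) \<Longrightarrow> cadjoint T \<in> commutant (perm_op ` A)"
      using commutant_ops commutant_cadjoint [OF perm_op_A_subset perm_op_A_cadjoint] by blast+
    have 2: "a \<in> commutant (commutant (perm_op ` A))"
      unfolding a_def using ev gv pv by (intro commutant_compose) (auto simp: vna_def)
    have 3: "a o\<^sub>L p = a"
      by (rule blinfun_eqI) (simp add: a_def projection_idem [OF p(1-3)])
    have 4: "a \<noteq> 0"
    proof
      assume "a = 0"
      then have "a (ket i) = 0"
        by simp
      then show False
        using e(2) by (simp add: a_def)
    qed
    have 5: "norm (a v) \<le> norm v" for v
      unfolding a_def
      using norm_projection_le [OF ep, of "perm_op g (p v)"] norm_projection_le [OF p(1-3), of v]
        norm_perm_op [OF A_bij [OF g(1)], of "p v"] by simp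
    have 6: "e o\<^sub>L a = a"
      by (rule blinfun_eqI) (simp add: a_def projection_idem [OF ep])
    obtain u where u: "\<And>n. u n \<in> vna" "\<And>n x. norm (blinfun_apply (u n) x) \<le> norm x"
        "\<And>n. e o\<^sub>L u n = u n" "(\<lambda>n. norm (u n (ket i))) \<longlonglongrightarrow> norm (p (ket i))"
      using minimal_projection_polar [OF 1 min [unfolded vna_def] 2 3 4 5 6] unfolding vna_def by metis
    have "norm (u m (ket i)) \<le> norm (e (ket c))" for m
    proof -
      have eu: "e (u m v) = u m v" for v
        by (metis blinfun_apply_blinfun_compose u(3))
      have um: "u m \<in> ops" "cadjoint (u m) \<in> ops"
        using u(1) vna_ops cadjoint_ops by blast+
      have "restr_op base_orbit o\<^sub>L u m = u m"
      proof (rule blinfun_eqI)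
        fix v
        have "restr_op base_orbit (e (u m v)) = e (u m v)"
          by (metis blinfun_apply_blinfun_compose e(3))
        then show "(restr_op base_orbit o\<^sub>L u m) v = u m v"
          by (simp add: eu)
      qed
      then have "norm (u m (ket i)) \<le> norm (cadjoint (u m) (ket c))"
        by (rule norm_column_le_row [OF u(1)])
      also have "cadjoint (u m) (ket c) = cadjoint (u m) (e (ket c))"
        using arg_cong [OF u(3) [of m], of "\<lambda>T. cadjoint T (ket c)"] um ep by (simp add: cadjoint_compose)
      also have "norm \<dots> \<le> norm (e (ket c))"
      proof -
        let ?y = "cadjoint (u m) (e (ket c))"
        have "(norm ?y)\<^sup>2 = inner (u m ?y) (e (ket c))"
          using inner_cadjoint [OF um(1), of ?y "e (ket c)"] by (simp add: power2_norm_eq_inner)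
        also have "\<dots> \<le> norm ?y * norm (e (ket c))"
          using norm_cauchy_schwarz [of "u m ?y" "e (ket c)"] u(2) [of m ?y]
          by (meson mult_right_mono norm_ge_zero order_trans)
        finally show ?thesis
          by (cases "norm ?y = 0") (auto simp: power2_eq_square)
      qed
      finally show ?thesis .
    qed
    then have "norm (p (ket i)) \<le> norm (e (ket c))"
      by (intro LIMSEQ_le_const2 [OF u(4)]) blast
    then have "(norm (p (ket i)))\<^sup>2 \<le> (norm (e (ket c)))\<^sup>2"
      by (intro power_mono) auto
    then show ?thesis
      using e(4) by linarith
  qed
  moreover have "(\<lambda>n. (1 / 2 :: real) ^ n) \<longlonglongrightarrow> 0"
    by (intro LIMSEQ_realpow_zero) auto
  ultimately have "(norm (p (ket i)))\<^sup>2 \<le> 0"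
    by (intro LIMSEQ_le_const) auto
  with i show False
    by simp
qed

lemma type_II_factor_vna: "type_II_factor vna"
  unfolding type_II_factor_def
proof (intro conjI factor_vna exI)
  show "\<nexists>p. minimal_projection vna p"
    using no_minimal_projection by blast
  show "finite_projection vna (restr_op base_orbit)"
    by (rule finite_projection_restr_op)
  have "restr_op base_orbit (ket c) \<noteq> 0"
    by (simp add: restr_op_ket ket_nonzero base_mem_orbit)
  then show "restr_op base_orbit \<noteq> 0"
    by (auto simp: zero_blinfun.rep_eq)
qed

lemma type_II_1_factor_vna: "base_orbit = UNIV \<Longrightarrow> type_II_1_factor vna"
  using type_II_factor_vna finite_projection_restr_op by (simp add: type_II_1_factor_def restr_op_UNIV)

lemma type_II_inf_factor_vna:
  assumes "inj \<sigma>" "\<not> surj \<sigma>" "\<And>h x. h \<in> B \<Longrightarrow> \<sigma> (h x) = h (\<sigma> x)"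
  shows "type_II_inf_factor vna"
  using type_II_factor_vna not_finite_projection_id [OF assms] by (simp add: type_II_inf_factor_def)

end

section \<open>Unitary representations of free products\<close>

text \<open>Makes complex-linearity an instance of the closure properties of commutants.\<close>

lemma commutant_empty: "commutant {} = ops"
  by (auto simp: commutant_def)

lemma eval_cspan_subset:
  assumes "(\<lambda>x. x \<rho>) ` T \<subseteq> (commutant S :: ('h::complex_hilbert_space \<Rightarrow>\<^sub>L 'h) set)" "S \<subseteq> ops"
  shows "(\<lambda>x. x \<rho>) ` cspan T \<subseteq> commutant S"
proof
  fix y
  assume "y \<in> (\<lambda>x. x \<rho>) ` cspan T"
  then obtain x where x: "x \<in> cspan T" "y = x \<rho>"
    by blast
  have "x \<rho> \<in> commutant S"
    using x(1)
  proof (induction rule: complex_vector.span_induct_alt)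
    case base
    have "0 *\<^sub>R id_blinfun \<in> commutant S"
      by (intro commutant_scaleR commutant_id)
    then show ?case
      by simp
  next
    case (step c t z)
    have "t \<rho> \<in> commutant S"
      using step(1) assms(1) by blast
    then have "c *\<^sub>C t \<rho> \<in> commutant S"
      using assms(2) by (intro commutantI)
        (auto simp: ops_scaleC_blinfun commutant_ops commutantD_apply scaleC_blinfun.rep_eq ops_scaleC subset_iff)
    then show ?case
      using step(2) by (simp add: commutant_add scaleC_fun_def)
  qed
  then show "y \<in> commutant S"
    by (simp add: x)
qed

lemma commutant_eval_cspan:
  assumes "(\<lambda>x. x \<rho>) ` T \<subseteq> (ops :: ('h::complex_hilbert_space \<Rightarrow>\<^sub>L 'h) set)"
  shows "commutant ((\<lambda>x. x \<rho>) ` cspan T) = commutant ((\<lambda>x. x \<rho>) ` T)"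
proof
  have "T \<subseteq> cspan T"
    by (simp add: complex_vector.span_superset)
  then show "commutant ((\<lambda>x. x \<rho>) ` cspan T) \<subseteq> commutant ((\<lambda>x. x \<rho>) ` T)"
    by (intro commutant_antimono image_mono)
  have "(\<lambda>x. x \<rho>) ` cspan T \<subseteq> commutant (commutant ((\<lambda>x. x \<rho>) ` T))"
    by (intro eval_cspan_subset commutant_double assms) (simp add: commutant_def subset_iff)
  then show "commutant ((\<lambda>x. x \<rho>) ` T) \<subseteq> commutant ((\<lambda>x. x \<rho>) ` cspan T)"
    using commutant_antimono commutant_triple [OF assms] by blast
qed

lemma unitary_reps_ops: "\<rho> \<in> unitary_reps G \<Longrightarrow> g \<in> carrier G \<Longrightarrow> \<rho> g \<in> ops"
  by (auto simp: unitary_reps_def unitary_group_def hom_def)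

lemma group_cstar_eval_ops:
  assumes \<rho>: "\<rho> \<in> unitary_reps G" and x: "x \<in> carrier (group_cstar G)"
  shows "x \<rho> \<in> ops"
proof -
  obtain s where s: "\<And>n::nat. s n \<in> cspan (canonical_unitary G ` carrier G)"
      "uniform_limit (unitary_reps G) s x sequentially"
    using x by (auto simp: group_cstar_def)
  have "(\<lambda>x. x \<rho>) ` canonical_unitary G ` carrier G \<subseteq> commutant {}"
    using \<rho> unitary_reps_ops by (auto simp: canonical_unitary_def commutant_empty)
  then have "s n \<rho> \<in> commutant {}" for n
    using eval_cspan_subset [of \<rho> _ "{}"] s(1) by blast
  moreover have "(\<lambda>n. s n \<rho>) \<longlonglongrightarrow> x \<rho>"
    using tendsto_uniform_limitI [OF s(2) \<rho>] .
  then have "(\<lambda>n. s n \<rho> v) \<longlonglongrightarrow> x \<rho> v" for v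
    by (intro blinfun.tendsto tendsto_const)
  ultimately have "x \<rho> \<in> commutant {}"
    by (rule commutant_limit)
  then show ?thesis
    by (simp add: commutant_empty)
qed

text \<open>The algebra consists of families indexed by the unitary representations, with pointwise
  operations, so taking a coordinate respects all of its structure.\<close>

lemma star_representation_eval:
  assumes \<rho>: "\<rho> \<in> unitary_reps G" "\<rho> \<one>\<^bsub>G\<^esub> = id_blinfun"
  shows "star_representation G (\<lambda>x. x \<rho>)"
  unfolding star_representation_def
proof (intro conjI ballI allI)
  show "(\<lambda>x. x \<rho>) \<in> ring_hom (group_cstar G) bounded_ops"
  proof (rule ring_hom_memI)
    show "x \<in> carrier (group_cstar G) \<Longrightarrow> x \<rho> \<in> ops" for x
      by (rule group_cstar_eval_ops [OF \<rho>(1)])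
    show "(x \<otimes>\<^bsub>group_cstar G\<^esub> y) \<rho> = x \<rho> \<otimes>\<^bsub>bounded_ops\<^esub> y \<rho>" for x y
      by (simp add: group_cstar_def bounded_ops_def)
    show "(x \<oplus>\<^bsub>group_cstar G\<^esub> y) \<rho> = x \<rho> \<oplus>\<^bsub>bounded_ops\<^esub> y \<rho>" for x y
      by (simp add: group_cstar_def bounded_ops_def)
    show "\<one>\<^bsub>group_cstar G\<^esub> \<rho> = \<one>\<^bsub>bounded_ops\<^esub>"
      using \<rho> by (simp add: group_cstar_def bounded_ops_def canonical_unitary_def)
  qed
  show "(c *\<^sub>C x) \<rho> = c *\<^sub>C x \<rho>" for c and x :: "'a group_cstar_elem"
    by (simp only: scaleC_fun_def)
  show "group_cstar_star x \<rho> = cadjoint (x \<rho>)" for x :: "'a group_cstar_elem"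
    by (simp only: group_cstar_star_def)
qed

text \<open>A factorisation of \<open>X\<close> through \<open>Y\<close> turns the quadratic form
  into the sum over \<open>l\<close> of the squared norms of \<open>z l\<close>, the
  \<open>l\<close>-th component of \<open>Y\<close> applied to the vector \<open>h\<close>.\<close>

lemma completely_positive_on_eval:
  assumes \<rho>: "\<rho> \<in> unitary_reps G"
  shows "completely_positive_on G R (\<lambda>x. x \<rho>)"
  unfolding completely_positive_on_def
proof (intro allI impI)
  fix n :: nat and X and h :: "nat \<Rightarrow> nat ell2"
  assume "(\<forall>i<n. \<forall>j<n. X i j \<in> R) \<and> positive_matrix G n X"
  then obtain Y where Y: "\<And>i j. i < n \<Longrightarrow> j < n \<Longrightarrow> Y i j \<in> carrier (group_cstar G)"
    "\<And>i j. i < n \<Longrightarrow> j < n \<Longrightarrow> X i j = (\<Sum>l<n. group_cstar_star (Y l i) \<otimes>\<^bsub>group_cstar G\<^esub> Y l j)"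
    unfolding positive_matrix_def by blast
  define z where "z l = (\<Sum>j<n. Y l j \<rho> (h j))" for l
  have eval_sum: "sum F A \<rho> = (\<Sum>l\<in>A. F l \<rho>)" for F :: "nat \<Rightarrow> 'a group_cstar_elem" and A
    by (induction A rule: infinite_finite_induct) simp_all
  have "cinner (X i j \<rho> (h j)) (h i) = (\<Sum>l<n. cinner (Y l j \<rho> (h j)) (Y l i \<rho> (h i)))"
    if "i < n" "j < n" for i j
    using that Y(1)
    by (simp add: Y(2) eval_sum group_cstar_def group_cstar_star_def blinfun.sum_left cinner_sum_left
        cinner_cadjoint' group_cstar_eval_ops [OF \<rho>, unfolded group_cstar_def, simplified])
  then have "(\<Sum>i<n. \<Sum>j<n. cinner (X i j \<rho> (h j)) (h i))
      = (\<Sum>i<n. \<Sum>j<n. \<Sum>l<n. cinner (Y l j \<rho> (h j)) (Y l i \<rho> (h i)))"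
    by simp
  also have "\<dots> = (\<Sum>i<n. \<Sum>l<n. \<Sum>j<n. cinner (Y l j \<rho> (h j)) (Y l i \<rho> (h i)))"
    by (intro sum.cong refl sum.swap)
  also have "\<dots> = (\<Sum>l<n. \<Sum>i<n. \<Sum>j<n. cinner (Y l j \<rho> (h j)) (Y l i \<rho> (h i)))"
    by (rule sum.swap)
  also have "\<dots> = (\<Sum>l<n. cinner (z l) (z l))"
    by (simp add: z_def cinner_sum_left cinner_sum_right)
  also have "\<dots> = complex_of_real (\<Sum>l<n. (norm (z l))\<^sup>2)"
    by (simp add: cinner_self)
  finally show "(\<Sum>i<n. \<Sum>j<n. cinner (X i j \<rho> (h j)) (h i)) \<in> \<real>\<^sub>\<ge>\<^sub>0"
    by (simp add: sum_nonneg del: of_real_sum)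
qed

lemma factorial_representation_eval:
  assumes \<rho>: "\<rho> \<in> unitary_reps G" "\<rho> \<one>\<^bsub>G\<^esub> = id_blinfun"
    and R: "(\<lambda>x. x \<rho>) ` R \<subseteq> ops" and "factor (commutant (commutant ((\<lambda>x. x \<rho>) ` R)))"
  shows "factorial_representation G R (\<lambda>x. x \<rho>)"
  unfolding factorial_representation_def
proof (intro conjI exI [of _ "\<lambda>x. x \<rho>"] ballI star_representation_eval \<rho> refl)
  show "factorial_ucp G R (\<lambda>x. x \<rho>)"
    unfolding factorial_ucp_def ucp_on_def
    using assms by (auto simp: completely_positive_on_eval scaleC_fun_def group_cstar_def canonical_unitary_def)
qed

section \<open>Reduced words and permutation representations\<close>

lemma free_cons_in_carrier:
  assumes i: "i \<in> I" and g: "g \<in> carrier (G i)" "g \<noteq> \<one>\<^bsub>G i\<^esub>" and w: "w \<in> carrier (free_product I G)"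
    and closed: "\<And>g h. g \<in> carrier (G i) \<Longrightarrow> h \<in> carrier (G i) \<Longrightarrow> g \<otimes>\<^bsub>G i\<^esub> h \<in> carrier (G i)"
  shows "free_cons G (i, g) w \<in> carrier (free_product I G)"
proof (cases w)
  case Nil
  with i g show ?thesis
    by (simp add: free_product_def)
next
  case (Cons l w')
  moreover obtain j h where "l = (j, h)"
    by (cases l)
  ultimately show ?thesis
    using w i g closed [of g h]
    by (cases w') (auto simp: free_product_def split: if_splits)
qed

lemma free_product_mult_closed:
  assumes u: "u \<in> carrier (free_product I G)" and w: "w \<in> carrier (free_product I G)"
    and closed: "\<And>i g h. i \<in> I \<Longrightarrow> g \<in> carrier (G i) \<Longrightarrow> h \<in> carrier (G i) \<Longrightarrow> g \<otimes>\<^bsub>G i\<^esub> h \<in> carrier (G i)"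
  shows "u \<otimes>\<^bsub>free_product I G\<^esub> w \<in> carrier (free_product I G)"
proof -
  have "foldr (free_cons G) u w \<in> carrier (free_product I G)"
    if "\<And>i g. (i, g) \<in> set u \<Longrightarrow> i \<in> I \<and> g \<in> carrier (G i) \<and> g \<noteq> \<one>\<^bsub>G i\<^esub>"
    using that
  proof (induction u)
    case (Cons l u)
    obtain i g where l: "l = (i, g)"
      by (cases l)
    then have "i \<in> I" "g \<in> carrier (G i)" "g \<noteq> \<one>\<^bsub>G i\<^esub>"
      using Cons.prems by auto
    moreover have "foldr (free_cons G) u w \<in> carrier (free_product I G)"
      by (rule Cons.IH) (use Cons.prems in auto)
    ultimately show ?case
      using closed by (simp add: l free_cons_in_carrier)
  qed (use w in simp)
  then show ?thesis
    using u by (auto simp: free_product_def)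
qed

definition word_action :: "('i \<Rightarrow> 'a \<Rightarrow> 'x \<Rightarrow> 'x) \<Rightarrow> ('i \<times> 'a) list \<Rightarrow> 'x \<Rightarrow> 'x" where
  "word_action \<alpha> w = foldr (\<lambda>(i, g) r. \<alpha> i g \<circ> r) w id"

lemma word_action_simps [simp]:
  "word_action \<alpha> [] = id" "word_action \<alpha> ((i, g) # w) = \<alpha> i g \<circ> word_action \<alpha> w"
  by (simp_all add: word_action_def)

text \<open>Merging and cancelling of letters take place inside a single factor, so the homomorphism
  law of that factor absorbs them. Iterated over a word, this is the universal property of the free
  product.\<close>

lemma word_action_free_cons:
  assumes "i \<in> I" "g \<in> carrier (G i)" and w: "w \<in> carrier (free_product I G)"
    and hom: "\<And>g h. g \<in> carrier (G i) \<Longrightarrow> h \<in> carrier (G i) \<Longrightarrow> \<alpha> i (g \<otimes>\<^bsub>G i\<^esub> h) = \<alpha> i g \<circ> \<alpha> i h"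
      "\<alpha> i \<one>\<^bsub>G i\<^esub> = id"
  shows "word_action \<alpha> (free_cons G (i, g) w) = \<alpha> i g \<circ> word_action \<alpha> w"
proof (cases w)
  case (Cons l w')
  obtain j h where l: "l = (j, h)"
    by (cases l)
  show ?thesis
  proof (cases "i = j")
    case True
    have h: "h \<in> carrier (G i)"
      using w Cons l True by (auto simp: free_product_def)
    have "\<alpha> i (g \<otimes>\<^bsub>G i\<^esub> h) = \<alpha> i g \<circ> \<alpha> i h"
      using hom(1) assms(2) h .
    then show ?thesis
      using hom(2) by (auto simp: Cons l True comp_assoc [symmetric])
  qed (simp add: Cons l)
qed simp

lemma word_action_mult:
  assumes u: "u \<in> carrier (free_product I G)" and w: "w \<in> carrier (free_product I G)"
    and closed: "\<And>i g h. i \<in> I \<Longrightarrow> g \<in> carrier (G i) \<Longrightarrow> h \<in> carrier (G i) \<Longrightarrow> g \<otimes>\<^bsub>G i\<^esub> h \<in> carrier (G i)"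
    and hom: "\<And>i g h. i \<in> I \<Longrightarrow> g \<in> carrier (G i) \<Longrightarrow> h \<in> carrier (G i) \<Longrightarrow> \<alpha> i (g \<otimes>\<^bsub>G i\<^esub> h) = \<alpha> i g \<circ> \<alpha> i h"
      "\<And>i. i \<in> I \<Longrightarrow> \<alpha> i \<one>\<^bsub>G i\<^esub> = id"
  shows "word_action \<alpha> (u \<otimes>\<^bsub>free_product I G\<^esub> w) = word_action \<alpha> u \<circ> word_action \<alpha> w"
proof -
  have "foldr (free_cons G) u w \<in> carrier (free_product I G)
      \<and> word_action \<alpha> (foldr (free_cons G) u w) = word_action \<alpha> u \<circ> word_action \<alpha> w"
    if "\<And>i g. (i, g) \<in> set u \<Longrightarrow> i \<in> I \<and> g \<in> carrier (G i) \<and> g \<noteq> \<one>\<^bsub>G i\<^esub>"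
    using that
  proof (induction u)
    case (Cons l u)
    obtain i g where l: "l = (i, g)"
      by (cases l)
    then have i: "i \<in> I" "g \<in> carrier (G i)" "g \<noteq> \<one>\<^bsub>G i\<^esub>"
      using Cons.prems by auto
    have IH: "foldr (free_cons G) u w \<in> carrier (free_product I G)"
      "word_action \<alpha> (foldr (free_cons G) u w) = word_action \<alpha> u \<circ> word_action \<alpha> w"
      using Cons.IH Cons.prems by (metis list.set_intros(2))+
    show ?case
      using free_cons_in_carrier [of i I g G, OF i IH(1)] word_action_free_cons [OF i(1,2) IH(1), of \<alpha>]
        closed hom i(1) by (simp add: l IH(2) comp_assoc)
  qed (use w in simp)
  moreover have "u \<otimes>\<^bsub>free_product I G\<^esub> w = foldr (free_cons G) u w"
    by (simp add: free_product_def)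
  ultimately show ?thesis
    using u by (auto simp: free_product_def)
qed

lemma word_action_bij:
  assumes "w \<in> carrier (free_product I G)" "\<And>i g. i \<in> I \<Longrightarrow> g \<in> carrier (G i) \<Longrightarrow> bij (\<alpha> i g)"
  shows "bij (word_action \<alpha> w)"
proof -
  have "\<And>i g. (i, g) \<in> set w \<Longrightarrow> bij (\<alpha> i g)"
    using assms by (auto simp: free_product_def)
  then show ?thesis
    by (induction w) (auto intro!: bij_comp)
qed

lemma perm_op_unitary: "bij g \<Longrightarrow> perm_op g \<in> carrier unitary_group"
  by (simp add: unitary_group_def perm_op_ops cadjoint_perm_op perm_op_compose bij_imp_bij_inv
      bij_is_inj bij_is_surj inv_o_cancel surj_iff [THEN iffD1] perm_op_id)

text \<open>An element of the cyclic factor is an integer between \<open>0\<close> and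
  \<open>m i - 1\<close>, hence the exponent \<open>nat g\<close>. The restriction to the carrier is
  what \<open>unitary_reps\<close> demands by extensionality.\<close>

definition perm_rep ::
    "nat set \<Rightarrow> (nat \<Rightarrow> nat) \<Rightarrow> (nat \<Rightarrow> 'x \<Rightarrow> 'x) \<Rightarrow> (nat \<times> int) list \<Rightarrow> 'x ell2 \<Rightarrow>\<^sub>L 'x ell2" where
  "perm_rep I m s = (\<lambda>w\<in>carrier (free_product I (\<lambda>i. integer_mod_group (m i))).
     perm_op (word_action (\<lambda>i g. s i ^^ nat g) w))"

lemma
  fixes s :: "nat \<Rightarrow> nat \<Rightarrow> nat"
  defines "G \<equiv> \<lambda>m i. integer_mod_group (m i)"
  assumes m: "\<And>i. i \<in> I \<Longrightarrow> 1 < m i" and s: "\<And>i. i \<in> I \<Longrightarrow> bij (s i)" "\<And>i. i \<in> I \<Longrightarrow> s i ^^ m i = id"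
  shows perm_rep_unitary: "perm_rep I m s \<in> unitary_reps (free_product I (G m))"
    and perm_rep_one: "perm_rep I m s \<one>\<^bsub>free_product I (G m)\<^esub> = id_blinfun"
    and perm_rep_letter: "i \<in> I \<Longrightarrow> perm_rep I m s [(i, 1)] = perm_op (s i)"
proof -
  let ?F = "free_product I (G m)" and ?\<alpha> = "\<lambda>i g. s i ^^ nat g"
  have carr: "carrier (G m i) = {0..<int (m i)}" if "i \<in> I" for i
    using m [OF that] by (simp add: G_def carrier_integer_mod_group)
  have mult: "g \<otimes>\<^bsub>G m i\<^esub> h = (g + h) mod int (m i)" for i g h
    by (simp add: G_def mult_integer_mod_group)
  have closed: "g \<otimes>\<^bsub>G m i\<^esub> h \<in> carrier (G m i)" if "i \<in> I" for i g h
    using m [OF that] by (simp add: carr that mult)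
  have hom: "?\<alpha> i (g \<otimes>\<^bsub>G m i\<^esub> h) = ?\<alpha> i g \<circ> ?\<alpha> i h"
    if i: "i \<in> I" and gh: "g \<in> carrier (G m i)" "h \<in> carrier (G m i)" for i g h
  proof -
    have "nat (g \<otimes>\<^bsub>G m i\<^esub> h) = (nat g + nat h) mod m i"
      using gh by (simp add: carr i mult nat_mod_distrib nat_add_distrib)
    moreover have "s i ^^ ((nat g + nat h) mod m i) = s i ^^ (nat g + nat h)"
    proof -
      have "s i ^^ (m i * k) = id" for k
        by (induction k) (simp_all add: funpow_add s(2) [OF i])
      then have "s i ^^ (nat g + nat h) = s i ^^ ((nat g + nat h) mod m i) \<circ> id"
        by (metis add.commute funpow_add mult_div_mod_eq)
      then show ?thesis
        by simp
    qed
    ultimately show ?thesis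
      by (simp add: funpow_add)
  qed
  have one: "?\<alpha> i \<one>\<^bsub>G m i\<^esub> = id" for i
    by (simp add: G_def)
  have bij: "bij (word_action ?\<alpha> w)" if "w \<in> carrier ?F" for w
    using that by (rule word_action_bij) (simp add: s(1) bij_fn)
  have rep: "perm_rep I m s w = perm_op (word_action ?\<alpha> w)" if "w \<in> carrier ?F" for w
    using that by (simp add: perm_rep_def G_def)
  show "perm_rep I m s \<in> unitary_reps ?F"
    unfolding unitary_reps_def
  proof (intro IntI homI)
    show "perm_rep I m s \<in> extensional (carrier ?F)"
      by (simp add: perm_rep_def G_def)
    show "perm_rep I m s w \<in> carrier unitary_group" if "w \<in> carrier ?F" for w
      using that by (simp add: rep bij perm_op_unitary)
    show "perm_rep I m s (u \<otimes>\<^bsub>?F\<^esub> w) = perm_rep I m s u \<otimes>\<^bsub>unitary_group\<^esub> perm_rep I m s w"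
      if uw: "u \<in> carrier ?F" "w \<in> carrier ?F" for u w
    proof -
      have "u \<otimes>\<^bsub>?F\<^esub> w \<in> carrier ?F"
        using uw closed by (rule free_product_mult_closed)
      moreover have "word_action ?\<alpha> (u \<otimes>\<^bsub>?F\<^esub> w) = word_action ?\<alpha> u \<circ> word_action ?\<alpha> w"
        using uw closed hom one by (rule word_action_mult)
      ultimately show ?thesis
        using uw by (simp add: rep unitary_group_def perm_op_compose bij)
    qed
  qed
  have "[] \<in> carrier ?F"
    by (simp add: free_product_def)
  then show "perm_rep I m s \<one>\<^bsub>?F\<^esub> = id_blinfun"
    by (simp add: rep free_product_def perm_op_id)
  assume i: "i \<in> I"
  then have "[(i, 1)] \<in> carrier ?F"
    using m by (simp add: free_product_def carr) (simp add: G_def)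
  then show "perm_rep I m s [(i, 1)] = perm_op (s i)"
    by (simp add: rep)
qed

section \<open>Coset actions of permutation groups\<close>

text \<open>Products without inverses. Closure under inverses is a separate assumption later; it
  holds for the generators used because they have finite order.\<close>

definition gen_perms :: "('y \<Rightarrow> 'y) set \<Rightarrow> ('y \<Rightarrow> 'y) set" where
  "gen_perms S = (\<lambda>l. foldr (\<circ>) l id) ` lists S"

lemma gen_id: "id \<in> gen_perms S"
  unfolding gen_perms_def by (rule image_eqI [of _ _ "[]"]) auto

lemma gen_step: "s \<in> S \<Longrightarrow> g \<in> gen_perms S \<Longrightarrow> s \<circ> g \<in> gen_perms S"
proof -
  assume "s \<in> S" "g \<in> gen_perms S"
  then obtain l where "s # l \<in> lists S" "g = foldr (\<circ>) l id"
    by (auto simp: gen_perms_def)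
  then show ?thesis
    unfolding gen_perms_def by (intro image_eqI [of _ _ "s # l"]) simp_all
qed

lemma gen_perms_induct [consumes 1, case_names id step]:
  assumes "g \<in> gen_perms S" "P id" "\<And>s g. s \<in> S \<Longrightarrow> g \<in> gen_perms S \<Longrightarrow> P g \<Longrightarrow> P (s \<circ> g)"
  shows "P g"
proof -
  obtain l where l: "l \<in> lists S" "g = foldr (\<circ>) l id"
    using assms(1) unfolding gen_perms_def by blast
  have "P (foldr (\<circ>) l id)"
    using l(1)
  proof (induction l)
    case Nil
    show "P (foldr (\<circ>) [] id)"
      using assms(2) by simp
  next
    case (Cons s l)
    have "P (foldr (\<circ>) l id)"
      by (rule Cons.IH)
    then have "P (s \<circ> foldr (\<circ>) l id)"
      using assms(3) Cons.hyps by (auto simp: gen_perms_def)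
    then show "P (foldr (\<circ>) (s # l) id)"
      by simp
  qed
  then show ?thesis
    by (simp add: l(2))
qed

lemma gen_perms_generator: "s \<in> S \<Longrightarrow> s \<in> gen_perms S"
  using gen_step [OF _ gen_id] by force

lemma gen_perms_comp: "g \<in> gen_perms S \<Longrightarrow> h \<in> gen_perms S \<Longrightarrow> g \<circ> h \<in> gen_perms S"
  by (induction rule: gen_perms_induct) (auto simp: comp_assoc intro: gen_step)

lemma gen_perms_funpow: "g \<in> gen_perms S \<Longrightarrow> g ^^ n \<in> gen_perms S"
  by (induction n) (auto intro: gen_perms_comp gen_id)

lemma gen_perms_bij: "g \<in> gen_perms S \<Longrightarrow> (\<And>s. s \<in> S \<Longrightarrow> bij s) \<Longrightarrow> bij g"
  by (induction rule: gen_perms_induct) (auto intro: bij_comp)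

lemma gen_perms_inv:
  assumes "g \<in> gen_perms S" "\<And>s. s \<in> S \<Longrightarrow> bij s" "\<And>s. s \<in> S \<Longrightarrow> inv s \<in> gen_perms S"
  shows "inv g \<in> gen_perms S"
  using assms(1)
proof (induction rule: gen_perms_induct)
  case (step s g)
  then show "inv (s \<circ> g) \<in> gen_perms S"
    using assms by (simp add: o_inv_distrib gen_perms_bij gen_perms_comp)
next
  case id
  show "inv id \<in> gen_perms S"
    by (simp only: inv_id gen_id)
qed

lemma countable_gen_perms:
  assumes "countable S"
  shows "countable (gen_perms S)"
  using assms by (simp add: gen_perms_def)

lemma funpow_pred_comp:
  assumes "0 < m"
  shows "s \<circ> s ^^ (m - 1) = s ^^ m" "s ^^ (m - 1) \<circ> s = s ^^ m"
  using funpow.simps(2) [of "m - 1" s] funpow_Suc_right [of "m - 1" s] assms by simp_all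

lemma inv_eq_funpow:
  assumes "s ^^ m = id" "0 < m"
  shows "inv s = s ^^ (m - 1)"
  using assms by (intro inv_unique_comp) (simp_all only: funpow_pred_comp)

lemma funpow_eq_id_bij:
  assumes "s ^^ m = id" "0 < m"
  shows "bij s"
  using assms by (intro o_bij [of "s ^^ (m - 1)"]) (simp_all only: funpow_pred_comp)

lemma commutant_gen_perms:
  assumes "\<And>s. s \<in> S \<Longrightarrow> bij s"
  shows "commutant (perm_op ` gen_perms S) = commutant (perm_op ` S)"
proof
  show "commutant (perm_op ` gen_perms S) \<subseteq> commutant (perm_op ` S)"
    by (intro commutant_antimono image_mono) (auto intro: gen_perms_generator)
  show "commutant (perm_op ` S) \<subseteq> commutant (perm_op ` gen_perms S)"
  proof
    fix T
    assume T: "T \<in> commutant (perm_op ` S)"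
    have "T (perm_op g x) = perm_op g (T x)" if "g \<in> gen_perms S" for g x
      using that
    proof (induction arbitrary: x rule: gen_perms_induct)
      case (step s g)
      have "perm_op (s \<circ> g) y = perm_op s (perm_op g y)" for y
        using step(1,2) assms by (simp add: perm_op_perm_op gen_perms_bij)
      then show "T (perm_op (s \<circ> g) x) = perm_op (s \<circ> g) (T x)"
        using commutantD_apply [OF T imageI [OF step(1)]] step(3) by simp
    qed (simp add: perm_op_id)
    then show "T \<in> commutant (perm_op ` gen_perms S)"
      using T by (auto intro!: commutantI simp: commutant_ops)
  qed
qed

text \<open>The orbit of an injection \<open>j\<close> under the group generated by \<open>S\<close> is the coset space of the
  pointwise stabiliser of the range of \<open>j\<close>. Precomposition with the permutations in \<open>right\<close> is
  the action of the normaliser of that stabiliser.\<close>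

locale coset_action =
  fixes S :: "('y \<Rightarrow> 'y) set" and j :: "'w \<Rightarrow> 'y"
  assumes countable_S: "countable S" and S_bij: "s \<in> S \<Longrightarrow> bij s" and S_inv: "s \<in> S \<Longrightarrow> inv s \<in> gen_perms S"
    and inj_j: "inj j" and infinite_orbit: "infinite ((\<lambda>g. g \<circ> j) ` gen_perms S)"
begin

abbreviation GG :: "('y \<Rightarrow> 'y) set" where
  "GG \<equiv> gen_perms S"

definition X :: "('w \<Rightarrow> 'y) set" where
  "X = (\<lambda>g. g \<circ> j) ` GG"

definition right :: "('w \<Rightarrow> 'w) set" where
  "right = {h. bij h \<and> j \<circ> h \<in> X}"

text \<open>The universal representation is built from representations on \<open>nat ell2\<close>,
  so the countably infinite orbit \<open>X\<close> has to be coded by natural numbers.\<close>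

definition enc :: "('w \<Rightarrow> 'y) \<Rightarrow> nat" where
  "enc = to_nat_on X"

definition dec :: "nat \<Rightarrow> 'w \<Rightarrow> 'y" where
  "dec = from_nat_into X"

definition left_code :: "('y \<Rightarrow> 'y) \<Rightarrow> nat \<Rightarrow> nat" where
  "left_code g m = enc (g \<circ> dec m)"

definition right_code :: "('w \<Rightarrow> 'w) \<Rightarrow> nat \<Rightarrow> nat" where
  "right_code h m = enc (dec m \<circ> h)"

lemma countable_X: "countable X" and infinite_X: "infinite X"
  using countable_S infinite_orbit by (simp_all add: X_def countable_gen_perms)

lemma dec_in_X: "dec m \<in> X"
  using infinite_X unfolding dec_def by (intro from_nat_into) auto

lemma dec_enc: "x \<in> X \<Longrightarrow> dec (enc x) = x"
  by (simp add: dec_def enc_def countable_X)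

lemma enc_dec: "enc (dec m) = m"
  by (simp add: dec_def enc_def countable_X infinite_X)

lemma enc_inj: "x \<in> X \<Longrightarrow> y \<in> X \<Longrightarrow> enc x = enc y \<longleftrightarrow> x = y"
  using dec_enc by metis

lemma j_in_X: "j \<in> X"
  unfolding X_def by (rule image_eqI [OF _ gen_id]) simp

lemma GG_bij: "g \<in> GG \<Longrightarrow> bij g" and GG_inv: "g \<in> GG \<Longrightarrow> inv g \<in> GG"
  using S_bij S_inv by (auto intro: gen_perms_bij gen_perms_inv)

lemma left_in_X: "g \<in> GG \<Longrightarrow> x \<in> X \<Longrightarrow> g \<circ> x \<in> X"
  unfolding X_def using gen_perms_comp by (force simp: comp_assoc [symmetric])

lemma right_in_X: "h \<in> right \<Longrightarrow> x \<in> X \<Longrightarrow> x \<circ> h \<in> X"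
proof -
  assume "h \<in> right" "x \<in> X"
  then obtain g g' where "x = g \<circ> j" "j \<circ> h = g' \<circ> j" "g \<in> GG" "g' \<in> GG"
    by (auto simp: right_def X_def)
  then have "x \<circ> h = (g \<circ> g') \<circ> j"
    by (simp add: comp_assoc)
  then show "x \<circ> h \<in> X"
    using \<open>g \<in> GG\<close> \<open>g' \<in> GG\<close> gen_perms_comp by (auto simp: X_def)
qed

lemma right_id: "id \<in> right"
  by (simp add: right_def j_in_X)

lemma right_comp: "h \<in> right \<Longrightarrow> h' \<in> right \<Longrightarrow> h \<circ> h' \<in> right"
  using right_in_X [of h' "j \<circ> h"] by (auto simp: right_def bij_comp comp_assoc)

lemma right_inv: "h \<in> right \<Longrightarrow> inv h \<in> right"
proof -
  assume h: "h \<in> right"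
  then obtain g where g: "j \<circ> h = g \<circ> j" "g \<in> GG" "bij h"
    by (auto simp: right_def X_def)
  have "j \<circ> inv h = inv g \<circ> j"
  proof
    fix w
    have "g (j (inv h w)) = j w"
      using fun_cong [OF g(1), of "inv h w"] g(3) by (simp add: bij_is_surj surj_f_inv_f)
    then show "(j \<circ> inv h) w = (inv g \<circ> j) w"
      using GG_bij [OF g(2)] by (metis bij_inv_eq_iff comp_apply)
  qed
  then show "inv h \<in> right"
    using GG_inv [OF g(2)] g(3) by (auto simp: right_def X_def bij_imp_bij_inv)
qed

lemma left_code_comp: "g \<in> GG \<Longrightarrow> g' \<in> GG \<Longrightarrow> left_code (g \<circ> g') = left_code g \<circ> left_code g'"
  by (rule ext) (simp add: left_code_def dec_enc left_in_X dec_in_X comp_assoc)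

lemma left_code_id: "left_code id = id"
  by (rule ext) (simp add: left_code_def enc_dec)

lemma left_code_funpow: "g \<in> GG \<Longrightarrow> left_code (g ^^ n) = left_code g ^^ n"
  by (induction n) (simp_all add: left_code_id left_code_comp gen_perms_funpow)

lemma left_code_enc: "g \<in> GG \<Longrightarrow> x \<in> X \<Longrightarrow> left_code g (enc x) = enc (g \<circ> x)"
  by (simp add: left_code_def dec_enc)

lemma right_code_enc: "h \<in> right \<Longrightarrow> x \<in> X \<Longrightarrow> right_code h (enc x) = enc (x \<circ> h)"
  by (simp add: right_code_def dec_enc)

text \<open>Precomposition reverses the order of products; this is harmless, since only closure of
  the set of codes is required.\<close>

lemma right_code_comp: "h \<in> right \<Longrightarrow> h' \<in> right \<Longrightarrow> right_code h \<circ> right_code h' = right_code (h' \<circ> h)"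
  by (rule ext) (simp add: right_code_def dec_enc right_in_X dec_in_X comp_assoc)

lemma right_code_id: "right_code id = id"
  by (rule ext) (simp add: right_code_def enc_dec)

lemma left_code_inv: "g \<in> GG \<Longrightarrow> bij (left_code g) \<and> inv (left_code g) = left_code (inv g)"
proof -
  assume g: "g \<in> GG"
  have "left_code g \<circ> left_code (inv g) = id" "left_code (inv g) \<circ> left_code g = id"
    using g GG_inv [OF g] GG_bij [OF g]
    by (simp_all flip: left_code_comp add: left_code_id bij_is_inj bij_is_surj surj_iff [THEN iffD1])
  then show ?thesis
    by (simp add: inv_unique_comp o_bij)
qed

lemma right_code_inv: "h \<in> right \<Longrightarrow> bij (right_code h) \<and> inv (right_code h) = right_code (inv h)"
proof -
  assume h: "h \<in> right"
  then have "bij h"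
    by (simp add: right_def)
  then have "right_code h \<circ> right_code (inv h) = id" "right_code (inv h) \<circ> right_code h = id"
    using h right_inv [OF h]
    by (simp_all add: right_code_comp right_code_id bij_is_inj bij_is_surj surj_iff [THEN iffD1])
  then show ?thesis
    by (simp add: inv_unique_comp o_bij)
qed

lemma left_code_gen_perms: "left_code ` GG = gen_perms (left_code ` S)"
proof (intro subset_antisym subsetI)
  fix y
  assume "y \<in> left_code ` GG"
  then obtain g where "g \<in> GG" "y = left_code g"
    by blast
  have "left_code g \<in> gen_perms (left_code ` S)"
    using \<open>g \<in> GG\<close>
  proof (induction rule: gen_perms_induct)
    case id
    show "left_code id \<in> gen_perms (left_code ` S)"
      by (simp only: left_code_id gen_id)
  next
    case (step s g)
    then show "left_code (s \<circ> g) \<in> gen_perms (left_code ` S)"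
      by (simp add: left_code_comp gen_perms_generator gen_step)
  qed
  then show "y \<in> gen_perms (left_code ` S)"
    by (simp add: \<open>y = left_code g\<close>)
next
  fix y
  assume "y \<in> gen_perms (left_code ` S)"
  then show "y \<in> left_code ` GG"
  proof (induction rule: gen_perms_induct)
    case id
    show ?case
      using imageI [OF gen_id, of left_code S] by (simp only: left_code_id)
  next
    case (step t y)
    then obtain s g where "s \<in> S" "t = left_code s" "g \<in> GG" "y = left_code g"
      by blast
    then have "t \<circ> y = left_code (s \<circ> g)" "s \<circ> g \<in> GG"
      by (auto simp only: left_code_comp gen_perms_generator gen_step)
    then show "t \<circ> y \<in> left_code ` GG"
      by (rule image_eqI)
  qed
qed

lemma orbit_of_j: "(\<lambda>h. h (enc j)) ` right_code ` right = enc ` (\<lambda>h. j \<circ> h) ` right"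
proof -
  have "right_code h (enc j) = enc (j \<circ> h)" if "h \<in> right" for h
    using that by (simp add: right_code_enc j_in_X)
  then show ?thesis
    unfolding image_image by (intro image_cong) auto
qed

lemma infinite_enc_image:
  assumes "infinite M" "M \<subseteq> X"
  shows "infinite (enc ` M)"
proof -
  have "inj_on enc M"
    using assms(2) enc_inj by (intro inj_onI) blast
  then show ?thesis
    using assms(1) by (simp add: finite_image_iff)
qed

text \<open>\<open>H1\<close> says that the stabiliser of \<open>j\<close> has infinite orbits off
  the base orbit, and \<open>H2\<close> that \<open>right\<close> is ICC. The decreasing sets
  \<open>K\<close> localise the involutions: a map agreeing with \<open>j\<close> on
  \<open>K n\<close> still agrees on \<open>K (Suc n)\<close> after \<open>f n\<close> is applied,
  whereas \<open>f n\<close> itself moves a point of \<open>K n\<close>.\<close>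

lemma diffuse_commuting_actionsI:
  fixes f :: "nat \<Rightarrow> 'y \<Rightarrow> 'y" and K :: "nat \<Rightarrow> 'y set"
  assumes H1: "\<And>x. x \<in> X \<Longrightarrow> x \<notin> (\<lambda>h. j \<circ> h) ` right \<Longrightarrow> infinite {g \<circ> x |g. g \<in> GG \<and> g \<circ> j = j}"
    and H2: "\<And>h. h \<in> right \<Longrightarrow> h \<noteq> id \<Longrightarrow> infinite {j \<circ> k \<circ> h \<circ> inv k |k. k \<in> right}"
    and f: "\<And>n. f n \<in> GG" "\<And>n. f n \<circ> f n = id" "\<And>m n. f m \<circ> f n = f n \<circ> f m"
      "\<And>n. \<exists>h\<in>right. f n \<circ> j = j \<circ> h"
    and K: "\<And>n. K (Suc n) \<subseteq> K n" "\<And>n y. y \<in> K (Suc n) \<Longrightarrow> f n y = y"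
      "\<And>n. \<exists>w. j w \<in> K n \<and> f n (j w) \<noteq> j w"
  shows "diffuse_commuting_actions (left_code ` GG) (right_code ` right) (enc j) (\<lambda>n. left_code (f n))
    (\<lambda>n. enc ` {x \<in> X. \<forall>w. j w \<in> K n \<longrightarrow> x w = j w})"
proof
  show "bij g" "inv g \<in> left_code ` GG" if "g \<in> left_code ` GG" for g
    using that left_code_inv GG_inv by auto
  show "bij h" "inv h \<in> right_code ` right" if "h \<in> right_code ` right" for h
    using that right_code_inv right_inv by auto
  show "id \<in> right_code ` right"
    using right_code_id right_id by (metis imageI)
  show "h \<circ> h' \<in> right_code ` right" if "h \<in> right_code ` right" "h' \<in> right_code ` right" for h h'
    using that right_code_comp right_comp by auto
  show "g (h m) = h (g m)" if "g \<in> left_code ` GG" "h \<in> right_code ` right" for g h m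
    using that by (auto simp: left_code_def right_code_def dec_enc dec_in_X left_in_X right_in_X comp_assoc)
  show "h = h'" if "h \<in> right_code ` right" "h' \<in> right_code ` right" "h m = h' m" for h h' m
  proof -
    obtain k k' where k: "k \<in> right" "h = right_code k" "k' \<in> right" "h' = right_code k'"
      using \<open>h \<in> right_code ` right\<close> \<open>h' \<in> right_code ` right\<close> by blast
    then have "dec m \<circ> k = dec m \<circ> k'"
      using \<open>h m = h' m\<close> by (simp add: right_code_def enc_inj right_in_X dec_in_X)
    moreover have "inj (dec m)"
      using dec_in_X [of m] GG_bij inj_j by (auto simp: X_def intro!: inj_compose [OF bij_is_inj])
    ultimately have "k = k'"
      by (simp add: fun_eq_iff inj_eq)
    then show ?thesis
      by (simp add: k)
  qed
  show "\<exists>g\<in>left_code ` GG. g (enc j) = m" for m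
  proof -
    obtain g where "g \<in> GG" "dec m = g \<circ> j"
      using dec_in_X [of m] by (auto simp: X_def)
    then show ?thesis
      using enc_dec [of m] by (auto simp: left_code_enc j_in_X)
  qed
  show "infinite {g m |g. g \<in> left_code ` GG \<and> g (enc j) = enc j}"
    if "m \<notin> (\<lambda>h. h (enc j)) ` right_code ` right" for m
  proof -
    have "dec m \<notin> (\<lambda>h. j \<circ> h) ` right"
      using that enc_dec [of m] unfolding orbit_of_j by (metis imageI)
    then have "infinite (enc ` {g \<circ> dec m |g. g \<in> GG \<and> g \<circ> j = j})"
      by (intro infinite_enc_image H1) (auto simp: dec_in_X left_in_X)
    moreover have "enc ` {g \<circ> dec m |g. g \<in> GG \<and> g \<circ> j = j}
        \<subseteq> {g m |g. g \<in> left_code ` GG \<and> g (enc j) = enc j}"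
    proof
      fix y
      assume "y \<in> enc ` {g \<circ> dec m |g. g \<in> GG \<and> g \<circ> j = j}"
      then obtain g where g: "y = left_code g m" "g \<in> GG" "g \<circ> j = j"
        by (auto simp: left_code_def)
      then have "left_code g (enc j) = enc j"
        by (simp add: left_code_enc j_in_X)
      with g show "y \<in> {g m |g. g \<in> left_code ` GG \<and> g (enc j) = enc j}"
        by blast
    qed
    ultimately show ?thesis
      using finite_subset by blast
  qed
  show "infinite {g (h' (h (enc j))) |g h'. g \<in> left_code ` GG \<and> h' \<in> right_code ` right \<and> g (h' (enc j)) = enc j}"
    if hB: "h \<in> right_code ` right" and hne: "h (enc j) \<noteq> enc j" for h
  proof -
    obtain k where k: "k \<in> right" "h = right_code k"
      using hB by blast
    then have "k \<noteq> id"
      using hne by (auto simp: right_code_id)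
    moreover have sub: "j \<circ> l \<circ> k \<circ> inv l \<in> X" if "l \<in> right" for l
      using that k by (intro right_in_X right_inv) (auto simp: j_in_X)
    ultimately have inf: "infinite (enc ` {j \<circ> l \<circ> k \<circ> inv l |l. l \<in> right})"
      using k by (intro infinite_enc_image H2) auto
    have enc_mem: "enc (j \<circ> l \<circ> k \<circ> inv l)
        \<in> {g (h' (h (enc j))) |g h'. g \<in> left_code ` GG \<and> h' \<in> right_code ` right \<and> g (h' (enc j)) = enc j}"
      if l: "l \<in> right" for l
    proof -
      \<comment> \<open>As \<open>l\<close> is in \<open>right\<close>, some \<open>g\<close> acts
        on \<open>j\<close> as \<open>l\<close> does. The pair \<open>g\<close> and
        \<open>inv l\<close> then fixes \<open>j\<close> and carries \<open>j \<circ> k\<close> to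
        \<open>j \<circ> l \<circ> k \<circ> inv l\<close>.\<close>
      obtain g where g: "g \<in> GG" "j \<circ> l = g \<circ> j"
        using l by (auto simp: right_def X_def)
      have "inv l \<in> right" "bij l"
        using l right_inv by (auto simp: right_def)
      have *: "g \<circ> (j \<circ> inv l) = j"
        using \<open>bij l\<close> by (simp add: comp_assoc [symmetric] flip: g(2))
          (simp add: comp_assoc bij_is_surj surj_iff [THEN iffD1])
      have "left_code g (right_code (inv l) (enc j)) = enc j"
        using * g(1) \<open>inv l \<in> right\<close> by (simp add: right_code_enc left_code_enc j_in_X right_in_X)
      moreover have "left_code g (right_code (inv l) (h (enc j))) = enc (j \<circ> l \<circ> k \<circ> inv l)"
        using g k \<open>inv l \<in> right\<close>
        by (simp add: right_code_enc left_code_enc j_in_X right_in_X g(2) comp_assoc [symmetric])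
      ultimately show ?thesis
        using g(1) \<open>inv l \<in> right\<close>
        by (intro CollectI exI [of _ "left_code g"] exI [of _ "right_code (inv l)"] conjI) simp_all
    qed
    have "enc ` {j \<circ> l \<circ> k \<circ> inv l |l. l \<in> right}
        \<subseteq> {g (h' (h (enc j))) |g h'. g \<in> left_code ` GG \<and> h' \<in> right_code ` right \<and> g (h' (enc j)) = enc j}"
      using enc_mem by (auto simp only: image_iff)
    then show ?thesis
      using inf finite_subset by blast
  qed
  show "left_code (f n) \<in> left_code ` GG" for n
    using f(1) by blast
  show "left_code (f n) (left_code (f n) m) = m" for n m
    using fun_cong [OF left_code_comp [OF f(1) f(1), of n n], of m] by (simp add: f(2) left_code_id)
  show "left_code (f m) (left_code (f n) x) = left_code (f n) (left_code (f m) x)" for m n x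
    using fun_cong [OF left_code_comp [OF f(1) f(1), of m n], of x]
      fun_cong [OF left_code_comp [OF f(1) f(1), of n m], of x] by (simp add: f(3))
  show "left_code (f n) (enc j) \<in> (\<lambda>h. h (enc j)) ` right_code ` right" for n
    using f(1,4) [of n] unfolding orbit_of_j by (auto simp: left_code_enc j_in_X)
  show "enc j \<in> enc ` {x \<in> X. \<forall>w. j w \<in> K 0 \<longrightarrow> x w = j w}"
    using j_in_X by blast
  fix n
  show "m \<in> enc ` {x \<in> X. \<forall>w. j w \<in> K (Suc n) \<longrightarrow> x w = j w}"
    "left_code (f n) m \<in> enc ` {x \<in> X. \<forall>w. j w \<in> K (Suc n) \<longrightarrow> x w = j w}"
    if m: "m \<in> enc ` {x \<in> X. \<forall>w. j w \<in> K n \<longrightarrow> x w = j w}" for m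
  proof -
    obtain x where x: "x \<in> X" "\<And>w. j w \<in> K n \<Longrightarrow> x w = j w" "m = enc x"
      using m by blast
    then show "m \<in> enc ` {x \<in> X. \<forall>w. j w \<in> K (Suc n) \<longrightarrow> x w = j w}"
      using K(1) by blast
    have "f n (x w) = j w" if "j w \<in> K (Suc n)" for w
      using x(2) [of w] K(1) [of n] K(2) [OF that] that by auto
    moreover have "f n \<circ> x \<in> X"
      using x(1) f(1) left_in_X by blast
    ultimately show "left_code (f n) m \<in> enc ` {x \<in> X. \<forall>w. j w \<in> K (Suc n) \<longrightarrow> x w = j w}"
      using x f(1) left_code_enc by auto
  qed
  show "left_code (f n) (enc j) \<notin> enc ` {x \<in> X. \<forall>w. j w \<in> K n \<longrightarrow> x w = j w}"
  proof
    assume "left_code (f n) (enc j) \<in> enc ` {x \<in> X. \<forall>w. j w \<in> K n \<longrightarrow> x w = j w}"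
    then obtain x where x: "x \<in> X" "\<And>w. j w \<in> K n \<Longrightarrow> x w = j w" "enc (f n \<circ> j) = enc x"
      using f(1) j_in_X left_code_enc by auto
    then have "f n \<circ> j = x"
      using enc_inj f(1) j_in_X left_in_X by blast
    then show False
      using K(3) [of n] x(2) by auto
  qed
qed

end

section \<open>Groups permuting blocks\<close>

abbreviation tau :: "'a \<Rightarrow> 'a \<Rightarrow> 'a \<Rightarrow> 'a" where
  "tau \<equiv> Transposition.transpose"

text \<open>The block of a point \<open>(r, n)\<close> is its first component; only the blocks \<open>r < k\<close> matter.\<close>

locale block_action =
  fixes S :: "(nat \<times> nat \<Rightarrow> nat \<times> nat) set" and k :: nat
  assumes countable_S: "countable S" and S_bij: "s \<in> S \<Longrightarrow> bij s" and S_inv: "s \<in> S \<Longrightarrow> inv s \<in> gen_perms S"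
    and S_block: "s \<in> S \<Longrightarrow> fst (s x) = fst (s y) \<longleftrightarrow> fst x = fst y"
    and S_less: "s \<in> S \<Longrightarrow> fst (s x) < k \<longleftrightarrow> fst x < k"
    and transpose_in: "r < k \<Longrightarrow> tau (r, m) (r, n) \<in> gen_perms S"
    and two_blocks: "2 \<le> k"
begin

lemma gen_block: "g \<in> gen_perms S \<Longrightarrow> fst (g x) = fst (g y) \<longleftrightarrow> fst x = fst y"
  by (induction rule: gen_perms_induct) (simp_all add: S_block)

lemma gen_less: "g \<in> gen_perms S \<Longrightarrow> fst (g x) < k \<longleftrightarrow> fst x < k"
  by (induction rule: gen_perms_induct) (simp_all add: S_less)

end

text \<open>\<open>range_maximal\<close> and \<open>infinite_outside\<close> serve the orbits of the
  stabiliser of \<open>j\<close>: a map outside the base orbit takes some value off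
  \<open>range j\<close>, and there is infinite room to move that value.
  \<open>infinite_inside\<close> serves the ICC condition, and \<open>zero_block\<close> leaves room
  for the involutions.\<close>

locale block_coset_action = block_action S k for S k +
  fixes j :: "nat \<Rightarrow> nat \<times> nat"
  assumes inj_j: "inj j" and j_less: "fst (j w) < k" and zero_block: "(0, n) \<in> range j"
    and infinite_outside: "y \<notin> range j \<Longrightarrow> fst y < k \<Longrightarrow> infinite {n. (fst y, n) \<notin> range j}"
    and range_maximal: "g \<in> gen_perms S \<Longrightarrow> g ` range j \<subseteq> range j \<Longrightarrow> g ` range j = range j"
    and infinite_inside: "g \<in> gen_perms S \<Longrightarrow> g ` range j = range j \<Longrightarrow> q \<in> range j \<Longrightarrow> g q \<noteq> q
      \<Longrightarrow> infinite {n. (fst (g q), n) \<in> range j}"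
begin

sublocale coset_action S j
proof
  obtain w where w: "j w = (0, 0)"
    using zero_block [of 0] by auto
  have "inj (\<lambda>n. tau (0, 0) (0, n) \<circ> j)"
  proof (rule injI)
    fix m n
    assume "tau (0, 0) (0, m) \<circ> j = tau (0, 0) (0, n) \<circ> j"
    then have "(tau (0, 0) (0, m) \<circ> j) w = (tau (0, 0) (0, n) \<circ> j) w"
      by simp
    then show "m = n"
      by (simp add: w)
  qed
  then have "infinite (range (\<lambda>n. tau (0, 0) (0, n) \<circ> j))"
    by (rule range_inj_infinite)
  moreover have "range (\<lambda>n. tau (0, 0) (0, n) \<circ> j) \<subseteq> (\<lambda>g. g \<circ> j) ` gen_perms S"
    using transpose_in two_blocks by auto
  ultimately show "infinite ((\<lambda>g. g \<circ> j) ` gen_perms S)"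
    using finite_subset by blast
qed (use countable_S S_bij S_inv inj_j in auto)

lemma right_of_stabiliser:
  assumes g: "g \<in> GG" "g ` range j = range j"
  shows "\<exists>h\<in>right. j \<circ> h = g \<circ> j"
proof -
  define h where "h = inv j \<circ> g \<circ> j"
  have jh: "j (h w) = g (j w)" for w
  proof -
    have "g (j w) \<in> range j"
      using g(2) by blast
    then show ?thesis
      by (simp add: h_def f_inv_into_f)
  qed
  have "inj h"
  proof (rule injI)
    fix v w
    assume "h v = h w"
    then have "g (j v) = g (j w)"
      using jh by metis
    then show "v = w"
      using GG_bij [OF g(1)] inj_j by (simp add: bij_is_inj inj_eq)
  qed
  moreover have "\<exists>v. w = h v" for w
  proof -
    obtain v where "j w = g (j v)"
      using g(2) by (metis (no_types, lifting) imageE rangeI)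
    then have "j w = j (h v)"
      by (simp add: jh)
    then show ?thesis
      using inj_j by (auto simp: inj_eq)
  qed
  then have "surj h"
    unfolding surj_def by blast
  moreover have *: "j \<circ> h = g \<circ> j"
    by (rule ext) (simp add: jh)
  ultimately have "h \<in> right"
    using g(1) by (auto simp: right_def X_def bij_def)
  then show ?thesis
    using * by blast
qed

lemma stabiliser_of_right:
  assumes "h \<in> right" "j \<circ> h = g \<circ> j"
  shows "g ` range j = range j"
proof -
  have "g ` range j = range (j \<circ> h)"
    by (simp add: assms(2) image_comp)
  also have "\<dots> = j ` range h"
    by (simp only: image_comp)
  also have "range h = UNIV"
    using assms(1) by (simp add: right_def bij_is_surj)
  finally show ?thesis .
qed

lemma infinite_of_inj_image:
  assumes "infinite M" "inj_on f M" "f ` M \<subseteq> N"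
  shows "infinite N"
  using assms finite_subset finite_imageD by metis

text \<open>The involutions are disjoint transpositions of neighbours in block \<open>0\<close>, and
  the sets \<open>K\<close> are tails of that block: the \<open>n\<close>-th transposition lives at
  the start of the \<open>n\<close>-th tail and fixes the next tail pointwise.\<close>

lemma diffuse:
  "diffuse_commuting_actions (left_code ` GG) (right_code ` right) (enc j)
    (\<lambda>n. left_code (tau (0, 2 * n) (0, Suc (2 * n))))
    (\<lambda>n. enc ` {x \<in> X. \<forall>w. j w \<in> {(0, m) |m. 2 * n \<le> m} \<longrightarrow> x w = j w})"
proof (rule diffuse_commuting_actionsI)
  fix x
  assume x: "x \<in> X" "x \<notin> (\<lambda>h. j \<circ> h) ` right"
  obtain g where g: "x = g \<circ> j" "g \<in> GG"
    using x(1) by (auto simp: X_def)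
  have "\<not> g ` range j \<subseteq> range j"
  proof
    assume "g ` range j \<subseteq> range j"
    then obtain h where "h \<in> right" "j \<circ> h = g \<circ> j"
      using right_of_stabiliser [OF g(2) range_maximal [OF g(2)]] by blast
    then have "x = j \<circ> h"
      by (simp add: g(1))
    with x(2) \<open>h \<in> right\<close> show False
      by blast
  qed
  then obtain w where "g (j w) \<notin> range j"
    by blast
  then have w: "x w \<notin> range j"
    by (simp add: g(1))
  define r where "r = fst (x w)"
  have r: "r < k"
    using gen_less [OF g(2)] j_less by (simp add: r_def g(1))
  have xw: "x w = (r, snd (x w))"
    by (simp add: r_def)
  \<comment> \<open>Swapping \<open>x w\<close> with another point of its block outside
    \<open>range j\<close> fixes \<open>j\<close> and changes the value of \<open>x\<close> at
    \<open>w\<close>.\<close>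
  show "infinite {g \<circ> x |g. g \<in> GG \<and> g \<circ> j = j}"
  proof (rule infinite_of_inj_image)
    show "infinite {n. (r, n) \<notin> range j}"
      unfolding r_def using w r by (intro infinite_outside) (auto simp: r_def)
    show "inj_on (\<lambda>n. tau (x w) (r, n) \<circ> x) {n. (r, n) \<notin> range j}"
    proof (rule inj_onI)
      fix m n
      assume "tau (x w) (r, m) \<circ> x = tau (x w) (r, n) \<circ> x"
      then have "(tau (x w) (r, m) \<circ> x) w = (tau (x w) (r, n) \<circ> x) w"
        by simp
      then show "m = n"
        by simp
    qed
    show "(\<lambda>n. tau (x w) (r, n) \<circ> x) ` {n. (r, n) \<notin> range j} \<subseteq> {g \<circ> x |g. g \<in> GG \<and> g \<circ> j = j}"
    proof
      fix y
      assume "y \<in> (\<lambda>n. tau (x w) (r, n) \<circ> x) ` {n. (r, n) \<notin> range j}"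
      then obtain n where n: "y = tau (x w) (r, n) \<circ> x" "(r, n) \<notin> range j"
        by blast
      have "tau (x w) (r, n) (j v) = j v" for v
        using n(2) w by (intro transpose_apply_other) (metis rangeI)+
      then have "tau (x w) (r, n) \<circ> j = j"
        by (simp add: fun_eq_iff)
      moreover have "tau (x w) (r, n) \<in> GG"
        using transpose_in [OF r, of "snd (x w)" n] xw by simp
      ultimately show "y \<in> {g \<circ> x |g. g \<in> GG \<and> g \<circ> j = j}"
        using n(1) by blast
    qed
  qed
next
  fix h
  assume h: "h \<in> right" "h \<noteq> id"
  obtain g where g: "j \<circ> h = g \<circ> j" "g \<in> GG"
    using h(1) by (auto simp: right_def X_def)
  obtain w where w: "h w \<noteq> w"
    using h(2) by (auto simp: fun_eq_iff)
  have jh: "j (h w) = g (j w)"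
    using fun_cong [OF g(1), of w] by simp
  define r where "r = fst (g (j w))"
  have jhr: "j (h w) = (r, snd (j (h w)))"
    by (simp add: r_def jh)
  have r: "r < k"
    using gen_less [OF g(2)] j_less by (simp add: r_def)
  have ne: "j (h w) \<noteq> j w"
    using w inj_j by (simp add: inj_eq)
  \<comment> \<open>Conjugating by an element that swaps \<open>j (h w)\<close> with
    \<open>(r, n)\<close> makes the value at \<open>w\<close> equal to \<open>(r, n)\<close>,
    provided \<open>j w\<close> is left alone; hence the exclusion of \<open>j w\<close>.\<close>
  define M where "M = {n. (r, n) \<in> range j \<and> (r, n) \<noteq> j w}"
  have "infinite {n. (r, n) \<in> range j}"
    unfolding r_def using ne jh by (intro infinite_inside g stabiliser_of_right [OF h(1)]) auto
  moreover have "{n. (r, n) \<in> range j} \<subseteq> M \<union> {snd (j w)}"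
    by (auto simp: M_def) (metis snd_conv)
  ultimately have M: "infinite M"
    using finite_subset by (metis finite.emptyI finite_Un finite_insert)
  have ex: "\<exists>l\<in>right. j \<circ> l = tau (j (h w)) (r, n) \<circ> j" if n: "n \<in> M" for n
  proof -
    have "tau (j (h w)) (r, n) \<in> GG"
      using transpose_in [OF r, of "snd (j (h w))" n] jhr by simp
    moreover have "tau (j (h w)) (r, n) ` range j = range j"
      using n by (intro transpose_image_eq) (auto simp: M_def)
    ultimately show ?thesis
      by (rule right_of_stabiliser)
  qed
  then have "\<exists>l. \<forall>n\<in>M. l n \<in> right \<and> j \<circ> l n = tau (j (h w)) (r, n) \<circ> j"
    by (intro bchoice) blast
  then obtain l where l: "\<And>n. n \<in> M \<Longrightarrow> l n \<in> right" "\<And>n. n \<in> M \<Longrightarrow> j \<circ> l n = tau (j (h w)) (r, n) \<circ> j"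
    by blast
  have eval: "(j \<circ> l n \<circ> h \<circ> inv (l n)) w = (r, n)" if n: "n \<in> M" for n
  proof -
    have "j (l n w) = j w"
      using fun_cong [OF l(2) [OF n], of w] n ne by (auto simp: M_def)
    then have "l n w = w"
      using inj_j by (simp add: inj_eq)
    moreover have "bij (l n)"
      using l(1) [OF n] by (simp add: right_def)
    ultimately have "inv (l n) w = w"
      by (metis bij_inv_eq_iff)
    then show ?thesis
      using fun_cong [OF l(2) [OF n], of "h w"] by simp
  qed
  show "infinite {j \<circ> k \<circ> h \<circ> inv k |k. k \<in> right}"
  proof (rule infinite_of_inj_image [OF M])
    show "inj_on (\<lambda>n. j \<circ> l n \<circ> h \<circ> inv (l n)) M"
    proof (rule inj_onI)
      fix m n
      assume mn: "m \<in> M" "n \<in> M" and "j \<circ> l m \<circ> h \<circ> inv (l m) = j \<circ> l n \<circ> h \<circ> inv (l n)"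
      then have "(j \<circ> l m \<circ> h \<circ> inv (l m)) w = (j \<circ> l n \<circ> h \<circ> inv (l n)) w"
        by (rule_tac fun_cong)
      then show "m = n"
        using eval mn by simp
    qed
    show "(\<lambda>n. j \<circ> l n \<circ> h \<circ> inv (l n)) ` M \<subseteq> {j \<circ> k \<circ> h \<circ> inv k |k. k \<in> right}"
      using l(1) by blast
  qed
next
  fix m n :: nat
  let ?f = "\<lambda>n. tau (0::nat, 2 * n) (0, Suc (2 * n))"
  show f: "?f n \<in> GG"
    using transpose_in two_blocks by simp
  show "?f n \<circ> ?f n = id"
    by simp
  show "?f m \<circ> ?f n = ?f n \<circ> ?f m"
  proof (cases "m = n")
    case False
    then have "2 * m \<noteq> Suc (2 * n)" "2 * n \<noteq> Suc (2 * m)"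
      by presburger+
    with False show ?thesis
      by (auto simp: fun_eq_iff Transposition.transpose_def)
  qed simp
  have "?f n ` range j = range j"
    using zero_block by (intro transpose_image_eq) simp
  then show "\<exists>h\<in>right. ?f n \<circ> j = j \<circ> h"
    using right_of_stabiliser [OF f] by (auto simp: eq_commute)
  show "{(0, m) |m. 2 * Suc n \<le> m} \<subseteq> {(0, m) |m. 2 * n \<le> m}"
    by auto
  show "?f n y = y" if "y \<in> {(0, m) |m. 2 * Suc n \<le> m}" for y
    using that by auto
  obtain w where "j w = (0, 2 * n)"
    using zero_block [of "2 * n"] by auto
  then show "\<exists>w. j w \<in> {(0, m) |m. 2 * n \<le> m} \<and> ?f n (j w) \<noteq> j w"
    by (intro exI [of _ w]) simp
qed

end

section \<open>The two enumerations, giving type II_1 and type II_inf\<close>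

context block_action
begin

text \<open>For the type \<open>II\<^sub>1\<close> case \<open>j\<close> enumerates all blocks; for the type \<open>II\<^sub>\<infinity>\<close> case it enumerates
  block \<open>0\<close> together with one point of block \<open>1\<close>.\<close>

definition enum_all :: "nat \<Rightarrow> nat \<times> nat" where
  "enum_all m = (m mod k, m div k)"

definition enum_one :: "nat \<Rightarrow> nat \<times> nat" where
  "enum_one m = (case m of 0 \<Rightarrow> (1, 0) | Suc n \<Rightarrow> (0, n))"

lemma range_enum_all: "range enum_all = {y. fst y < k}"
proof (intro subset_antisym subsetI)
  fix y :: "nat \<times> nat"
  assume "y \<in> {y. fst y < k}"
  then show "y \<in> range enum_all"
    by (intro image_eqI [of _ _ "snd y * k + fst y"]) (auto simp: enum_all_def prod_eq_iff)
qed (use two_blocks in \<open>auto simp: enum_all_def\<close>)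

lemma range_enum_one: "range enum_one = insert (1, 0) {y. fst y = 0}"
proof (intro subset_antisym subsetI)
  fix y :: "nat \<times> nat"
  assume "y \<in> insert (1, 0) {y. fst y = 0}"
  then show "y \<in> range enum_one"
  proof
    assume "y = (1, 0)"
    then show ?thesis
      by (intro image_eqI [of _ _ 0]) (simp_all add: enum_one_def)
  next
    assume "y \<in> {y. fst y = 0}"
    then show ?thesis
      by (intro image_eqI [of _ _ "Suc (snd y)"]) (simp_all add: enum_one_def prod_eq_iff)
  qed
qed (auto simp: enum_one_def split: nat.splits)

lemma gen_enum_all: "g \<in> gen_perms S \<Longrightarrow> g ` range enum_all = range enum_all"
proof -
  assume g: "g \<in> gen_perms S"
  then have "bij g"
    using S_bij by (rule gen_perms_bij)
  then have "y \<in> g ` {y. fst y < k}" if "fst y < k" for y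
    using that gen_less [OF g, of "inv g y"] by (intro image_eqI [of _ _ "inv g y"]) (simp_all add: bij_is_surj surj_f_inv_f)
  then show ?thesis
    using gen_less [OF g] by (auto simp: range_enum_all)
qed

sublocale all: block_coset_action S k enum_all
proof
  show "inj enum_all"
  proof (rule injI)
    fix m n
    assume "enum_all m = enum_all n"
    then have "m mod k = n mod k" "m div k = n div k"
      by (simp_all add: enum_all_def)
    then show "m = n"
      by (metis div_mult_mod_eq)
  qed
  show "infinite {n. (fst (g q), n) \<in> range enum_all}"
    if "g \<in> gen_perms S" "q \<in> range enum_all" for g q
  proof -
    have "{n. (fst (g q), n) \<in> range enum_all} = UNIV"
      using that gen_less [of g q] by (simp add: range_enum_all)
    then show ?thesis
      by simp
  qed
qed (use two_blocks gen_enum_all in \<open>auto simp: range_enum_all\<close>, auto simp: enum_all_def)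

text \<open>Block \<open>0\<close> must go injectively into a single block, and the part of the
  range in any other block is at most one point; so block \<open>0\<close> goes into itself. No
  other block can then enter block \<open>0\<close>, which leaves \<open>(1, 0)\<close> only itself
  as image.\<close>

lemma stabiliser_enum_one:
  assumes g: "g \<in> gen_perms S" "g ` range enum_one \<subseteq> range enum_one"
  shows "fst (g y) = 0 \<longleftrightarrow> fst y = 0" "g (1, 0) = (1, 0)"
proof -
  have gi: "inj g"
    using gen_perms_bij [OF g(1) S_bij] by (simp add: bij_is_inj)
  have g0: "fst (g (0, 0)) = 0"
  proof (rule ccontr)
    assume ne: "fst (g (0, 0)) \<noteq> 0"
    have "g (0, n) = (1, 0)" for n
    proof -
      have "(0, n) \<in> range enum_one"
        by (simp add: range_enum_one)
      then have "g (0, n) \<in> range enum_one"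
        using g(2) by blast
      moreover have "fst (g (0, n)) = fst (g (0, 0))"
        using gen_block [OF g(1)] by simp
      ultimately show ?thesis
        using ne by (auto simp: range_enum_one)
    qed
    then have "g (0, 0) = g (0, 1)"
      by simp
    then show False
      using gi by (simp add: inj_eq)
  qed
  show *: "fst (g y) = 0 \<longleftrightarrow> fst y = 0" for y
    using gen_block [OF g(1), of y "(0, 0)"] g0 by simp
  have "(1, 0) \<in> range enum_one"
    by (simp add: range_enum_one)
  then have "g (1, 0) \<in> range enum_one"
    using g(2) by blast
  then show "g (1, 0) = (1, 0)"
    using * [of "(1, 0)"] by (auto simp: range_enum_one)
qed

sublocale one: block_coset_action S k enum_one
proof
  show "inj enum_one"
    by (rule injI) (auto simp: enum_one_def split: nat.splits)
  show "fst (enum_one w) < k" for w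
    using two_blocks by (simp add: enum_one_def split: nat.splits)
  show "(0, n) \<in> range enum_one" for n
    by (simp add: range_enum_one)
  show "infinite {n. (fst y, n) \<notin> range enum_one}" if "y \<notin> range enum_one" for y
  proof -
    have "{0<..} \<subseteq> {n. (fst y, n) \<notin> range enum_one}"
      using that by (auto simp: range_enum_one)
    then show ?thesis
      using infinite_Ioi finite_subset by blast
  qed
  fix g
  assume g: "g \<in> gen_perms S"
  show "g ` range enum_one = range enum_one" if sub: "g ` range enum_one \<subseteq> range enum_one"
  proof (intro subset_antisym sub subsetI)
    fix y
    assume y: "y \<in> range enum_one"
    have "bij g"
      using g S_bij by (rule gen_perms_bij)
    then have gy: "g (inv g y) = y" and g1: "inv g (1, 0) = (1, 0)"
      using stabiliser_enum_one(2) [OF g sub] by (metis bij_inv_eq_iff)+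
    have "inv g y \<in> range enum_one"
      using y stabiliser_enum_one(1) [OF g sub, of "inv g y"] g1 unfolding range_enum_one gy by auto
    then show "y \<in> g ` range enum_one"
      using gy by (metis imageI)
  qed
  show "infinite {n. (fst (g q), n) \<in> range enum_one}"
    if gr: "g ` range enum_one = range enum_one" and q: "q \<in> range enum_one" "g q \<noteq> q" for q
  proof -
    note st = stabiliser_enum_one [OF g, unfolded gr, OF subset_refl]
    have "fst q = 0"
      using q st(2) by (auto simp: range_enum_one)
    then have "fst (g q) = 0"
      by (simp add: st(1))
    then show ?thesis
      by (simp add: range_enum_one)
  qed
qed

text \<open>Every group element preserves the union of all blocks, hence stabilises
  \<open>range enum_all\<close> and comes from \<open>right\<close>.\<close>

lemma all_base_orbit: "(\<lambda>h. h (all.enc enum_all)) ` all.right_code ` all.right = UNIV"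
proof -
  have "m \<in> all.enc ` (\<lambda>h. enum_all \<circ> h) ` all.right" for m
  proof -
    obtain g where g: "g \<in> gen_perms S" "all.dec m = g \<circ> enum_all"
      using all.dec_in_X [of m] unfolding all.X_def by blast
    obtain h where h: "h \<in> all.right" "enum_all \<circ> h = g \<circ> enum_all"
      using all.right_of_stabiliser [OF g(1) gen_enum_all [OF g(1)]] by blast
    then have "m = all.enc (enum_all \<circ> h)"
      using all.enc_dec [of m] g(2) by simp
    then show ?thesis
      using h(1) by blast
  qed
  then show ?thesis
    unfolding all.orbit_of_j by (intro subset_antisym subset_UNIV subsetI)
qed

definition one_shift :: "nat \<Rightarrow> nat" where
  "one_shift m = one.enc ((one.dec m) (0 := (fst (one.dec m 0), Suc (snd (one.dec m 0)))))"

text \<open>The extra point is alone in its block among the values of \<open>enum_one\<close>, and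
  group elements respect blocks. So a transposition inside the block of \<open>x 0\<close> changes
  no other value of \<open>x\<close>.\<close>

lemma one_upd_in_X:
  assumes x: "x \<in> one.X"
  shows "x (0 := (fst (x 0), n)) \<in> one.X"
proof -
  obtain g where g: "g \<in> gen_perms S" "x = g \<circ> enum_one"
    using x unfolding one.X_def by blast
  let ?t = "tau (x 0) (fst (x 0), n)"
  have "fst (x 0) < k"
    using gen_less [OF g(1)] one.j_less by (simp add: g(2))
  then have t: "?t \<in> gen_perms S"
    using transpose_in [of "fst (x 0)" "snd (x 0)" n] by simp
  have "fst (x w) \<noteq> fst (x 0)" if "w \<noteq> 0" for w
    using that gen_block [OF g(1), of "enum_one w" "enum_one 0"]
    by (cases w) (simp_all add: g(2) enum_one_def)
  then have "?t (x w) = x w" if "w \<noteq> 0" for w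
    using that by (intro transpose_apply_other) (auto simp: prod_eq_iff)
  then have "x (0 := (fst (x 0), n)) = ?t \<circ> x"
    by (auto simp: fun_eq_iff)
  then show ?thesis
    using one.left_in_X [OF t x] by simp
qed

text \<open>A unilateral shift that pushes the image of the extra point along its block. It misses
  \<open>enum_one\<close>, whose second coordinate at index \<open>0\<close> is \<open>0\<close>. It
  commutes with \<open>right\<close> because elements of \<open>right\<close> fix the index
  \<open>0\<close>, as a stabiliser of the range cannot move the extra point.\<close>

lemma one_shift:
  shows "inj one_shift" "\<not> surj one_shift"
    and "h \<in> one.right_code ` one.right \<Longrightarrow> one_shift (h m) = h (one_shift m)"
proof -
  show "inj one_shift"
  proof (rule injI)
    fix m n
    let ?x = "one.dec m" and ?y = "one.dec n"
    assume "one_shift m = one_shift n"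
    then have eq: "?x (0 := (fst (?x 0), Suc (snd (?x 0)))) = ?y (0 := (fst (?y 0), Suc (snd (?y 0))))"
      by (simp add: one_shift_def one.enc_inj one_upd_in_X one.dec_in_X)
    have "?x w = ?y w" for w
      using fun_cong [OF eq, of w] by (cases "w = 0") (auto simp: prod_eq_iff)
    then have "?x = ?y"
      by blast
    then show "m = n"
      using one.enc_dec by metis
  qed
  have "one_shift m \<noteq> one.enc enum_one" for m
  proof
    let ?x = "one.dec m"
    assume "one_shift m = one.enc enum_one"
    then have "?x (0 := (fst (?x 0), Suc (snd (?x 0)))) = enum_one"
      by (simp add: one_shift_def one.enc_inj one_upd_in_X one.dec_in_X one.j_in_X)
    from fun_cong [OF this, of 0] have "(fst (?x 0), Suc (snd (?x 0))) = enum_one 0"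
      by simp
    then show False
      by (simp add: enum_one_def)
  qed
  then show "\<not> surj one_shift"
    by (metis surjD)
  assume "h \<in> one.right_code ` one.right"
  then obtain l where l: "l \<in> one.right" "h = one.right_code l"
    by blast
  obtain g where g: "g \<in> gen_perms S" "enum_one \<circ> l = g \<circ> enum_one"
    using l(1) unfolding one.right_def one.X_def by blast
  have "enum_one (l 0) = g (enum_one 0)"
    using fun_cong [OF g(2), of 0] by simp
  also have "\<dots> = enum_one 0"
    using stabiliser_enum_one(2) [OF g(1)] one.stabiliser_of_right [OF l(1) g(2)] by (simp add: enum_one_def)
  finally have l0: "l 0 = 0"
    using one.inj_j by (simp add: inj_eq)
  have "inj l"
    using l(1) by (simp add: one.right_def bij_is_inj)
  then have "l w = 0 \<longleftrightarrow> w = 0" for w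
    using inj_eq [of l w 0] l0 by simp
  then have upd: "(x (0 := c)) \<circ> l = (x \<circ> l) (0 := c)" for x :: "nat \<Rightarrow> nat \<times> nat" and c
    by (auto simp: fun_eq_iff)
  show "one_shift (h m) = h (one_shift m)"
    using l by (simp add: one_shift_def l(2) one.right_code_def one.dec_enc one.right_in_X one.dec_in_X
        one_upd_in_X upd l0)
qed

end

text \<open>Besides landing in \<open>ops\<close>, \<open>T\<close> only has to have the same
  commutant as the generators. Passing to the span or to the generated group does not change
  commutants, so both operator systems fit.\<close>

lemma (in coset_action) factorial_representation_perm_rep:
  fixes s :: "nat \<Rightarrow> 'y \<Rightarrow> 'y" and I m T
  defines "G \<equiv> free_product I (\<lambda>i. integer_mod_group (m i))" and "\<rho> \<equiv> perm_rep I m (\<lambda>i. left_code (s i))"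
  assumes S: "S = s ` I" and m: "\<And>i. i \<in> I \<Longrightarrow> 1 < m i" and s: "\<And>i. i \<in> I \<Longrightarrow> s i ^^ m i = id"
    and diffuse: "diffuse_commuting_actions (left_code ` GG) B c F N"
    and T: "(\<lambda>x. x \<rho>) ` T \<subseteq> ops" "commutant ((\<lambda>x. x \<rho>) ` T) = commutant (perm_op ` left_code ` S)"
  shows "(\<lambda>h. h c) ` B = UNIV \<Longrightarrow> factorial_representation_II_1 G (cspan T) (\<lambda>x. x \<rho>)"
    and "inj \<sigma> \<Longrightarrow> \<not> surj \<sigma> \<Longrightarrow> (\<And>h x. h \<in> B \<Longrightarrow> \<sigma> (h x) = h (\<sigma> x))
      \<Longrightarrow> factorial_representation_II_inf G (cspan T) (\<lambda>x. x \<rho>)"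
proof -
  interpret D: diffuse_commuting_actions "left_code ` GG" B c F N
    by (rule diffuse)
  have sS: "s i \<in> GG" if "i \<in> I" for i
    using that by (auto simp: S intro: gen_perms_generator)
  have bij: "bij (left_code (s i))" and pow: "left_code (s i) ^^ m i = id" if "i \<in> I" for i
    using that left_code_inv [OF sS] by (simp_all flip: left_code_funpow add: sS s left_code_id)
  have \<rho>: "\<rho> \<in> unitary_reps G" "\<rho> \<one>\<^bsub>G\<^esub> = id_blinfun"
    unfolding \<rho>_def G_def using m bij pow by (auto intro: perm_rep_unitary perm_rep_one)
  have "commutant ((\<lambda>x. x \<rho>) ` cspan T) = commutant (perm_op ` left_code ` S)"
    by (simp add: commutant_eval_cspan T)
  also have "\<dots> = commutant (perm_op ` left_code ` GG)"
    unfolding left_code_gen_perms using bij by (intro commutant_gen_perms [symmetric]) (auto simp: S)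
  finally have vna: "commutant (commutant ((\<lambda>x. x \<rho>) ` cspan T)) = D.vna"
    by (simp add: D.vna_def)
  have "(\<lambda>x. x \<rho>) ` cspan T \<subseteq> ops"
    using eval_cspan_subset [of \<rho> T "{}"] T(1) by (simp add: commutant_empty)
  then have "factorial_representation G (cspan T) (\<lambda>x. x \<rho>)"
    using D.factor_vna by (intro factorial_representation_eval \<rho>) (simp_all add: vna)
  then show "(\<lambda>h. h c) ` B = UNIV \<Longrightarrow> factorial_representation_II_1 G (cspan T) (\<lambda>x. x \<rho>)"
    and "inj \<sigma> \<Longrightarrow> \<not> surj \<sigma> \<Longrightarrow> (\<And>h x. h \<in> B \<Longrightarrow> \<sigma> (h x) = h (\<sigma> x))
      \<Longrightarrow> factorial_representation_II_inf G (cspan T) (\<lambda>x. x \<rho>)"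
    using D.type_II_1_factor_vna D.type_II_inf_factor_vna
    by (simp_all add: factorial_representation_II_1_def factorial_representation_II_inf_def vna)
qed

section \<open>Path permutations\<close>

text \<open>Each block is a path whose edge from \<open>n\<close> to \<open>n + 1\<close> is labelled \<open>(r + n) mod k\<close>;
  \<open>path_swap k l\<close> flips all edges with label \<open>l\<close>.\<close>

fun path_swap :: "nat \<Rightarrow> nat \<Rightarrow> nat \<times> nat \<Rightarrow> nat \<times> nat" where
  "path_swap k l (r, n) =
    (if k \<le> r then (r, n)
     else if (r + n) mod k = l then (r, Suc n)
     else if 0 < n \<and> (r + (n - 1)) mod k = l then (r, n - 1)
     else (r, n))"

fun rotate_blocks :: "nat \<Rightarrow> nat \<times> nat \<Rightarrow> nat \<times> nat" where
  "rotate_blocks k (r, n) = (if r < k then Suc r mod k else r, n)"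

lemma Suc_mod_ne: "2 \<le> k \<Longrightarrow> Suc x mod k \<noteq> x mod (k::nat)"
  using mod_less_divisor [of k x] by (auto simp: mod_Suc simp del: mod_less_divisor)

text \<open>Consecutive edges carry different labels once \<open>k\<close> is at least 2, so the
  edges flipped together are disjoint.\<close>

lemma path_swap_invol:
  assumes "2 \<le> k"
  shows "path_swap k l (path_swap k l x) = x"
proof -
  obtain r n where x: "x = (r, n)"
    by (cases x)
  define c where "c i = (r + i) mod k" for i
  have c_Suc: "c (Suc i) \<noteq> c i" for i
    using Suc_mod_ne [OF assms, of "r + i"] by (simp add: c_def)
  show ?thesis
  proof (cases "r < k")
    case True
    then have swap: "path_swap k l (r, i) = (if c i = l then (r, Suc i) else if 0 < i \<and> c (i - 1) = l then (r, i - 1) else (r, i))" for i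
      by (simp add: c_def)
    consider "c n = l" | i where "n = Suc i" "c n \<noteq> l" "c i = l" | "c n \<noteq> l" "\<not> (0 < n \<and> c (n - 1) = l)"
      by (metis Suc_pred diff_Suc_1)
    then show ?thesis
    proof cases
      case 1
      then have "c (Suc n) \<noteq> l"
        using c_Suc [of n] by simp
      with 1 show ?thesis
        by (simp add: x swap del: path_swap.simps)
    next
      case 2
      then show ?thesis
        by (simp add: x swap del: path_swap.simps)
    next
      case 3
      then have "path_swap k l x = x"
        unfolding x swap by (cases n) simp_all
      then show ?thesis
        by (simp del: path_swap.simps)
    qed
  qed (simp add: x)
qed

lemma path_swap_comp: "2 \<le> k \<Longrightarrow> path_swap k l \<circ> path_swap k l = id"
  by (simp add: fun_eq_iff path_swap_invol del: path_swap.simps)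

lemma fst_path_swap: "fst (path_swap k l x) = fst x"
  by (cases x) simp

lemma rotate_blocks_funpow:
  assumes "r < k"
  shows "(rotate_blocks k ^^ i) (r, n) = ((r + i) mod k, n)"
  using assms by (induction i) (simp_all add: mod_Suc_eq)

lemma rotate_blocks_order:
  assumes "0 < k"
  shows "rotate_blocks k ^^ k = id"
proof
  fix x :: "nat \<times> nat"
  obtain r n where x: "x = (r, n)"
    by (cases x)
  have "(rotate_blocks k ^^ i) (r, n) = (r, n)" if "\<not> r < k" for i
    using that by (induction i) simp_all
  then show "(rotate_blocks k ^^ k) x = id x"
    using rotate_blocks_funpow [of r k k n] by (cases "r < k") (simp_all add: x)
qed

lemma Suc_mod_eq_iff: "l < k \<Longrightarrow> Suc x mod k = Suc l mod k \<longleftrightarrow> x mod k = (l::nat)"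
  using mod_less_divisor [of k x] by (auto simp: mod_Suc split: if_splits simp del: mod_less_divisor)

text \<open>Advancing the block by one advances every edge label by one, so the rotation conjugates
  the swaps cyclically into each other.\<close>

lemma path_swap_rotate:
  assumes "l < k"
  shows "path_swap k (Suc l mod k) \<circ> rotate_blocks k = rotate_blocks k \<circ> path_swap k l"
proof
  fix x :: "nat \<times> nat"
  obtain r n where x: "x = (r, n)"
    by (cases x)
  have label: "(Suc r mod k + i) mod k = Suc l mod k \<longleftrightarrow> (r + i) mod k = l" for i
    using Suc_mod_eq_iff [OF assms, of "r + i"] by (simp add: mod_add_left_eq)
  show "(path_swap k (Suc l mod k) \<circ> rotate_blocks k) x = (rotate_blocks k \<circ> path_swap k l) x"
  proof (cases "r < k")
    case True
    then have "\<not> k \<le> Suc r mod k"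
      using assms by (simp add: not_le)
    then have "path_swap k (Suc l mod k) (Suc r mod k, n)
        = (if (r + n) mod k = l then (Suc r mod k, Suc n)
           else if 0 < n \<and> (r + (n - 1)) mod k = l then (Suc r mod k, n - 1) else (Suc r mod k, n))"
      unfolding path_swap.simps label by (simp only: if_False)
    with True show ?thesis
      by (simp add: x del: path_swap.simps) (cases n; simp add: not_le)
  qed (simp add: x)
qed

text \<open>Two swaps with adjacent labels compose to 3-cycles on consecutive points, except at the start
  of the block where only one of the two labels occurs.\<close>

lemma path_swap_transpose:
  assumes k: "3 \<le> k" and l: "l < k"
  defines "r \<equiv> Suc l mod k"
  shows "(path_swap k r \<circ> path_swap k l) ^^ 3 = tau (r, 0) (r, 1)"
proof
  fix x :: "nat \<times> nat"
  obtain q n where x: "x = (q, n)"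
    by (cases x)
  define B where "B = path_swap k r \<circ> path_swap k l"
  define c where "c i = (q + i) mod k" for i
  have c_Suc: "c (Suc i) = Suc (c i) mod k" for i
    by (simp add: c_def mod_Suc_eq)
  have c_less: "c i < k" for i
    using k by (simp add: c_def)
  \<comment> \<open>\<open>Suc r mod k \<noteq> l\<close> says that \<open>l + 2\<close> and
    \<open>l\<close> differ modulo \<open>k\<close>; this is where \<open>3 \<le> k\<close> is used
    rather than \<open>2 \<le> k\<close>.\<close>
  have lr: "r < k" "r \<noteq> l" "Suc r mod k \<noteq> l" "Suc r mod k \<noteq> r"
    using k l by (auto simp: r_def mod_Suc split: if_splits)
  have c_r: "c (Suc i) = r \<longleftrightarrow> c i = l" for i
    using l c_less [of i] by (auto simp: c_Suc r_def mod_Suc split: if_splits)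
  have swap: "path_swap k a (q, i) = (if c i = a then (q, Suc i) else if 0 < i \<and> c (i - 1) = a then (q, i - 1) else (q, i))"
    if "q < k" for a i
    using that by (simp add: c_def)
  have pow3: "(B ^^ 3) y = B (B (B y))" for y
    by (simp add: eval_nat_numeral)
  show "((path_swap k r \<circ> path_swap k l) ^^ 3) x = tau (r, 0) (r, 1) x"
    unfolding B_def [symmetric] pow3 x
  proof (cases "q < k")
    case False
    then have "B (q, n) = (q, n)" "q \<noteq> r"
      using lr by (auto simp: B_def)
    then show "B (B (B (q, n))) = tau (r, 0) (r, 1) (q, n)"
      by simp
  next
    case True
    note swap = swap [OF True]
    have c0: "c 0 = q"
      using True by (simp add: c_def)
    have cycle: "B (q, i) = (q, i + 2)" "B (q, i + 2) = (q, i + 1)" "B (q, i + 1) = (q, i)" if "c i = l" for i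
    proof -
      have 1: "c (Suc i) = r" "c (Suc (Suc i)) = Suc r mod k"
        using that c_r [of i] c_Suc [of "Suc i"] by simp_all
      have 2: "c (i - 1) \<noteq> r" if "0 < i"
        using \<open>c i = l\<close> c_Suc [of "i - 1"] lr that by auto
      show "B (q, i) = (q, i + 2)"
        using that 1 lr by (simp add: B_def swap del: path_swap.simps)
      show "B (q, i + 2) = (q, i + 1)"
        using 1 lr by (simp add: B_def swap del: path_swap.simps)
      show "B (q, i + 1) = (q, i)"
        using that 1 2 lr by (auto simp: B_def swap simp del: path_swap.simps)
    qed
    show "B (B (B (q, n))) = tau (r, 0) (r, 1) (q, n)"
    proof (cases "\<exists>i. c i = l \<and> (n = i \<or> n = i + 1 \<or> n = i + 2)")
      case True
      then obtain i where i: "c i = l" "n = i \<or> n = i + 1 \<or> n = i + 2"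
        by blast
      \<comment> \<open>In block \<open>r\<close> the first two edges are labelled \<open>r\<close>
        and \<open>r + 1\<close>, so a 3-cycle there starts at position 2 or later and avoids both
        transposed points.\<close>
      have "i \<noteq> 0" "i \<noteq> 1" if "q = r"
        using i(1) c0 lr c_Suc [of 0] that by (metis One_nat_def)+
      then have "(q, n) \<noteq> (r, 0)" "(q, n) \<noteq> (r, 1)"
        using i(2) by auto
      then show ?thesis
        using cycle [OF i(1)] i(2) by auto
    next
      case False
      then have n0: "c n \<noteq> l" and n1: "\<And>i. n = Suc i \<Longrightarrow> c i \<noteq> l" and n2: "\<And>i. n = Suc (Suc i) \<Longrightarrow> c i \<noteq> l"
        by auto
      have fix_l: "path_swap k l (q, n) = (q, n)"
        using n0 n1 by (cases n) (simp_all add: swap del: path_swap.simps)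
      show ?thesis
      proof (cases "q = r \<and> n \<le> 1")
        case True
        then have q: "q = r"
          by blast
        have c1: "c 1 = Suc r mod k"
          using c0 c_Suc [of 0] q by simp
        have c0': "c 0 = r"
          using c0 q by simp
        have "B (q, 0) = (q, 1)" "B (q, 1) = (q, 0)"
          using c0' c1 lr by (simp_all add: B_def swap del: path_swap.simps)
        moreover have "n = 0 \<or> n = 1"
          using True by auto
        ultimately show ?thesis
          using q by auto
      next
        case False
        have "c n \<noteq> r"
        proof (cases n)
          case 0
          then show ?thesis
            using False c0 by auto
        next
          case (Suc i)
          then show ?thesis
            using n1 c_r by blast
        qed
        moreover have "c (n - 1) \<noteq> r" if "0 < n"
        proof (cases "n - 1")
          case 0
          then show ?thesis
            using False c0 that by auto
        next
          case (Suc i)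
          then show ?thesis
            using n2 [of i] c_r that by auto
        qed
        ultimately have "path_swap k r (q, n) = (q, n)"
          by (cases n) (simp_all add: swap del: path_swap.simps)
        then have "B (q, n) = (q, n)"
          using fix_l by (simp add: B_def del: path_swap.simps)
        then show ?thesis
          using False by (auto simp: Transposition.transpose_def)
      qed
    qed
  qed
qed

lemma transpose_conj_invol:
  assumes "a \<circ> a = id"
  shows "a \<circ> tau x y \<circ> a = tau (a x) (a y)"
proof
  fix z
  have aa: "a (a v) = v" for v
    using fun_cong [OF assms, of v] by simp
  have "a v = w \<longleftrightarrow> v = a w" for v w
    using aa [of v] aa [of w] by auto
  then show "(a \<circ> tau x y \<circ> a) z = tau (a x) (a y) z"
    by (simp add: Transposition.transpose_def aa)
qed

text \<open>The transposition at the end of the path is carried outwards by conjugation: the swap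
  flipping the next edge moves its far endpoint one step. Transpositions through
  \<open>(r, 0)\<close> then give all others.\<close>

lemma transpose_in_gen_perms:
  assumes k: "3 \<le> k" and swaps: "\<And>l. l < k \<Longrightarrow> path_swap k l \<in> gen_perms S" and r: "r < k"
  shows "tau (r, m) (r, n) \<in> gen_perms S"
proof -
  have conj: "tau (a x) (a y) \<in> gen_perms S" if "a \<in> gen_perms S" "a \<circ> a = id" "tau x y \<in> gen_perms S" for a x y
    using that by (simp flip: transpose_conj_invol add: gen_perms_comp)
  define l where "l = (if r = 0 then k - 1 else r - 1)"
  have l: "l < k" "Suc l mod k = r"
    using k r by (auto simp: l_def)
  have base: "tau (r, 0) (r, 1) \<in> gen_perms S"
  proof -
    have "(path_swap k r \<circ> path_swap k l) ^^ 3 \<in> gen_perms S"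
      by (intro gen_perms_funpow gen_perms_comp swaps l r)
    then show ?thesis
      using path_swap_transpose [OF k l(1)] by (simp only: l(2))
  qed
  have zero: "tau (r, 0) (r, Suc n) \<in> gen_perms S" for n
  proof (induction n)
    case 0
    then show ?case
      using base by simp
  next
    case (Suc n)
    define a where "a = path_swap k ((r + Suc n) mod k)"
    have a: "a \<in> gen_perms S" "a \<circ> a = id"
      using swaps k by (simp_all add: a_def path_swap_comp del: path_swap.simps)
    have "a (r, Suc n) = (r, Suc (Suc n))"
      using r by (simp add: a_def)
    then have *: "tau (a (r, 0)) (r, Suc (Suc n)) \<in> gen_perms S"
      using conj [OF a Suc] by simp
    \<comment> \<open>The same swap may also flip the first edge and displace the near endpoint to
      \<open>(r, 1)\<close>; conjugating by \<open>base\<close> brings it back.\<close>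
    have "a (r, 0) = (r, 0) \<or> a (r, 0) = (r, 1)"
      by (simp add: a_def)
    then show ?case
    proof
      assume "a (r, 0) = (r, 1)"
      then have "tau (r, 1) (r, Suc (Suc n)) \<in> gen_perms S"
        using * by simp
      from conj [OF base _ this] show ?case
        by simp
    qed (use * in simp)
  qed
  have zero': "tau (r, 0) (r, n) \<in> gen_perms S" for n
    using zero by (cases n) (simp_all add: gen_id)
  show ?thesis
  proof (cases "m = 0 \<or> m = n")
    case True
    then show ?thesis
      using zero' [of n] by (auto simp: gen_id)
  next
    case False
    show ?thesis
    proof (cases "n = 0")
      case True
      then show ?thesis
        using zero' [of m] by (simp add: transpose_commute)
    next
      case nz: False
      from conj [OF zero' [of m] _ zero' [of n]] show ?thesis
        using False nz by simp
    qed
  qed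
qed

lemma block_action_path_swaps:
  assumes d: "3 \<le> d"
  shows "block_action (path_swap d ` {..<d}) d"
proof
  fix s
  assume "s \<in> path_swap d ` {..<d}"
  then obtain l where l: "l < d" "s = path_swap d l"
    by blast
  have inv: "s \<circ> s = id"
    using d by (simp add: l(2) path_swap_comp)
  then show "bij s"
    using o_bij by blast
  have "inv s = s"
    using inv inv by (rule inv_unique_comp)
  then show "inv s \<in> gen_perms (path_swap d ` {..<d})"
    using l by (auto intro: gen_perms_generator)
  show "fst (s x) = fst (s y) \<longleftrightarrow> fst x = fst y" "fst (s x) < d \<longleftrightarrow> fst x < d" for x y
    by (simp_all add: l(2) fst_path_swap)
next
  show "tau (r, m) (r, n) \<in> gen_perms (path_swap d ` {..<d})" if "r < d" for r m n
    using d _ that by (rule transpose_in_gen_perms) (auto intro: gen_perms_generator)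
qed (use d in auto)

text \<open>Only one swap is a generator. The others are its conjugates by the rotation, whose
  inverse is available as a power.\<close>

lemma block_action_rotate:
  assumes k: "3 \<le> k"
  shows "block_action {rotate_blocks k, path_swap k 0} k"
proof
  let ?S = "{rotate_blocks k, path_swap k 0}"
  have rot: "rotate_blocks k ^^ k = id"
    using k by (intro rotate_blocks_order) simp
  have inv: "path_swap k 0 \<circ> path_swap k 0 = id"
    using k by (simp add: path_swap_comp)
  have swap_inv: "bij (path_swap k 0)" "inv (path_swap k 0) = path_swap k 0"
    using inv by (auto intro: o_bij inv_unique_comp)
  have rot_inv: "bij (rotate_blocks k)" "inv (rotate_blocks k) = rotate_blocks k ^^ (k - 1)"
    using funpow_eq_id_bij [OF rot] inv_eq_funpow [OF rot] k by simp_all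
  have rot_in: "rotate_blocks k \<in> gen_perms ?S" "rotate_blocks k ^^ (k - 1) \<in> gen_perms ?S"
    by (simp_all add: gen_perms_generator gen_perms_funpow)
  show "bij s" if "s \<in> ?S" for s
    using that swap_inv rot_inv by auto
  show "inv s \<in> gen_perms ?S" if "s \<in> ?S" for s
    using that swap_inv rot_inv rot_in gen_perms_generator [of "path_swap k 0" ?S] by auto
  have rot_fst: "fst (rotate_blocks k x) = (if fst x < k then Suc (fst x) mod k else fst x)" for x
    by (cases x) simp
  have inj_Suc: "Suc a mod k = Suc b mod k \<longleftrightarrow> a = b" if "a < k" "b < k" for a b
    using that Suc_mod_eq_iff [of b k a] by simp
  have Suc_less: "Suc a mod k < k" for a
    using k by simp
  show "fst (s x) = fst (s y) \<longleftrightarrow> fst x = fst y" if "s \<in> ?S" for s x y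
    using that Suc_less [of "fst x"] Suc_less [of "fst y"]
    by (auto simp: fst_path_swap rot_fst inj_Suc simp del: mod_less_divisor split: if_splits)
  show "fst (s x) < k \<longleftrightarrow> fst x < k" if "s \<in> ?S" for s x
    using that k by (auto simp: fst_path_swap rot_fst split: if_splits)
  have swaps: "path_swap k l \<in> gen_perms ?S" if "l < k" for l
    using that
  proof (induction l)
    case 0
    show "path_swap k 0 \<in> gen_perms ?S"
      by (simp add: gen_perms_generator)
  next
    case (Suc l)
    have "path_swap k (Suc l) \<circ> rotate_blocks k = rotate_blocks k \<circ> path_swap k l"
      using path_swap_rotate [of l k] Suc.prems by simp
    then have "path_swap k (Suc l) \<circ> (rotate_blocks k \<circ> inv (rotate_blocks k))
        = rotate_blocks k \<circ> path_swap k l \<circ> inv (rotate_blocks k)"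
      by (simp only: comp_assoc [symmetric])
    moreover have "rotate_blocks k \<circ> inv (rotate_blocks k) = id"
      using bij_is_surj [OF rot_inv(1)] by (simp only: surj_iff)
    ultimately have "path_swap k (Suc l) = rotate_blocks k \<circ> path_swap k l \<circ> rotate_blocks k ^^ (k - 1)"
      by (simp only: rot_inv(2) comp_id)
    moreover have "path_swap k l \<in> gen_perms ?S"
      using Suc by simp
    then have "rotate_blocks k \<circ> path_swap k l \<circ> rotate_blocks k ^^ (k - 1) \<in> gen_perms ?S"
      using rot_in by (intro gen_perms_comp)
    ultimately show "path_swap k (Suc l) \<in> gen_perms ?S"
      by simp
  qed
  show "tau (r, m) (r, n) \<in> gen_perms ?S" if "r < k" for r m n
    using k swaps that by (rule transpose_in_gen_perms)
qed (use k in auto)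

section \<open>The operator systems\<close>

lemma NC_commutant:
  fixes d :: nat and s :: "nat \<Rightarrow> nat \<Rightarrow> nat"
  defines "\<rho> \<equiv> perm_rep {..<d} (\<lambda>_. 2) s"
    and "T \<equiv> insert \<one>\<^bsub>group_cstar (NC_group d)\<^esub> ((\<lambda>i. canonical_unitary (NC_group d) [(i, 1)]) ` {..<d})"
  assumes s: "\<And>i. i < d \<Longrightarrow> bij (s i)" "\<And>i. i < d \<Longrightarrow> s i ^^ 2 = id"
  shows "(\<lambda>x. x \<rho>) ` T \<subseteq> ops" "commutant ((\<lambda>x. x \<rho>) ` T) = commutant (perm_op ` s ` {..<d})"
proof -
  have \<rho>: "\<rho> \<in> unitary_reps (NC_group d)" "\<rho> \<one>\<^bsub>NC_group d\<^esub> = id_blinfun"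
    and letter: "\<And>i. i < d \<Longrightarrow> \<rho> [(i, 1)] = perm_op (s i)"
    unfolding \<rho>_def NC_group_def using s
    by (auto intro: perm_rep_unitary perm_rep_one perm_rep_letter)
  have T: "(\<lambda>x. x \<rho>) ` T = insert id_blinfun (perm_op ` s ` {..<d})"
    using \<rho> letter by (auto simp: T_def group_cstar_def canonical_unitary_def image_iff)
  show "(\<lambda>x. x \<rho>) ` T \<subseteq> ops"
    using s by (auto simp: T ops_id perm_op_ops)
  show "commutant ((\<lambda>x. x \<rho>) ` T) = commutant (perm_op ` s ` {..<d})"
  proof -
    have "X o\<^sub>L id_blinfun = id_blinfun o\<^sub>L X" for X :: "nat ell2 \<Rightarrow>\<^sub>L nat ell2"
      by (rule blinfun_eqI) simp
    then show ?thesis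
      unfolding T by (auto simp: commutant_def)
  qed
qed

lemma NCP_commutant:
  fixes k :: nat and s :: "nat \<Rightarrow> nat \<Rightarrow> nat"
  defines "G \<equiv> NCP_group k" and "\<rho> \<equiv> perm_rep {0, 1} (\<lambda>i. if i = 0 then k else 2) s"
  defines "T \<equiv> insert (canonical_unitary G [(1, 1)])
    ((\<lambda>j::nat. canonical_unitary G [(0, 1)] [^]\<^bsub>group_cstar G\<^esub> j) ` {..<k})"
  assumes k: "2 \<le> k" and s: "bij (s 0)" "bij (s 1)" "s 0 ^^ k = id" "s 1 ^^ 2 = id"
  shows "(\<lambda>x. x \<rho>) ` T \<subseteq> ops" "commutant ((\<lambda>x. x \<rho>) ` T) = commutant (perm_op ` {s 0, s 1})"
proof -
  let ?w = "canonical_unitary G [(0, 1)]"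
  have \<rho>: "\<rho> \<in> unitary_reps G" "\<rho> \<one>\<^bsub>G\<^esub> = id_blinfun"
    and letter: "\<And>i. i \<in> {0, 1} \<Longrightarrow> \<rho> [(i, 1)] = perm_op (s i)"
    unfolding \<rho>_def G_def NCP_group_def
    by (rule perm_rep_unitary perm_rep_one perm_rep_letter; use s k in auto)+
  have pow: "(?w [^]\<^bsub>group_cstar G\<^esub> j) \<rho> = perm_op (s 0 ^^ j)" for j :: nat
  proof (induction j)
    case 0
    have "?w [^]\<^bsub>group_cstar G\<^esub> (0::nat) = canonical_unitary G \<one>\<^bsub>G\<^esub>"
      by (simp add: group_cstar_def nat_pow_def)
    then show "(?w [^]\<^bsub>group_cstar G\<^esub> (0::nat)) \<rho> = perm_op (s 0 ^^ 0)"
      using \<rho> by (simp only: canonical_unitary_def funpow.simps perm_op_id if_True)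
  next
    case (Suc j)
    have "?w [^]\<^bsub>group_cstar G\<^esub> Suc j = (?w [^]\<^bsub>group_cstar G\<^esub> j) \<otimes>\<^bsub>group_cstar G\<^esub> ?w"
      by (simp add: nat_pow_def)
    then have "(?w [^]\<^bsub>group_cstar G\<^esub> Suc j) \<rho> = (?w [^]\<^bsub>group_cstar G\<^esub> j) \<rho> o\<^sub>L ?w \<rho>"
      by (simp add: group_cstar_def)
    also have "?w \<rho> = perm_op (s 0)"
      using \<rho> letter [of 0] by (simp add: canonical_unitary_def)
    also have "(?w [^]\<^bsub>group_cstar G\<^esub> j) \<rho> o\<^sub>L perm_op (s 0) = perm_op (s 0 ^^ Suc j)"
      using s by (simp only: Suc.IH perm_op_compose bij_fn funpow_Suc_right)
    finally show ?case .
  qed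
  have T: "(\<lambda>x. x \<rho>) ` T = insert (perm_op (s 1)) ((\<lambda>j. perm_op (s 0 ^^ j)) ` {..<k})"
    using \<rho> letter pow by (simp add: T_def image_image) (simp add: canonical_unitary_def)
  show "(\<lambda>x. x \<rho>) ` T \<subseteq> ops"
    using s by (auto simp: T perm_op_ops bij_fn)
  show "commutant ((\<lambda>x. x \<rho>) ` T) = commutant (perm_op ` {s 0, s 1})"
  proof
    have "perm_op ` {s 0, s 1} \<subseteq> (\<lambda>x. x \<rho>) ` T"
      \<comment> \<open>The rotation itself is the power with exponent \<open>1\<close>, which is
        below \<open>k\<close>.\<close>
      unfolding T using k by (auto intro!: image_eqI [of _ _ 1])
    then show "commutant ((\<lambda>x. x \<rho>) ` T) \<subseteq> commutant (perm_op ` {s 0, s 1})"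
      by (rule commutant_antimono)
    have "(\<lambda>x. x \<rho>) ` T \<subseteq> perm_op ` gen_perms {s 0, s 1}"
    proof -
      have "s 0 \<in> gen_perms {s 0, s 1}" "s 1 \<in> gen_perms {s 0, s 1}"
        by (simp_all add: gen_perms_generator)
      then show ?thesis
        unfolding T by (intro insert_subsetI image_subsetI imageI gen_perms_funpow)
    qed
    then have "commutant (perm_op ` gen_perms {s 0, s 1}) \<subseteq> commutant ((\<lambda>x. x \<rho>) ` T)"
      by (rule commutant_antimono)
    then show "commutant (perm_op ` {s 0, s 1}) \<subseteq> commutant ((\<lambda>x. x \<rho>) ` T)"
      using s by (subst (asm) commutant_gen_perms) auto
  qed
qed

lemma NC_factorial:
  assumes d: "3 \<le> d"
  shows "\<exists>\<pi> :: (nat \<times> int) list group_cstar_elem \<Rightarrow> nat ell2 \<Rightarrow>\<^sub>L nat ell2.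
      factorial_representation_II_1 (NC_group d) (NC d) \<pi>"
    and "\<exists>\<pi> :: (nat \<times> int) list group_cstar_elem \<Rightarrow> nat ell2 \<Rightarrow>\<^sub>L nat ell2.
      factorial_representation_II_inf (NC_group d) (NC d) \<pi>"
proof -
  interpret block_action "path_swap d ` {..<d}" d
    using d by (rule block_action_path_swaps)
  have two: "1 < (2::nat)"
    by simp
  have pow: "path_swap d i ^^ 2 = id" for i
    using d by (simp add: eval_nat_numeral path_swap_comp del: path_swap.simps)
  have gen: "path_swap d i \<in> gen_perms (path_swap d ` {..<d})" if "i < d" for i
    using that by (intro gen_perms_generator) simp
  have all: "bij (all.left_code (path_swap d i))" "all.left_code (path_swap d i) ^^ 2 = id" if "i < d" for i
    using all.left_code_inv [OF gen [OF that]] all.left_code_funpow [OF gen [OF that], of 2]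
    by (simp_all only: pow all.left_code_id)
  have one: "bij (one.left_code (path_swap d i))" "one.left_code (path_swap d i) ^^ 2 = id" if "i < d" for i
    using one.left_code_inv [OF gen [OF that]] one.left_code_funpow [OF gen [OF that], of 2]
    by (simp_all only: pow one.left_code_id)
  have "factorial_representation_II_1 (NC_group d) (NC d)
      (\<lambda>x. x (perm_rep {..<d} (\<lambda>_. 2) (\<lambda>i. all.left_code (path_swap d i))))"
    unfolding NC_def
  proof (rule all.factorial_representation_perm_rep(1) [where m = "\<lambda>_. 2" and I = "{..<d}", folded NC_group_def,
        OF refl two pow all.diffuse _ _ all_base_orbit])
    show "commutant ((\<lambda>x. x (perm_rep {..<d} (\<lambda>_. 2) (\<lambda>i. all.left_code (path_swap d i)))) `
        insert \<one>\<^bsub>group_cstar (NC_group d)\<^esub> ((\<lambda>i. canonical_unitary (NC_group d) [(i, 1)]) ` {..<d}))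
      = commutant (perm_op ` all.left_code ` path_swap d ` {..<d})"
      using NC_commutant(2) [OF all] by (simp only: image_image)
  qed (rule NC_commutant(1) [OF all])
  then show "\<exists>\<pi> :: (nat \<times> int) list group_cstar_elem \<Rightarrow> nat ell2 \<Rightarrow>\<^sub>L nat ell2.
      factorial_representation_II_1 (NC_group d) (NC d) \<pi>"
    by blast
  have "factorial_representation_II_inf (NC_group d) (NC d)
      (\<lambda>x. x (perm_rep {..<d} (\<lambda>_. 2) (\<lambda>i. one.left_code (path_swap d i))))"
    unfolding NC_def
  proof (rule one.factorial_representation_perm_rep(2) [where m = "\<lambda>_. 2" and I = "{..<d}", folded NC_group_def,
        OF refl two pow one.diffuse _ _ one_shift])
    show "commutant ((\<lambda>x. x (perm_rep {..<d} (\<lambda>_. 2) (\<lambda>i. one.left_code (path_swap d i)))) `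
        insert \<one>\<^bsub>group_cstar (NC_group d)\<^esub> ((\<lambda>i. canonical_unitary (NC_group d) [(i, 1)]) ` {..<d}))
      = commutant (perm_op ` one.left_code ` path_swap d ` {..<d})"
      using NC_commutant(2) [OF one] by (simp only: image_image)
  qed (rule NC_commutant(1) [OF one])
  then show "\<exists>\<pi> :: (nat \<times> int) list group_cstar_elem \<Rightarrow> nat ell2 \<Rightarrow>\<^sub>L nat ell2.
      factorial_representation_II_inf (NC_group d) (NC d) \<pi>"
    by blast
qed

lemma NCP_factorial:
  assumes k: "3 \<le> k"
  shows "\<exists>\<pi> :: (nat \<times> int) list group_cstar_elem \<Rightarrow> nat ell2 \<Rightarrow>\<^sub>L nat ell2.
      factorial_representation_II_1 (NCP_group k) (NCP k) \<pi>"
    and "\<exists>\<pi> :: (nat \<times> int) list group_cstar_elem \<Rightarrow> nat ell2 \<Rightarrow>\<^sub>L nat ell2.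
      factorial_representation_II_inf (NCP_group k) (NCP k) \<pi>"
proof -
  let ?S = "{rotate_blocks k, path_swap k 0}"
  interpret block_action ?S k
    using k by (rule block_action_rotate)
  define m where "m i = (if i = 0 then k else 2)" for i :: nat
  define s where "s i = (if i = 0 then rotate_blocks k else path_swap k 0)" for i :: nat
  have S: "?S = s ` {0, 1}"
    by (auto simp: s_def)
  have m: "1 < m i" for i
    using k by (simp add: m_def)
  have pow: "s i ^^ m i = id" for i
    using k rotate_blocks_order [of k]
    by (simp add: m_def s_def eval_nat_numeral path_swap_comp del: path_swap.simps)
  have gen: "s i \<in> gen_perms ?S" for i
    by (simp add: s_def gen_perms_generator)
  have group: "NCP_group k = free_product {0, 1} (\<lambda>i. integer_mod_group (m i))"
    by (simp add: NCP_group_def m_def)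
  have k2: "2 \<le> k"
    using k by simp
  have all: "bij (all.left_code (s i))" "all.left_code (s i) ^^ m i = id" for i
    using all.left_code_inv [OF gen] all.left_code_funpow [OF gen [of i], where n = "m i"]
    by (simp_all only: pow all.left_code_id)
  have one: "bij (one.left_code (s i))" "one.left_code (s i) ^^ m i = id" for i
    using one.left_code_inv [OF gen] one.left_code_funpow [OF gen [of i], where n = "m i"]
    by (simp_all only: pow one.left_code_id)
  have m_eq: "m = (\<lambda>i. if i = 0 then k else 2)"
    by (simp add: m_def fun_eq_iff)
  have m01: "m 0 = k" "m 1 = 2"
    by (simp_all add: m_def)
  note all_comm = NCP_commutant [OF k2 all(1) all(1) all(2) [of 0, unfolded m01] all(2) [of 1, unfolded m01],
      folded m_eq]
    and one_comm = NCP_commutant [OF k2 one(1) one(1) one(2) [of 0, unfolded m01] one(2) [of 1, unfolded m01],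
      folded m_eq]
  have "factorial_representation_II_1 (NCP_group k) (NCP k) (\<lambda>x. x (perm_rep {0, 1} m (\<lambda>i. all.left_code (s i))))"
    unfolding NCP_def Let_def
  proof (rule all.factorial_representation_perm_rep(1) [OF S m pow all.diffuse _ _ all_base_orbit, folded group])
    show "commutant ((\<lambda>x. x (perm_rep {0, 1} m (\<lambda>i. all.left_code (s i)))) `
        insert (canonical_unitary (NCP_group k) [(1, 1)])
          ((\<lambda>j::nat. canonical_unitary (NCP_group k) [(0, 1)] [^]\<^bsub>group_cstar (NCP_group k)\<^esub> j) ` {..<k}))
      = commutant (perm_op ` all.left_code ` ?S)"
      using all_comm(2) by (simp add: S)
  qed (rule all_comm(1))
  then show "\<exists>\<pi> :: (nat \<times> int) list group_cstar_elem \<Rightarrow> nat ell2 \<Rightarrow>\<^sub>L nat ell2.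
      factorial_representation_II_1 (NCP_group k) (NCP k) \<pi>"
    by blast
  have "factorial_representation_II_inf (NCP_group k) (NCP k) (\<lambda>x. x (perm_rep {0, 1} m (\<lambda>i. one.left_code (s i))))"
    unfolding NCP_def Let_def
  proof (rule one.factorial_representation_perm_rep(2) [OF S m pow one.diffuse _ _ one_shift, folded group])
    show "commutant ((\<lambda>x. x (perm_rep {0, 1} m (\<lambda>i. one.left_code (s i)))) `
        insert (canonical_unitary (NCP_group k) [(1, 1)])
          ((\<lambda>j::nat. canonical_unitary (NCP_group k) [(0, 1)] [^]\<^bsub>group_cstar (NCP_group k)\<^esub> j) ` {..<k}))
      = commutant (perm_op ` one.left_code ` ?S)"
      using one_comm(2) by (simp add: S)
  qed (rule one_comm(1))
  then show "\<exists>\<pi> :: (nat \<times> int) list group_cstar_elem \<Rightarrow> nat ell2 \<Rightarrow>\<^sub>L nat ell2.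
      factorial_representation_II_inf (NCP_group k) (NCP k) \<pi>"
    by blast
qed

theorem theorem4p8:
  fixes d k :: nat
  assumes "d \<ge> 3" and "k \<ge> 3"
  shows "(\<exists>\<pi> :: (nat \<times> int) list group_cstar_elem \<Rightarrow> nat ell2 \<Rightarrow>\<^sub>L nat ell2.
           factorial_representation_II_1 (NC_group d) (NC d) \<pi>)
    \<and> (\<exists>\<pi> :: (nat \<times> int) list group_cstar_elem \<Rightarrow> nat ell2 \<Rightarrow>\<^sub>L nat ell2.
           factorial_representation_II_inf (NC_group d) (NC d) \<pi>)
    \<and> (\<exists>\<pi> :: (nat \<times> int) list group_cstar_elem \<Rightarrow> nat ell2 \<Rightarrow>\<^sub>L nat ell2.
           factorial_representation_II_1 (NCP_group k) (NCP k) \<pi>)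
    \<and> (\<exists>\<pi> :: (nat \<times> int) list group_cstar_elem \<Rightarrow> nat ell2 \<Rightarrow>\<^sub>L nat ell2.
           factorial_representation_II_inf (NCP_group k) (NCP k) \<pi>)"
  using NC_factorial [OF assms(1)] NCP_factorial [OF assms(2)] by blast

end
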